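(* There exist a polynomially bounded function $m:\mathbb{N}\to 2\mathbb{N}$ and a polynomial $q$ in $n$ such that for every $n$, with $m=m(n)$, the state $\rho=|\Phi\rangle\langle\Phi|$ on $\bigotimes_{i=1}^{m}\mathcal{H}_i$, where \[ |\Phi\rangle=\sqrt{d_{n,\frac{m}{2}}}\int \left(U|0^n\rangle\otimes\overline{U}|0^n\rangle\right)^{\otimes \frac{m}{2}}\mu(\mathrm{d}U) \] (the $i$-th factor $U|0^n\rangle\otimes\overline{U}|0^n\rangle$ lying in $\mathcal{H}_{2i-1}\otimes\mathcal{H}_{2i}$), satisfies \[ \min_{\sigma\ \mathrm{separable}}\left\Vert \left.\rho\right\vert_{\mathcal{H}_1\otimes\mathcal{H}_2}-\sigma\right\Vert_1<\frac{1}{q(n)}. \]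
   Context: For each $n$, $\mathcal{H}_1\simeq\mathcal{H}_2\simeq\cdots\simeq\mathbb{C}^{2^n}$, and $|0^n\rangle$ is a fixed unit vector (the computational basis state) of $\mathbb{C}^{2^n}$. $\mu$ is the Haar measure on $\mathrm{SU}(2^n)$ normalized so that $\int\mu(\mathrm{d}U)=1$, and $\overline{U}$ is the entrywise complex conjugate of $U$ in the computational basis. $d_{n,k}:=\dim(\mathbb{C}^{2^n})^{\odot k}=\frac{(2^n+k-1)!}{(2^n-1)!\,k!}$, where $(\mathbb{C}^{2^n})^{\odot k}$ is the symmetric subspace of $(\mathbb{C}^{2^n})^{\otimes k}$. $\left.\rho\right\vert_{\mathcal{H}_1\otimes\mathcal{H}_2}$ is the reduced density matrix of $\rho$ on the first two factors, $\Vert\cdot\Vert_1$ is the trace norm, and a state on $\mathcal{H}_1\otimes\mathcal{H}_2$ is separable if it is a convex combination of product states. *)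

theory Defs
  imports "HOL-Analysis.Analysis" "HOL-Computational_Algebra.Polynomial"
begin

(* Matrices are functions 'i => 'i => complex, read on a finite index set I. *)

definition mmult :: "'i set \<Rightarrow> ('i \<Rightarrow> 'i \<Rightarrow> complex) \<Rightarrow> ('i \<Rightarrow> 'i \<Rightarrow> complex) \<Rightarrow> ('i \<Rightarrow> 'i \<Rightarrow> complex)" where
  "mmult I A B = (\<lambda>i j. \<Sum>k\<in>I. A i k * B k j)"

definition madj :: "('i \<Rightarrow> 'i \<Rightarrow> complex) \<Rightarrow> ('i \<Rightarrow> 'i \<Rightarrow> complex)" where
  "madj A = (\<lambda>i j. cnj (A j i))"

definition mtrace :: "'i set \<Rightarrow> ('i \<Rightarrow> 'i \<Rightarrow> complex) \<Rightarrow> complex" where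
  "mtrace I A = (\<Sum>i\<in>I. A i i)"

definition hermitian_on :: "'i set \<Rightarrow> ('i \<Rightarrow> 'i \<Rightarrow> complex) \<Rightarrow> bool" where
  "hermitian_on I A \<longleftrightarrow> (\<forall>i\<in>I. \<forall>j\<in>I. A i j = cnj (A j i))"

definition psd_on :: "'i set \<Rightarrow> ('i \<Rightarrow> 'i \<Rightarrow> complex) \<Rightarrow> bool" where
  "psd_on I A \<longleftrightarrow> hermitian_on I A \<and>
     (\<forall>x :: 'i \<Rightarrow> complex. 0 \<le> Re (\<Sum>i\<in>I. \<Sum>j\<in>I. cnj (x i) * A i j * x j))"

definition supported_on :: "'i set \<Rightarrow> ('i \<Rightarrow> 'i \<Rightarrow> complex) \<Rightarrow> bool" where
  "supported_on I A \<longleftrightarrow> (\<forall>i j. \<not> (i \<in> I \<and> j \<in> I) \<longrightarrow> A i j = 0)"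

definition trace_norm :: "'i set \<Rightarrow> ('i \<Rightarrow> 'i \<Rightarrow> complex) \<Rightarrow> real" where
  "trace_norm I A = Re (mtrace I (THE B. psd_on I B \<and> supported_on I B \<and>
      (\<forall>i\<in>I. \<forall>j\<in>I. mmult I B B i j = mmult I (madj A) A i j)))"

definition density_on :: "'i set \<Rightarrow> ('i \<Rightarrow> 'i \<Rightarrow> complex) \<Rightarrow> bool" where
  "density_on I A \<longleftrightarrow> psd_on I A \<and> mtrace I A = 1"

definition mtensor :: "('a \<Rightarrow> 'a \<Rightarrow> complex) \<Rightarrow> ('b \<Rightarrow> 'b \<Rightarrow> complex) \<Rightarrow> ('a \<times> 'b \<Rightarrow> 'a \<times> 'b \<Rightarrow> complex)" where
  "mtensor A B = (\<lambda>(i, j) (i', j'). A i i' * B j j')"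

definition separable :: "nat \<Rightarrow> (nat \<times> nat \<Rightarrow> nat \<times> nat \<Rightarrow> complex) \<Rightarrow> bool" where
  "separable D \<sigma> \<longleftrightarrow> (\<exists>(k::nat) (p::nat \<Rightarrow> real) A B.
     (\<forall>i<k. 0 \<le> p i \<and> density_on {..<D} (A i) \<and> density_on {..<D} (B i)) \<and>
     (\<Sum>i<k. p i) = 1 \<and>
     \<sigma> = (\<lambda>x y. \<Sum>i<k. complex_of_real (p i) * mtensor (A i) (B i) x y))"

definition mdet :: "nat \<Rightarrow> (nat \<Rightarrow> nat \<Rightarrow> complex) \<Rightarrow> complex" where
  "mdet D U = (\<Sum>p\<in>{p. p permutes {..<D}}. of_int (sign p) * (\<Prod>i<D. U i (p i)))"

definition SU :: "nat \<Rightarrow> (nat \<Rightarrow> nat \<Rightarrow> complex) set" where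
  "SU D = {U. supported_on {..<D} U \<and>
      (\<forall>i<D. \<forall>j<D. mmult {..<D} (madj U) U i j = (if i = j then 1 else 0)) \<and>
      mdet D U = 1}"

definition haar :: "nat \<Rightarrow> (nat \<Rightarrow> nat \<Rightarrow> complex) measure" where
  "haar D = (THE M. sets M = sets (borel :: (nat \<Rightarrow> nat \<Rightarrow> complex) measure) \<and>
      emeasure M (space M) = 1 \<and> emeasure M (SU D) = 1 \<and>
      (\<forall>V\<in>SU D. distr M borel (\<lambda>U. mmult {..<D} V U) = M))"

(* d_{n,k} = dim of symmetric subspace of (C^{2^n})^{(x)k} *)
definition dsym :: "nat \<Rightarrow> nat \<Rightarrow> nat" where
  "dsym n k = (2^n + k - 1) choose k"

(* Computational basis of (C^{2^n})^{(x) m}: lists of length m with entries < 2^n.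
   Amplitudes of |Phi> = sqrt(d_{n,m/2}) * int (U|0^n> (x) conj U|0^n>)^{(x) m/2} dmu(U),
   the i-th pair occupying factors 2i-1, 2i (list positions 2i, 2i+1, 0-based). *)
definition Phi :: "nat \<Rightarrow> nat \<Rightarrow> nat list \<Rightarrow> complex" where
  "Phi n m xs = complex_of_real (sqrt (real (dsym n (m div 2)))) *
     integral\<^sup>L (haar (2^n))
       (\<lambda>U. \<Prod>i<m div 2. U (xs ! (2*i)) 0 * cnj (U (xs ! (2*i+1)) 0))"

definition rho12 :: "nat \<Rightarrow> nat \<Rightarrow> (nat \<times> nat \<Rightarrow> nat \<times> nat \<Rightarrow> complex)" where
  "rho12 n m = (\<lambda>(a, b) (a', b').
     \<Sum>ys\<in>{ys. length ys = m - 2 \<and> set ys \<subseteq> {..<2^n}}.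
        Phi n m (a # b # ys) * cnj (Phi n m (a' # b' # ys)))"

end

theory Submission
  imports Defs "HOL-Computational_Algebra.Formal_Power_Series" "HOL-Probability.Probability_Measure"
    "Jordan_Normal_Form.Determinant"
begin

text \<open>Write \<open>D = 2\<^sup>n\<close> and \<open>k = m / 2\<close>, and let \<open>\<psi>\<close>, \<open>\<phi>\<close> be independent Haar-distributed first columns. The
  entries of the reduced state are \<open>d\<^bsub>n,k\<^esub>\<close> times the moments
  \<open>E[\<psi>\<^sub>a \<psi>\<^sub>b\<^sup>* \<phi>\<^sub>a\<^sub>'\<^sup>* \<phi>\<^sub>b\<^sub>' |\<langle>\<phi>|\<psi>\<rangle>|\<^bsup>2(k-1)\<^esup>]\<close>. Invariance under
  diagonal phases and under coordinate swaps leaves only three values: \<open>s\<close> at \<open>(aa, aa)\<close>,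
  \<open>\<beta>\<close> at \<open>(ab, ab)\<close> and \<open>r\<close> at \<open>(aa, a'a')\<close>. Two sum rules, the trace and the overlap with the
  maximally entangled vector, reduce to \<open>E|\<psi>\<^sub>0|\<^bsup>2k\<^esup> = 1 / d\<^bsub>n,k\<^esub>\<close> and give
  \<open>r - \<beta> = 1 / (k D)\<close>. The matrix with \<open>r\<close> replaced by \<open>\<beta>\<close> is separable: it is a mixture of the states
  \<open>v v\<^sup>\<dagger> \<otimes> (v v\<^sup>\<dagger>)\<^sup>*\<close>, with the entries of \<open>v\<close> ranging over fourth roots of unity,
  and of \<open>|aa\<rangle>\<langle>aa|\<close>. The difference has trace norm \<open>2 (D - 1) / (k D) < 2 / k\<close>, and
  \<open>k = n + 1\<close> suffices.

  Haar measure on \<open>SU(D)\<close> is obtained by pushing normalised Lebesgue measure on a set of invertible matrices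
  through Gram--Schmidt orthonormalisation.\<close>

section \<open>Positive semidefinite square roots and the trace norm\<close>

text \<open>\<open>trace_norm\<close> and \<open>haar\<close> are definite descriptions, so nothing
  can be evaluated before positive square roots and invariant probability measures are known to
  exist and to be unique. A root of a matrix between 0 and 1 is taken as the binomial series of
  sqrt(1 - N), and uniqueness comes from a trace identity for the difference of two roots.
  Gram--Schmidt transports invariance because it commutes with left multiplication by a unitary
  matrix; swapping two Haar integrals turns left invariance into uniqueness. The gap is 1/(k D)
  because the overlap rule reads D s + D (D - 1) r = (D + k - 1)/k and the trace rule D s + D (D -
  1) \<beta> = 1: the difference (D - 1)/k is spread over D (D - 1) entries. The moments behind both
  rules follow from rotations of two coordinates. Fourth roots of unity are enough for the mixture
  because only products of four phases are averaged. The minimum over separable states is stated as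
  an infimum, which one nearby state bounds from above once trace norms are known to be
  nonnegative.\<close>

definition ip :: "'i set \<Rightarrow> ('i \<Rightarrow> complex) \<Rightarrow> ('i \<Rightarrow> complex) \<Rightarrow> complex" where
  "ip I x y = (\<Sum>i\<in>I. cnj (x i) * y i)"

definition mat_vec :: "'i set \<Rightarrow> ('i \<Rightarrow> 'i \<Rightarrow> complex) \<Rightarrow> ('i \<Rightarrow> complex) \<Rightarrow> 'i \<Rightarrow> complex" where
  "mat_vec I A x = (\<lambda>i. \<Sum>j\<in>I. A i j * x j)"

lemma ip_self: "ip I x x = complex_of_real (\<Sum>i\<in>I. (cmod (x i))\<^sup>2)"
  by (simp add: ip_def mult.commute flip: complex_norm_square)

lemma ip_self_Re: "Re (ip I x x) = (\<Sum>i\<in>I. (cmod (x i))\<^sup>2)"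
  by (simp add: ip_self)

lemma cnj_ip: "cnj (ip I x y) = ip I y x"
  by (simp add: ip_def mult.commute)

lemma ip_add_left: "ip I (\<lambda>i. x i + y i) z = ip I x z + ip I y z"
  by (simp add: ip_def algebra_simps sum.distrib)

lemma ip_add_right: "ip I z (\<lambda>i. x i + y i) = ip I z x + ip I z y"
  by (simp add: ip_def algebra_simps sum.distrib)

lemma ip_scale_left: "ip I (\<lambda>i. c * x i) z = cnj c * ip I x z"
  by (simp add: ip_def algebra_simps sum_distrib_left)

lemma ip_scale_right: "ip I z (\<lambda>i. c * x i) = c * ip I z x"
  by (simp add: ip_def algebra_simps sum_distrib_left)

lemma mat_vec_add: "mat_vec I A (\<lambda>i. x i + y i) = (\<lambda>i. mat_vec I A x i + mat_vec I A y i)"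
  by (simp add: mat_vec_def algebra_simps sum.distrib)

lemma mat_vec_scale: "mat_vec I A (\<lambda>i. c * x i) = (\<lambda>i. c * mat_vec I A x i)"
  by (simp add: mat_vec_def algebra_simps sum_distrib_left)

lemma mat_vec_mmult: "mat_vec I (mmult I A B) x = mat_vec I A (mat_vec I B x)"
proof
  fix i
  have "mat_vec I (mmult I A B) x i = (\<Sum>j\<in>I. \<Sum>k\<in>I. A i k * B k j * x j)"
    by (simp add: mat_vec_def mmult_def sum_distrib_right)
  also have "\<dots> = (\<Sum>k\<in>I. \<Sum>j\<in>I. A i k * B k j * x j)"
    by (rule sum.swap)
  finally show "mat_vec I (mmult I A B) x i = mat_vec I A (mat_vec I B x) i"
    by (simp add: mat_vec_def sum_distrib_left mult.assoc)
qed

lemma mmult_assoc: "mmult I (mmult I A B) C = mmult I A (mmult I B C)"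
  by (intro ext) (simp add: mmult_def sum_distrib_right sum_distrib_left mult.assoc, rule sum.swap)

lemma ip_mat_vec: "ip I x (mat_vec I A y) = (\<Sum>i\<in>I. \<Sum>j\<in>I. cnj (x i) * A i j * y j)"
  by (simp add: ip_def mat_vec_def sum_distrib_left mult.assoc)

lemma ip_mat_vec_adjoint: "ip I x (mat_vec I A y) = ip I (mat_vec I (madj A) x) y"
proof -
  have "ip I x (mat_vec I A y) = (\<Sum>j\<in>I. \<Sum>i\<in>I. cnj (x i) * A i j * y j)"
    unfolding ip_mat_vec by (rule sum.swap)
  then show ?thesis
    by (simp add: ip_def mat_vec_def madj_def sum_distrib_right sum_distrib_left mult_ac)
qed

lemma ip_hermitian:
  assumes "hermitian_on I A"
  shows "ip I x (mat_vec I A y) = ip I (mat_vec I A x) y"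
proof -
  have "mat_vec I (madj A) x i = mat_vec I A x i" if "i \<in> I" for i
    using assms that unfolding mat_vec_def madj_def hermitian_on_def
    by (intro sum.cong refl) (metis complex_cnj_cnj)
  then show ?thesis
    by (simp add: ip_mat_vec_adjoint) (simp add: ip_def)
qed

lemma psd_on_iff: "psd_on I A \<longleftrightarrow> hermitian_on I A \<and> (\<forall>x. 0 \<le> Re (ip I x (mat_vec I A x)))"
  by (simp add: psd_on_def ip_mat_vec)

text \<open>For \<open>a > 0\<close> the quadratic is evaluated at its vertex. The degenerate cases
  are settled at a point \<open>t\<close> chosen so that the quadratic would be at most -1
  there.\<close>

lemma discriminant_le:
  fixes a b c :: real
  assumes "\<And>t. 0 \<le> a * t\<^sup>2 + 2 * b * t + c"
  shows "b\<^sup>2 \<le> a * c"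
proof -
  have c: "0 \<le> c" using assms[of 0] by simp
  consider "a > 0" | "a \<le> 0" "b \<noteq> 0" | "a \<le> 0" "b = 0" by linarith
  then show ?thesis
  proof cases
    case 1
    have "0 \<le> a * (a * (- b / a)\<^sup>2 + 2 * b * (- b / a) + c)"
      using assms[of "- b / a"] 1 by (simp add: mult_nonneg_nonneg)
    also have "\<dots> = a * c - b\<^sup>2"
      using 1 by (simp add: field_simps power2_eq_square)
    finally show ?thesis by simp
  next
    case 2
    have "0 \<le> a * (- (c + 1) / (2 * b))\<^sup>2 + 2 * b * (- (c + 1) / (2 * b)) + c"
      by (rule assms)
    also have "\<dots> \<le> 2 * b * (- (c + 1) / (2 * b)) + c"
      using 2 by (simp add: mult_nonpos_nonneg)
    also have "\<dots> = -1" using 2 by simp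
    finally show ?thesis by simp
  next
    case 3
    have "a = 0 \<or> c = 0"
    proof (rule ccontr)
      assume h: "\<not> (a = 0 \<or> c = 0)"
      then have "a < 0" using 3 by auto
      have "0 \<le> a * (sqrt ((c + 1) / - a))\<^sup>2 + 2 * b * sqrt ((c + 1) / - a) + c"
        by (rule assms)
      also have "\<dots> = -1" using 3 \<open>a < 0\<close> c by (simp add: field_simps)
      finally show False by simp
    qed
    then show ?thesis using 3 by auto
  qed
qed

text \<open>The form at \<open>t w + v\<close> is a nonnegative quadratic in the real variable
  \<open>t\<close>; Hermitian symmetry merges its two mixed terms into twice a real part.\<close>

lemma psd_cauchy_schwarz:
  assumes "psd_on I A"
  shows "(Re (ip I w (mat_vec I A v)))\<^sup>2 \<le> Re (ip I w (mat_vec I A w)) * Re (ip I v (mat_vec I A v))"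
proof (rule discriminant_le)
  fix t :: real
  have h: "hermitian_on I A" using assms by (simp add: psd_on_iff)
  have sym: "ip I v (mat_vec I A w) = cnj (ip I w (mat_vec I A v))"
    using ip_hermitian[OF h, of v w] by (simp add: cnj_ip)
  let ?x = "\<lambda>i. of_real t * w i + v i"
  have "ip I ?x (mat_vec I A ?x) = (of_real t)\<^sup>2 * ip I w (mat_vec I A w)
      + of_real t * (ip I w (mat_vec I A v) + cnj (ip I w (mat_vec I A v))) + ip I v (mat_vec I A v)"
    unfolding mat_vec_add mat_vec_scale ip_add_left ip_add_right ip_scale_left ip_scale_right sym
    by (simp add: algebra_simps power2_eq_square)
  then have "Re (ip I ?x (mat_vec I A ?x)) = Re (ip I w (mat_vec I A w)) * t\<^sup>2
      + 2 * Re (ip I w (mat_vec I A v)) * t + Re (ip I v (mat_vec I A v))"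
    by (simp add: complex_add_cnj flip: of_real_power)
  then show "0 \<le> Re (ip I w (mat_vec I A w)) * t\<^sup>2 + 2 * Re (ip I w (mat_vec I A v)) * t + Re (ip I v (mat_vec I A v))"
    using assms unfolding psd_on_iff by metis
qed

text \<open>Cauchy--Schwarz against \<open>w = A v\<close> bounds the fourth power of the norm of
  \<open>A v\<close> by a multiple of the vanishing form.\<close>

lemma psd_kernel:
  assumes "finite I" "psd_on I A" "Re (ip I v (mat_vec I A v)) = 0" "i \<in> I"
  shows "mat_vec I A v i = 0"
proof -
  have "(Re (ip I (mat_vec I A v) (mat_vec I A v)))\<^sup>2 \<le> 0"
    using psd_cauchy_schwarz[OF assms(2), of "mat_vec I A v" v] assms(3) by simp
  then have "(\<Sum>i\<in>I. (cmod (mat_vec I A v i))\<^sup>2) = 0"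
    by (simp add: ip_self_Re)
  then show ?thesis
    using assms(1,4) by (subst (asm) sum_nonneg_eq_0_iff) auto
qed

text \<open>With \<open>X = B - C\<close>, equality of the squares says
  \<open>B X + X C = 0\<close>. Multiplying by \<open>X\<close> and taking the trace gives tr(X B X)
  + tr(X C X) = 0, a sum of nonnegative numbers, so every column of \<open>X\<close> lies in the
  kernels of \<open>B\<close> and of \<open>C\<close>. Then \<open>X X = B X - C X = 0\<close>, and
  \<open>X\<close> is Hermitian.\<close>

lemma psd_sqrt_unique:
  assumes fin: "finite I"
    and B: "psd_on I B" "supported_on I B" and C: "psd_on I C" "supported_on I C"
    and eq: "\<And>i j. i \<in> I \<Longrightarrow> j \<in> I \<Longrightarrow> mmult I B B i j = mmult I C C i j"
  shows "B = C"
proof -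
  define X where "X = (\<lambda>i j. B i j - C i j)"
  have hX: "cnj (X j i) = X i j" if "i \<in> I" "j \<in> I" for i j
    using that B(1) C(1) unfolding X_def psd_on_iff hermitian_on_def
    by (metis complex_cnj_cnj complex_cnj_diff)
  define col where "col b = (\<lambda>i. X i b)" for b
  have tr: "(\<Sum>b\<in>I. ip I (col b) (mat_vec I A (col b))) = (\<Sum>b\<in>I. \<Sum>i\<in>I. \<Sum>j\<in>I. X b i * A i j * X j b)" for A
    unfolding ip_mat_vec col_def by (intro sum.cong refl) (simp add: hX)
  have z: "(\<Sum>j\<in>I. B i j * X j b + X i j * C j b) = 0" if "i \<in> I" "b \<in> I" for i b
    using eq[OF that] by (simp add: X_def mmult_def algebra_simps sum.distrib sum_subtractf)
  \<comment> \<open>Cyclicity of the trace: tr(X C X) = tr(X X C).\<close>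
  have "(\<Sum>b\<in>I. \<Sum>i\<in>I. \<Sum>j\<in>I. X b i * C i j * X j b) = (\<Sum>b\<in>I. \<Sum>i\<in>I. \<Sum>j\<in>I. X b i * X i j * C j b)"
  proof -
    have "(\<Sum>b\<in>I. \<Sum>i\<in>I. \<Sum>j\<in>I. X b i * C i j * X j b) = (\<Sum>b\<in>I. \<Sum>j\<in>I. \<Sum>i\<in>I. X b i * C i j * X j b)"
      by (rule sum.cong[OF refl], rule sum.swap)
    also have "\<dots> = (\<Sum>j\<in>I. \<Sum>b\<in>I. \<Sum>i\<in>I. X b i * C i j * X j b)"
      by (rule sum.swap)
    finally show ?thesis by (simp add: mult_ac)
  qed
  then have "(\<Sum>b\<in>I. ip I (col b) (mat_vec I B (col b))) + (\<Sum>b\<in>I. ip I (col b) (mat_vec I C (col b)))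
      = (\<Sum>b\<in>I. \<Sum>i\<in>I. X b i * (\<Sum>j\<in>I. B i j * X j b + X i j * C j b))"
    unfolding tr by (simp add: sum.distrib sum_distrib_left algebra_simps)
  also have "\<dots> = 0" using z by simp
  finally have "Re ((\<Sum>b\<in>I. ip I (col b) (mat_vec I B (col b))) + (\<Sum>b\<in>I. ip I (col b) (mat_vec I C (col b)))) = 0"
    by (simp only: zero_complex.sel)
  then have "(\<Sum>b\<in>I. Re (ip I (col b) (mat_vec I B (col b))) + Re (ip I (col b) (mat_vec I C (col b)))) = 0"
    by (simp only: sum.distrib Re_sum plus_complex.sel)
  moreover have pos: "0 \<le> Re (ip I x (mat_vec I B x))" "0 \<le> Re (ip I x (mat_vec I C x))" for x
    using B C by (auto simp: psd_on_iff)
  ultimately have "\<forall>b\<in>I. Re (ip I (col b) (mat_vec I B (col b))) + Re (ip I (col b) (mat_vec I C (col b))) = 0"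
    using fin by (subst (asm) sum_nonneg_eq_0_iff) (auto intro: add_nonneg_nonneg)
  then have zero: "Re (ip I (col b) (mat_vec I B (col b))) = 0" "Re (ip I (col b) (mat_vec I C (col b))) = 0" if "b \<in> I" for b
    using that pos[of "col b"] by (smt (verit))+
  have "X i b = 0" if "i \<in> I" "b \<in> I" for i b
  proof -
    \<comment> \<open>This is the diagonal entry of \<open>X X\<close> at \<open>b\<close>, which is
      the squared norm of column \<open>b\<close> because \<open>X\<close> is Hermitian.\<close>
    have "mat_vec I B (col b) b - mat_vec I C (col b) b = 0"
      using psd_kernel[OF fin B(1) zero(1)] psd_kernel[OF fin C(1) zero(2)] that by simp
    then have "(\<Sum>j\<in>I. X b j * X j b) = 0"
      by (simp add: mat_vec_def col_def X_def algebra_simps sum_subtractf sum.distrib)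
    then have "ip I (col b) (col b) = 0"
      using that(2) by (simp add: ip_def col_def hX)
    then have "(\<Sum>j\<in>I. (cmod (X j b))\<^sup>2) = 0"
      by (simp add: ip_self col_def flip: of_real_power of_real_sum)
    then show ?thesis
      using fin that by (subst (asm) sum_nonneg_eq_0_iff) auto
  qed
  then show ?thesis
    using B(2) C(2) by (intro ext) (metis X_def eq_iff_diff_eq_0 supported_on_def)
qed

section \<open>Powers of a positive contraction\<close>

definition mat_id :: "'i set \<Rightarrow> 'i \<Rightarrow> 'i \<Rightarrow> complex" where
  "mat_id I = (\<lambda>i j. if i = j \<and> i \<in> I then 1 else 0)"

lemma supported_mat_id: "supported_on I (mat_id I)"
  by (auto simp: supported_on_def mat_id_def)

primrec matrix_power :: "'i set \<Rightarrow> ('i \<Rightarrow> 'i \<Rightarrow> complex) \<Rightarrow> nat \<Rightarrow> 'i \<Rightarrow> 'i \<Rightarrow> complex" where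
  "matrix_power I A 0 = mat_id I"
| "matrix_power I A (Suc n) = mmult I A (matrix_power I A n)"

lemma supported_mmult:
  assumes "supported_on I A" "supported_on I B"
  shows "supported_on I (mmult I A B)"
  using assms by (auto simp: supported_on_def mmult_def)

lemma supported_matrix_power:
  assumes "supported_on I A"
  shows "supported_on I (matrix_power I A n)"
  by (induction n) (auto simp: supported_mmult supported_mat_id assms)

lemma mmult_mat_id_left:
  assumes "finite I" "supported_on I A"
  shows "mmult I (mat_id I) A = A"
proof (intro ext)
  fix i j
  have "mmult I (mat_id I) A i j = (\<Sum>k\<in>I. if k = i then A i j else 0)"
    unfolding mmult_def mat_id_def by (intro sum.cong refl) auto
  also have "\<dots> = A i j"
    using assms by (auto simp: supported_on_def)
  finally show "mmult I (mat_id I) A i j = A i j" .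
qed

lemma mmult_mat_id_right:
  assumes "finite I" "supported_on I A"
  shows "mmult I A (mat_id I) = A"
proof (intro ext)
  fix i j
  have "mmult I A (mat_id I) i j = (\<Sum>k\<in>I. if k = j then A i j else 0)"
    unfolding mmult_def mat_id_def by (intro sum.cong refl) auto
  also have "\<dots> = A i j"
    using assms by (auto simp: supported_on_def)
  finally show "mmult I A (mat_id I) i j = A i j" .
qed

lemma mat_vec_mat_id:
  assumes "finite I" "i \<in> I"
  shows "mat_vec I (mat_id I) x i = x i"
proof -
  have "mat_vec I (mat_id I) x i = (\<Sum>k\<in>I. if k = i then x i else 0)"
    unfolding mat_vec_def mat_id_def by (intro sum.cong refl) (use assms in auto)
  then show ?thesis using assms by simp
qed

lemma matrix_power_add:
  assumes "finite I" "supported_on I A"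
  shows "matrix_power I A (m + n) = mmult I (matrix_power I A m) (matrix_power I A n)"
proof (induction m)
  case 0
  show ?case using mmult_mat_id_left[OF assms(1) supported_matrix_power[OF assms(2)], of n] by simp
next
  case (Suc m)
  then show ?case by (simp add: mmult_assoc)
qed

lemma hermitian_matrix_power:
  assumes "finite I" "supported_on I A" "hermitian_on I A"
  shows "hermitian_on I (matrix_power I A n)"
proof (induction n)
  case 0
  then show ?case by (auto simp: hermitian_on_def mat_id_def)
next
  case (Suc n)
  \<comment> \<open>The adjoint reverses the order of the factors, so \<open>A\<close> has to
    commute with its powers.\<close>
  have comm: "mmult I A (matrix_power I A n) = mmult I (matrix_power I A n) A"
  proof -
    have "mmult I (matrix_power I A n) A = matrix_power I A (n + 1)"
      using mmult_mat_id_right[OF assms(1,2)] by (simp only: matrix_power_add[OF assms(1,2)] One_nat_def matrix_power.simps)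
    then show ?thesis by simp
  qed
  show ?case
    unfolding hermitian_on_def
  proof (intro ballI)
    fix i j assume "i \<in> I" "j \<in> I"
    then have "matrix_power I A (Suc n) i j = (\<Sum>k\<in>I. cnj (matrix_power I A n j k) * cnj (A k i))"
      using Suc assms(3) unfolding hermitian_on_def mmult_def matrix_power.simps
      by (intro sum.cong refl) (metis mult.commute)
    also have "\<dots> = cnj (mmult I (matrix_power I A n) A j i)"
      by (simp add: mmult_def)
    finally show "matrix_power I A (Suc n) i j = cnj (matrix_power I A (Suc n) j i)"
      by (simp add: comm)
  qed
qed

text \<open>Cauchy--Schwarz with \<open>w = A x\<close> and \<open>v = x\<close>, together with the
  upper bound at \<open>A x\<close>, gives |A x|^4 \<le> |A x|^2 <x, A x>. Cancelling leaves |A x|^2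
  \<le> <x, A x> \<le> |x|^2.\<close>

lemma psd_contraction:
  assumes "psd_on I A" "\<And>x. Re (ip I x (mat_vec I A x)) \<le> Re (ip I x x)"
  shows "Re (ip I (mat_vec I A x) (mat_vec I A x)) \<le> Re (ip I x x)"
proof -
  let ?y = "mat_vec I A x"
  have "(Re (ip I ?y ?y))\<^sup>2 \<le> Re (ip I ?y (mat_vec I A ?y)) * Re (ip I x ?y)"
    using psd_cauchy_schwarz[OF assms(1), of ?y x] .
  also have "\<dots> \<le> Re (ip I ?y ?y) * Re (ip I x ?y)"
    using assms by (intro mult_right_mono) (auto simp: psd_on_iff)
  finally have "Re (ip I ?y ?y) * Re (ip I ?y ?y) \<le> Re (ip I ?y ?y) * Re (ip I x ?y)"
    by (simp add: power2_eq_square)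
  moreover have "0 \<le> Re (ip I ?y ?y)" "0 \<le> Re (ip I x x)"
    by (simp_all add: ip_self_Re sum_nonneg)
  ultimately have "Re (ip I ?y ?y) \<le> Re (ip I x ?y) \<or> Re (ip I ?y ?y) = 0"
    by (auto simp: mult_le_cancel_left)
  then show ?thesis
    using assms(2)[of x] \<open>0 \<le> Re (ip I x x)\<close> by linarith
qed

lemma matrix_power_contraction:
  assumes "finite I" "psd_on I A" "\<And>x. Re (ip I x (mat_vec I A x)) \<le> Re (ip I x x)"
  shows "Re (ip I (mat_vec I (matrix_power I A n) x) (mat_vec I (matrix_power I A n) x)) \<le> Re (ip I x x)"
proof (induction n)
  case 0
  then show ?case by (simp add: ip_def mat_vec_mat_id assms(1))
next
  case (Suc n)
  then show ?case
    using psd_contraction[OF assms(2,3), of "mat_vec I (matrix_power I A n) x"]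
    by (simp add: mat_vec_mmult)
qed

section \<open>The power series of sqrt(1 - x), with \<open>sqrt_coeff n\<close> the coefficient of
  x^n\<close>

definition sqrt_coeff :: "nat \<Rightarrow> real" where
  "sqrt_coeff n = ((1/2) gchoose n) * (-1) ^ n"

text \<open>Both claims go through one induction: the first expresses a coefficient by the preceding
  partial sum, so that the partial sums obey \<open>S (n + 1) = S n * (2 n + 1) / (2 n + 2)\<close>
  and stay nonnegative.\<close>

lemma sqrt_coeff_partial:
  "sqrt_coeff (Suc n) * (2 * real n + 2) = - (\<Sum>k\<le>n. sqrt_coeff k) \<and> 0 \<le> (\<Sum>k\<le>n. sqrt_coeff k)"
proof (induction n)
  case 0
  then show ?case by (simp add: sqrt_coeff_def)
next
  case (Suc n)
  have c: "sqrt_coeff (Suc n) = - (\<Sum>k\<le>n. sqrt_coeff k) / (2 * real n + 2)"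
    using Suc by (simp add: field_simps)
  have s: "(\<Sum>k\<le>Suc n. sqrt_coeff k) = (\<Sum>k\<le>n. sqrt_coeff k) * ((2 * real n + 1) / (2 * real n + 2))"
    using c by (simp add: field_simps)
  have "((1/2) gchoose Suc (Suc n)) * (real n + 2) = - (real n + 1/2) * ((1/2) gchoose Suc n)"
    using gbinomial_mult_1[of "1/2 :: real" "Suc n"] by (simp add: algebra_simps)
  then have "(-1) ^ n * (((1/2) gchoose Suc (Suc n)) * (real n + 2)) = (-1) ^ n * (- (real n + 1/2) * ((1/2) gchoose Suc n))"
    by simp
  then have "sqrt_coeff (Suc (Suc n)) * (real n + 2) = sqrt_coeff (Suc n) * (real n + 1 / 2)"
    by (simp add: sqrt_coeff_def algebra_simps)
  then have "sqrt_coeff (Suc (Suc n)) * (2 * real (Suc n) + 2) = sqrt_coeff (Suc n) * (2 * real n + 1)"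
    by (simp add: algebra_simps)
  then have "sqrt_coeff (Suc (Suc n)) * (2 * real (Suc n) + 2) = - (\<Sum>k\<le>Suc n. sqrt_coeff k)"
    unfolding s c by simp
  moreover have "0 \<le> (\<Sum>k\<le>Suc n. sqrt_coeff k)"
    unfolding s using Suc by auto
  ultimately show ?case by blast
qed

lemma sqrt_coeff_0: "sqrt_coeff 0 = 1"
  by (simp add: sqrt_coeff_def)

lemma sqrt_coeff_Suc_le_0: "sqrt_coeff (Suc n) \<le> 0"
proof -
  have "sqrt_coeff (Suc n) * (2 * real n + 2) \<le> 0"
    using sqrt_coeff_partial[of n] by simp
  then show ?thesis by (auto simp: mult_le_0_iff)
qed

text \<open>All coefficients after the constant one are nonpositive, so their absolute values add up
  to 1 minus a nonnegative partial sum. The bound serves both the convergence of the matrix series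
  and the positivity of its limit.\<close>

lemma sqrt_coeff_abs_partial: "(\<Sum>k<n. \<bar>sqrt_coeff (Suc k)\<bar>) \<le> 1"
proof -
  have "(\<Sum>k<n. \<bar>sqrt_coeff (Suc k)\<bar>) = 1 - (\<Sum>k\<le>n. sqrt_coeff k)"
    by (induction n) (auto simp: sqrt_coeff_0 sqrt_coeff_Suc_le_0)
  then show ?thesis using sqrt_coeff_partial[of n] by simp
qed

lemma summable_sqrt_coeff: "summable (\<lambda>n. \<bar>sqrt_coeff (Suc n)\<bar>)" "(\<Sum>n. \<bar>sqrt_coeff (Suc n)\<bar>) \<le> 1"
proof -
  show *: "summable (\<lambda>n. \<bar>sqrt_coeff (Suc n)\<bar>)"
    using sqrt_coeff_abs_partial by (intro summableI_nonneg_bounded[where x = 1]) auto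
  show "(\<Sum>n. \<bar>sqrt_coeff (Suc n)\<bar>) \<le> 1"
    by (rule suminf_le_const[OF * sqrt_coeff_abs_partial])
qed

text \<open>The series squares to 1 - x: Vandermonde's convolution at 1/2 + 1/2 = 1 leaves only
  binomials of exponent 1.\<close>

lemma sqrt_coeff_convolution: "(\<Sum>i\<le>n. sqrt_coeff i * sqrt_coeff (n - i)) = (if n = 0 then 1 else if n = 1 then -1 else 0)"
proof -
  have "(\<Sum>i\<le>n. sqrt_coeff i * sqrt_coeff (n - i)) = (-1) ^ n * (\<Sum>i\<le>n. ((1/2) gchoose i) * ((1/2) gchoose (n - i)))"
    unfolding sum_distrib_left
  proof (intro sum.cong refl)
    fix i assume "i \<in> {..n}"
    then have "(-1::real) ^ n = (-1) ^ i * (-1) ^ (n - i)"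
      by (simp flip: power_add)
    then show "sqrt_coeff i * sqrt_coeff (n - i) = (- 1) ^ n * ((1 / 2 gchoose i) * (1 / 2 gchoose (n - i)))"
      by (simp add: sqrt_coeff_def)
  qed
  also have "(\<Sum>i\<le>n. ((1/2::real) gchoose i) * ((1/2) gchoose (n - i))) = (1 gchoose n)"
    using gbinomial_Vandermonde[of "1/2::real" "1/2" n] by (simp add: atMost_atLeast0)
  also have "(1::real) gchoose n = of_nat (1 choose n)"
    by (metis binomial_gbinomial of_nat_1)
  finally show ?thesis
    by (auto simp: binomial_eq_0)
qed

lemma hermitian_onD:
  assumes "hermitian_on I A" "i \<in> I" "j \<in> I"
  shows "cnj (A j i) = A i j"
  using assms unfolding hermitian_on_def by (metis complex_cnj_cnj)

lemma psd_on_hermitian: "psd_on I A \<Longrightarrow> hermitian_on I A"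
  by (simp add: psd_on_def)

lemma ip_cong: "(\<And>i. i \<in> I \<Longrightarrow> x i = x' i) \<Longrightarrow> (\<And>i. i \<in> I \<Longrightarrow> y i = y' i) \<Longrightarrow> ip I x y = ip I x' y'"
  by (simp add: ip_def)

lemma Re_ip_le:
  assumes "Re (ip I y y) \<le> Re (ip I x x)"
  shows "Re (ip I x y) \<le> Re (ip I x x)"
proof -
  have "2 * Re (ip I x y) \<le> (\<Sum>i\<in>I. (cmod (x i))\<^sup>2 + (cmod (y i))\<^sup>2)"
    unfolding ip_def Re_sum sum_distrib_left
  proof (rule sum_mono)
    fix i assume "i \<in> I"
    have "Re (cnj (x i) * y i) \<le> cmod (x i) * cmod (y i)"
      using complex_Re_le_cmod[of "cnj (x i) * y i"] by (simp add: norm_mult)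
    moreover have "2 * (cmod (x i) * cmod (y i)) \<le> (cmod (x i))\<^sup>2 + (cmod (y i))\<^sup>2"
      using sum_squares_bound[of "cmod (x i)" "cmod (y i)"] by (simp add: mult.assoc)
    ultimately show "2 * Re (cnj (x i) * y i) \<le> (cmod (x i))\<^sup>2 + (cmod (y i))\<^sup>2"
      by linarith
  qed
  then show ?thesis using assms by (simp add: ip_self_Re sum.distrib)
qed

text \<open>A column of the power is the image of a basis vector under a contraction. Bounded
  entries make the square root series converge entrywise by comparison with
  \<open>sqrt_coeff\<close>.\<close>

lemma matrix_power_entry_bound:
  assumes fin: "finite I" and sup: "supported_on I A" and psd: "psd_on I A"
    and le: "\<And>x. Re (ip I x (mat_vec I A x)) \<le> Re (ip I x x)"
  shows "cmod (matrix_power I A n i j) \<le> 1"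
proof (cases "i \<in> I \<and> j \<in> I")
  case True
  define e where "e = (\<lambda>k. if k = j then 1 else 0 :: complex)"
  have col: "mat_vec I (matrix_power I A n) e k = matrix_power I A n k j" for k
  proof -
    have "mat_vec I (matrix_power I A n) e k = (\<Sum>l\<in>I. if l = j then matrix_power I A n k j else 0)"
      unfolding mat_vec_def e_def by (intro sum.cong refl) auto
    then show ?thesis using True fin by simp
  qed
  have "(cmod (matrix_power I A n i j))\<^sup>2 \<le> (\<Sum>k\<in>I. (cmod (matrix_power I A n k j))\<^sup>2)"
    using fin True by (intro member_le_sum) auto
  also have "\<dots> \<le> (\<Sum>k\<in>I. (cmod (e k))\<^sup>2)"
    using matrix_power_contraction[OF fin psd le, of n e] by (simp add: ip_self_Re col)
  also have "\<dots> = (\<Sum>k\<in>I. if k = j then 1 else 0)"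
    by (intro sum.cong) (auto simp: e_def)
  also have "\<dots> = 1" using True fin by simp
  finally show ?thesis by (simp add: power_le_one_iff)
next
  case False
  then show ?thesis using supported_matrix_power[OF sup, of n] by (auto simp: supported_on_def)
qed

text \<open>The root is obtained from the binomial series of \<open>sqrt (1 - N)\<close>, whose coefficients
  beyond the constant one are nonpositive with sum at least \<open>-1\<close>.\<close>

lemma psd_sqrt_one_minus:
  assumes fin: "finite I" and sup: "supported_on I N" and psd: "psd_on I N"
    and le: "\<And>x. Re (ip I x (mat_vec I N x)) \<le> Re (ip I x x)"
  obtains B where "psd_on I B" "supported_on I B"
    "\<And>i j. mmult I B B i j = mat_id I i j - N i j"
proof -
  define P where "P = matrix_power I N"
  have bound: "cmod (P n i j) \<le> 1" for n i j
    unfolding P_def by (rule matrix_power_entry_bound[OF fin sup psd le])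
  have summ: "summable (\<lambda>n. norm (of_real (sqrt_coeff n) * P n i j))" for i j
  proof (subst summable_Suc_iff[symmetric], rule summable_comparison_test)
    show "\<exists>m. \<forall>n\<ge>m. norm (norm (of_real (sqrt_coeff (Suc n)) * P (Suc n) i j)) \<le> \<bar>sqrt_coeff (Suc n)\<bar>"
      using bound by (auto simp: norm_mult intro!: exI[of _ 0] mult_left_le)
  qed (rule summable_sqrt_coeff)
  define B where "B = (\<lambda>i j. \<Sum>n. of_real (sqrt_coeff n) * P n i j)"
  have sums: "(\<lambda>n. of_real (sqrt_coeff n) * P n i j) sums B i j" for i j
    unfolding B_def by (rule summable_sums[OF summable_norm_cancel[OF summ]])
  have supB: "supported_on I B"
    using supported_matrix_power[OF sup] unfolding supported_on_def B_def P_def by auto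
  have herm: "hermitian_on I B"
    unfolding hermitian_on_def
  proof (intro ballI)
    fix i j assume ij: "i \<in> I" "j \<in> I"
    have "(\<lambda>n. cnj (of_real (sqrt_coeff n) * P n j i)) sums cnj (B j i)"
      using sums[of j i] by (subst sums_cnj)
    moreover have "cnj (of_real (sqrt_coeff n) * P n j i) = of_real (sqrt_coeff n) * P n i j" for n
      using hermitian_onD[OF hermitian_matrix_power[OF fin sup] ij, of n] psd_on_hermitian[OF psd] by (simp add: P_def)
    ultimately have "(\<lambda>n. of_real (sqrt_coeff n) * P n i j) sums cnj (B j i)"
      by (simp only:)
    with sums[of i j] show "B i j = cnj (B j i)"
      by (rule sums_unique2)
  qed
  have form: "0 \<le> Re (ip I x (mat_vec I B x))" for x
  proof -
    \<comment> \<open>The constant term of the series is \<open>r 0\<close>. Every later term is at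
      least \<open>- \<bar>sqrt_coeff (Suc n)\<bar> * r 0\<close>, since
      \<open>r (Suc n) \<le> r 0\<close>, and these lower bounds add up to at least
      \<open>- r 0\<close>.\<close>
    define r where "r n = Re (ip I x (mat_vec I (P n) x))" for n
    have "(\<lambda>n. \<Sum>i\<in>I. \<Sum>j\<in>I. cnj (x i) * (of_real (sqrt_coeff n) * P n i j) * x j) sums ip I x (mat_vec I B x)"
      unfolding ip_mat_vec by (intro sums_sum sums_mult sums_mult2 sums)
    moreover have "(\<Sum>i\<in>I. \<Sum>j\<in>I. cnj (x i) * (of_real (sqrt_coeff n) * P n i j) * x j)
        = of_real (sqrt_coeff n) * ip I x (mat_vec I (P n) x)" for n
      unfolding ip_mat_vec sum_distrib_left by (intro sum.cong refl) (simp add: mult_ac)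
    ultimately have "(\<lambda>n. of_real (sqrt_coeff n) * ip I x (mat_vec I (P n) x)) sums ip I x (mat_vec I B x)"
      by simp
    from sums_Re[OF this] have s: "(\<lambda>n. sqrt_coeff n * r n) sums Re (ip I x (mat_vec I B x))"
      by (simp add: r_def)
    have "mat_vec I (P 0) x i = x i" if "i \<in> I" for i
      using that fin by (simp add: P_def mat_vec_mat_id)
    then have r_0: "r 0 = Re (ip I x x)"
      unfolding r_def by (intro arg_cong[where f = Re] ip_cong) auto
    then have r0: "0 \<le> r 0"
      by (simp add: ip_self_Re sum_nonneg)
    have r: "r n \<le> r 0" for n
      unfolding r_0 unfolding r_def P_def by (intro Re_ip_le matrix_power_contraction[OF fin psd le])
    have s1: "(\<lambda>n. sqrt_coeff (Suc n) * r (Suc n)) sums (Re (ip I x (mat_vec I B x)) - r 0)"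
      using s by (subst sums_Suc_iff) (simp add: sqrt_coeff_0)
    have s2: "(\<lambda>n. - \<bar>sqrt_coeff (Suc n)\<bar> * r 0) sums (- (\<Sum>n. \<bar>sqrt_coeff (Suc n)\<bar>) * r 0)"
      by (intro sums_mult2 sums_minus summable_sums summable_sqrt_coeff)
    have "- \<bar>sqrt_coeff (Suc n)\<bar> * r 0 \<le> sqrt_coeff (Suc n) * r (Suc n)" for n
      using mult_left_mono_neg[OF r sqrt_coeff_Suc_le_0, of n "Suc n"] sqrt_coeff_Suc_le_0[of n] by simp
    then have "- (\<Sum>n. \<bar>sqrt_coeff (Suc n)\<bar>) * r 0 \<le> Re (ip I x (mat_vec I B x)) - r 0"
      using s2 s1 by (rule sums_le)
    moreover have "(\<Sum>n. \<bar>sqrt_coeff (Suc n)\<bar>) * r 0 \<le> r 0"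
      using summable_sqrt_coeff(2) r0 by (intro mult_left_le_one_le) (auto intro!: suminf_nonneg summable_sqrt_coeff)
    ultimately show ?thesis by simp
  qed
  have sq: "mmult I B B i j = mat_id I i j - N i j" for i j
  proof -
    let ?c = "\<lambda>n. if n = 0 then 1 else if n = 1 then -1 else 0 :: real"
    \<comment> \<open>The square is the Cauchy product of the series with itself; powers of
      \<open>N\<close> add, and the convolution of the coefficients cuts the product down to
      \<open>P 0 - P 1\<close>.\<close>
    have "(\<lambda>n. \<Sum>k\<in>I. \<Sum>m\<le>n. (of_real (sqrt_coeff m) * P m i k) * (of_real (sqrt_coeff (n - m)) * P (n - m) k j))
        sums mmult I B B i j"
      unfolding mmult_def B_def by (intro sums_sum Cauchy_product_sums summ)
    moreover have "(\<Sum>k\<in>I. \<Sum>m\<le>n. (of_real (sqrt_coeff m) * P m i k) * (of_real (sqrt_coeff (n - m)) * P (n - m) k j))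
        = of_real (?c n) * P n i j" for n
    proof -
      have "(\<Sum>k\<in>I. \<Sum>m\<le>n. (of_real (sqrt_coeff m) * P m i k) * (of_real (sqrt_coeff (n - m)) * P (n - m) k j))
          = (\<Sum>m\<le>n. \<Sum>k\<in>I. (of_real (sqrt_coeff m) * P m i k) * (of_real (sqrt_coeff (n - m)) * P (n - m) k j))"
        by (rule sum.swap)
      also have "\<dots> = (\<Sum>m\<le>n. of_real (sqrt_coeff m * sqrt_coeff (n - m)) * P n i j)"
      proof (intro sum.cong refl)
        fix m assume "m \<in> {..n}"
        then have "P n = mmult I (P m) (P (n - m))"
          using matrix_power_add[OF fin sup, of m "n - m"] by (simp add: P_def)
        then show "(\<Sum>k\<in>I. (of_real (sqrt_coeff m) * P m i k) * (of_real (sqrt_coeff (n - m)) * P (n - m) k j))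
            = of_real (sqrt_coeff m * sqrt_coeff (n - m)) * P n i j"
          by (simp add: mmult_def sum_distrib_left mult_ac)
      qed
      also have "\<dots> = of_real (?c n) * P n i j"
        unfolding sqrt_coeff_convolution[symmetric] by (simp add: sum_distrib_right)
      finally show ?thesis .
    qed
    ultimately have "(\<lambda>n. of_real (?c n) * P n i j) sums mmult I B B i j"
      by simp
    moreover have "(\<lambda>n. of_real (?c n) * P n i j) sums (\<Sum>n\<in>{0,1}. of_real (?c n) * P n i j)"
      by (intro sums_finite) auto
    ultimately have "mmult I B B i j = (\<Sum>n\<in>{0,1}. of_real (?c n) * P n i j)"
      by (rule sums_unique2)
    also have "\<dots> = P 0 i j - P 1 i j" by simp
    also have "P 1 = N"
      using mmult_mat_id_right[OF fin sup] by (simp add: P_def)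
    finally show ?thesis by (simp add: P_def)
  qed
  show ?thesis
    using that[of B] herm form supB sq by (simp add: psd_on_iff)
qed

text \<open>Rescaling reduces to the series: \<open>M = t (1 - N)\<close> on \<open>I\<close> with
  \<open>N\<close> between 0 and 1 as soon as \<open>t\<close> dominates the form of
  \<open>M\<close>, and the root of \<open>1 - N\<close> is multiplied by
  \<open>sqrt t\<close>.\<close>

lemma psd_sqrt_exists:
  assumes fin: "finite I" and psd: "psd_on I M"
  obtains B where "psd_on I B" "supported_on I B"
    "\<And>i j. i \<in> I \<Longrightarrow> j \<in> I \<Longrightarrow> mmult I B B i j = M i j"
proof -
  \<comment> \<open>The sum of all moduli is a crude bound for the form; adding 1 keeps
    \<open>t\<close> positive even when \<open>M\<close> vanishes.\<close>
  define s where "s = (\<Sum>i\<in>I. \<Sum>j\<in>I. cmod (M i j))"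
  define t where "t = 1 + s"
  have s0: "0 \<le> s" by (simp add: s_def sum_nonneg)
  then have t0: "0 < t" by (simp add: t_def)
  define N where "N = (\<lambda>i j. if i \<in> I \<and> j \<in> I then mat_id I i j - M i j / of_real t else 0)"
  have le: "Re (ip I x (mat_vec I M x)) \<le> s * Re (ip I x x)" for x
    unfolding ip_mat_vec s_def sum_distrib_right Re_sum
  proof (intro sum_mono)
    fix i j assume ij: "i \<in> I" "j \<in> I"
    let ?q = "\<Sum>i\<in>I. (cmod (x i))\<^sup>2"
    have "(cmod (x i))\<^sup>2 \<le> ?q" "(cmod (x j))\<^sup>2 \<le> ?q"
      using ij fin by (auto intro: member_le_sum)
    moreover have "2 * (cmod (x i) * cmod (x j)) \<le> (cmod (x i))\<^sup>2 + (cmod (x j))\<^sup>2"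
      using sum_squares_bound[of "cmod (x i)" "cmod (x j)"] by (simp add: mult.assoc)
    ultimately have "cmod (x i) * cmod (x j) \<le> ?q" by linarith
    then have "cmod (M i j) * (cmod (x i) * cmod (x j)) \<le> cmod (M i j) * ?q"
      by (intro mult_left_mono) auto
    moreover have "Re (cnj (x i) * M i j * x j) \<le> cmod (M i j) * (cmod (x i) * cmod (x j))"
      using complex_Re_le_cmod[of "cnj (x i) * M i j * x j"] by (simp add: norm_mult mult_ac)
    ultimately show "Re (cnj (x i) * M i j * x j) \<le> cmod (M i j) * Re (ip I x x)"
      by (simp add: ip_self_Re)
  qed
  have idf: "(\<Sum>i\<in>I. \<Sum>j\<in>I. cnj (x i) * mat_id I i j * x j) = ip I x x" for x
    unfolding ip_mat_vec[symmetric] by (rule ip_cong) (simp_all add: mat_vec_mat_id fin)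
  have Nf: "ip I x (mat_vec I N x) = ip I x x - ip I x (mat_vec I M x) / of_real t" for x
  proof -
    have "ip I x (mat_vec I N x)
        = (\<Sum>i\<in>I. \<Sum>j\<in>I. cnj (x i) * mat_id I i j * x j - cnj (x i) * M i j * x j / of_real t)"
      unfolding ip_mat_vec N_def by (intro sum.cong refl) (simp add: algebra_simps)
    then show ?thesis
      unfolding ip_mat_vec idf[symmetric] by (simp add: sum_subtractf sum_divide_distrib)
  qed
  have xx: "0 \<le> Re (ip I x x)" for x by (simp add: ip_self_Re sum_nonneg)
  have "hermitian_on I N"
    unfolding hermitian_on_def
  proof (intro ballI)
    fix i j assume ij: "i \<in> I" "j \<in> I"
    then have "cnj (M j i) = M i j"
      using psd_on_hermitian[OF psd] by (simp add: hermitian_onD)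
    then show "N i j = cnj (N j i)" using ij by (auto simp: N_def mat_id_def)
  qed
  moreover have "0 \<le> Re (ip I x (mat_vec I N x))" for x
  proof -
    have "Re (ip I x (mat_vec I M x)) \<le> t * Re (ip I x x)"
      using le[of x] xx[of x] by (simp add: t_def algebra_simps)
    then show ?thesis using t0 by (simp add: Nf Re_divide_of_real field_simps)
  qed
  ultimately have "psd_on I N" by (simp add: psd_on_iff)
  moreover have "supported_on I N" by (auto simp: N_def supported_on_def)
  moreover have "Re (ip I x (mat_vec I N x)) \<le> Re (ip I x x)" for x
    using psd t0 by (simp add: Nf Re_divide_of_real psd_on_iff)
  ultimately obtain B where B: "psd_on I B" "supported_on I B"
    "\<And>i j. mmult I B B i j = mat_id I i j - N i j"
    using psd_sqrt_one_minus[OF fin] by metis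
  define C where "C = (\<lambda>i j. of_real (sqrt t) * B i j)"
  have "psd_on I C"
    unfolding psd_on_iff
  proof (intro conjI allI)
    show "hermitian_on I C"
      unfolding C_def hermitian_on_def by (simp add: hermitian_onD[OF psd_on_hermitian[OF B(1)]])
    fix x
    have "ip I x (mat_vec I C x) = of_real (sqrt t) * ip I x (mat_vec I B x)"
      unfolding ip_mat_vec C_def sum_distrib_left by (intro sum.cong refl) (simp add: mult_ac)
    then show "0 \<le> Re (ip I x (mat_vec I C x))"
      using B(1) t0 by (simp add: psd_on_iff)
  qed
  moreover have "supported_on I C"
    using B(2) by (auto simp: C_def supported_on_def)
  moreover have "mmult I C C i j = M i j" if "i \<in> I" "j \<in> I" for i j
  proof -
    have "mmult I C C i j = of_real (sqrt t * sqrt t) * mmult I B B i j"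
      unfolding mmult_def C_def sum_distrib_left of_real_mult by (intro sum.cong refl) (simp add: mult_ac)
    also have "\<dots> = of_real t * (M i j / of_real t)"
      using t0 that by (simp add: B(3) N_def)
    finally show ?thesis using t0 by simp
  qed
  ultimately show ?thesis using that by blast
qed

text \<open>Uniqueness of the positive root resolves the definite description, so that exhibiting
  one root computes the norm.\<close>

lemma trace_norm_eqI:
  assumes "finite I" "psd_on I B" "supported_on I B"
    "\<And>i j. i \<in> I \<Longrightarrow> j \<in> I \<Longrightarrow> mmult I B B i j = mmult I (madj A) A i j"
  shows "trace_norm I A = Re (mtrace I B)"
proof -
  have "(THE B. psd_on I B \<and> supported_on I B \<and>
      (\<forall>i\<in>I. \<forall>j\<in>I. mmult I B B i j = mmult I (madj A) A i j)) = B"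
  proof (rule the_equality)
    fix C assume C: "psd_on I C \<and> supported_on I C \<and>
      (\<forall>i\<in>I. \<forall>j\<in>I. mmult I C C i j = mmult I (madj A) A i j)"
    show "C = B"
      by (rule psd_sqrt_unique[OF assms(1)]) (use C assms in auto)
  qed (use assms in auto)
  then show ?thesis by (simp add: trace_norm_def)
qed

lemma psd_diag_nonneg:
  assumes "finite I" "psd_on I B" "i \<in> I"
  shows "0 \<le> Re (B i i)"
proof -
  have "ip I (\<lambda>k. if k = i then 1 else 0) (mat_vec I B (\<lambda>k. if k = i then 1 else 0)) = B i i"
    using assms(1,3) by (simp add: ip_def mat_vec_def if_distrib if_distribR sum.delta cong: if_cong)
  then show ?thesis
    using assms(2) unfolding psd_on_iff by metis
qed

lemma psd_madj_mult: "psd_on I (mmult I (madj A) A)"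
  unfolding psd_on_iff
proof (intro conjI allI)
  show "hermitian_on I (mmult I (madj A) A)"
    by (simp add: hermitian_on_def mmult_def madj_def mult.commute)
  fix x
  have "ip I x (mat_vec I (mmult I (madj A) A) x) = ip I (mat_vec I A x) (mat_vec I A x)"
    by (simp add: mat_vec_mmult ip_mat_vec_adjoint[of I x "madj A"]) (simp add: madj_def)
  then show "0 \<le> Re (ip I x (mat_vec I (mmult I (madj A) A) x))"
    by (simp add: ip_self_Re sum_nonneg)
qed

text \<open>A real infimum lies below its members only for families bounded below, which this
  supplies. The bound concerns every separable state, hence arbitrary \<open>A\<close>, so the
  existence theorem for roots is essential.\<close>

lemma trace_norm_nonneg:
  assumes "finite I"
  shows "0 \<le> trace_norm I A"
proof -
  obtain B where B: "psd_on I B" "supported_on I B"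
    "\<And>i j. i \<in> I \<Longrightarrow> j \<in> I \<Longrightarrow> mmult I B B i j = mmult I (madj A) A i j"
    using psd_sqrt_exists[OF assms psd_madj_mult] by metis
  have "0 \<le> Re (mtrace I B)"
    using psd_diag_nonneg[OF assms B(1)] by (auto simp: mtrace_def intro: sum_nonneg)
  then show ?thesis
    using trace_norm_eqI[OF assms B] by simp
qed

section \<open>The special unitary group\<close>

text \<open>Bridge to the library matrices, from which multiplicativity of the determinant and the
  passage from left to right inverses are taken.\<close>

definition tomat :: "nat \<Rightarrow> (nat \<Rightarrow> nat \<Rightarrow> complex) \<Rightarrow> complex mat" where
  "tomat D A = Matrix.mat D D (\<lambda>(i, j). A i j)"

lemma tomat_carrier: "tomat D A \<in> carrier_mat D D"
  by (simp add: tomat_def)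

lemma mdet_eq_det: "mdet D A = Determinant.det (tomat D A)"
  unfolding mdet_def det_def'[OF tomat_carrier] lessThan_atLeast0
  by (intro sum.cong refl arg_cong2[where f = "(*)"] prod.cong)
     (auto simp: tomat_def permutes_in_image dest!: permutes_in_image)

lemma tomat_mmult: "tomat D (mmult {..<D} A B) = tomat D A * tomat D B"
  by (rule eq_matI) (auto simp: tomat_def mmult_def scalar_prod_def lessThan_atLeast0)

lemma tomat_mat_id: "tomat D (mat_id {..<D}) = 1\<^sub>m D"
  by (rule eq_matI) (auto simp: tomat_def mat_id_def)

lemma tomat_inject:
  assumes "supported_on {..<D} A" "supported_on {..<D} B" "tomat D A = tomat D B"
  shows "A = B"
proof (intro ext)
  fix i j
  show "A i j = B i j"
  proof (cases "i < D \<and> j < D")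
    case True
    then have "A i j = tomat D A $$ (i, j)" "B i j = tomat D B $$ (i, j)"
      by (simp_all add: tomat_def)
    then show ?thesis by (simp add: assms(3))
  next
    case False
    then show ?thesis using assms(1,2) unfolding supported_on_def by (metis lessThan_iff)
  qed
qed

lemma mdet_mmult: "mdet D (mmult {..<D} A B) = mdet D A * mdet D B"
  by (simp add: mdet_eq_det tomat_mmult det_mult[OF tomat_carrier tomat_carrier])

lemma mdet_mat_id: "mdet D (mat_id {..<D}) = 1"
  by (simp add: mdet_eq_det tomat_mat_id)

lemma mdet_madj: "mdet D (madj A) = cnj (mdet D A)"
proof -
  have "mdet D (madj A) = mdet D (\<lambda>i j. cnj (A i j))"
  proof -
    have "tomat D (madj A) = transpose_mat (tomat D (\<lambda>i j. cnj (A i j)))"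
      by (rule eq_matI) (auto simp: tomat_def madj_def)
    then show ?thesis by (simp add: mdet_eq_det det_transpose[OF tomat_carrier])
  qed
  then show ?thesis by (simp add: mdet_def)
qed

lemma supported_madj: "supported_on I A \<Longrightarrow> supported_on I (madj A)"
  by (auto simp: supported_on_def madj_def)

lemma madj_madj: "madj (madj A) = A"
  by (simp add: madj_def)

lemma madj_mmult: "madj (mmult I A B) = mmult I (madj B) (madj A)"
  by (simp add: madj_def mmult_def mult.commute)

text \<open>An equation between total functions instead of entries below \<open>D\<close>: it can
  rewrite products directly, and the support condition makes both readings equivalent.\<close>

definition unitary_on :: "nat \<Rightarrow> (nat \<Rightarrow> nat \<Rightarrow> complex) \<Rightarrow> bool" where
  "unitary_on D U \<longleftrightarrow> supported_on {..<D} U \<and> mmult {..<D} (madj U) U = mat_id {..<D}"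

lemma SU_iff: "U \<in> SU D \<longleftrightarrow> unitary_on D U \<and> mdet D U = 1"
proof -
  have "mmult {..<D} (madj U) U = mat_id {..<D} \<longleftrightarrow>
      (\<forall>i<D. \<forall>j<D. mmult {..<D} (madj U) U i j = (if i = j then 1 else 0))"
    if "supported_on {..<D} U"
  proof
    assume h: "\<forall>i<D. \<forall>j<D. mmult {..<D} (madj U) U i j = (if i = j then 1 else 0)"
    have s: "supported_on {..<D} (mmult {..<D} (madj U) U)"
      by (intro supported_mmult supported_madj that)
    show "mmult {..<D} (madj U) U = mat_id {..<D}"
    proof (intro ext)
      fix i j
      show "mmult {..<D} (madj U) U i j = mat_id {..<D} i j"
        using h s unfolding supported_on_def mat_id_def
        by (cases "i < D \<and> j < D") auto
    qed
  qed (simp add: mat_id_def)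
  then show ?thesis by (auto simp: SU_def unitary_on_def)
qed

lemma unitary_right_inverse:
  assumes "unitary_on D U"
  shows "mmult {..<D} U (madj U) = mat_id {..<D}"
proof (rule tomat_inject)
  show "supported_on {..<D} (mmult {..<D} U (madj U))"
    using assms by (auto simp: unitary_on_def intro: supported_mmult supported_madj)
  show "supported_on {..<D} (mat_id {..<D})" by (rule supported_mat_id)
  have "tomat D (madj U) * tomat D U = 1\<^sub>m D"
    using assms by (simp add: unitary_on_def tomat_mat_id flip: tomat_mmult)
  then show "tomat D (mmult {..<D} U (madj U)) = tomat D (mat_id {..<D})"
    unfolding tomat_mat_id tomat_mmult
    by (rule mat_mult_left_right_inverse[OF tomat_carrier tomat_carrier])
qed

lemma unitary_madj:
  assumes "unitary_on D U"
  shows "unitary_on D (madj U)"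
  using assms unitary_right_inverse[OF assms]
  by (simp add: unitary_on_def supported_madj madj_madj)

lemma SU_madj: "U \<in> SU D \<Longrightarrow> madj U \<in> SU D"
  by (simp add: SU_iff unitary_madj mdet_madj)

lemma cmod_mdet_unitary:
  assumes "unitary_on D U"
  shows "cnj (mdet D U) * mdet D U = 1"
  using assms by (simp add: unitary_on_def mdet_mat_id flip: mdet_madj mdet_mmult)

lemma ip_unitary:
  assumes "unitary_on D V"
  shows "ip {..<D} (mat_vec {..<D} V x) (mat_vec {..<D} V y) = ip {..<D} x y"
proof -
  have "ip {..<D} (mat_vec {..<D} V x) (mat_vec {..<D} V y) = ip {..<D} x (mat_vec {..<D} (mat_id {..<D}) y)"
    using assms ip_mat_vec_adjoint[of "{..<D}" x "madj V" "mat_vec {..<D} V y"]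
    by (simp add: madj_madj unitary_on_def flip: mat_vec_mmult)
  then show ?thesis by (simp add: ip_def mat_vec_mat_id)
qed

lemma unitary_col_sum:
  assumes "unitary_on D U" "j < D"
  shows "(\<Sum>i<D. cnj (U i j) * U i j) = 1"
proof -
  have "mmult {..<D} (madj U) U j j = mat_id {..<D} j j"
    using assms(1) by (simp only: unitary_on_def)
  then show ?thesis using assms(2) by (simp add: mmult_def madj_def mat_id_def)
qed

lemma unitary_entry_le_1:
  assumes "unitary_on D U"
  shows "cmod (U i j) \<le> 1"
proof (cases "i < D \<and> j < D")
  case True
  have "complex_of_real (\<Sum>i<D. (cmod (U i j))\<^sup>2) = 1"
    using unitary_col_sum[OF assms, of j] True ip_self[of "{..<D}" "\<lambda>i. U i j"] by (simp add: ip_def)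
  then have "(\<Sum>i<D. (cmod (U i j))\<^sup>2) = 1"
    using of_real_eq_1_iff by blast
  moreover have "(cmod (U i j))\<^sup>2 \<le> (\<Sum>i<D. (cmod (U i j))\<^sup>2)"
    using True by (intro member_le_sum) auto
  ultimately show ?thesis by (simp add: power_le_one_iff)
next
  case False
  then have "U i j = 0" using assms unfolding unitary_on_def supported_on_def by (metis lessThan_iff)
  then show ?thesis by simp
qed

text \<open>The SU(2) matrix with rows \<open>(a, b)\<close> and \<open>(- cnj b, cnj a)\<close>
  placed in the coordinates \<open>j\<close> and \<open>l\<close>. Its special cases are the
  symmetries used for the moments: opposite phases for \<open>b = 0\<close>, a signed swap for
  \<open>a = 0\<close> and \<open>b = 1\<close>, a rotation for real \<open>a\<close> and
  \<open>b\<close>.\<close>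

definition rot :: "nat \<Rightarrow> nat \<Rightarrow> nat \<Rightarrow> complex \<Rightarrow> complex \<Rightarrow> nat \<Rightarrow> nat \<Rightarrow> complex" where
  "rot D j l a b = (\<lambda>i k. if i < D \<and> k < D then
     (if i = j then (if k = j then a else if k = l then b else 0)
      else if i = l then (if k = j then - cnj b else if k = l then cnj a else 0)
      else if i = k then 1 else 0) else 0)"

lemma supported_rot: "supported_on {..<D} (rot D j l a b)"
  by (auto simp: supported_on_def rot_def)

lemma sum_split2:
  fixes f :: "nat \<Rightarrow> complex"
  assumes "j < D" "l < D" "j \<noteq> l"
  shows "(\<Sum>k<D. f k) = f j + f l + (\<Sum>k\<in>{..<D} - {j, l}. f k)"
proof -
  have "{..<D} = insert j (insert l ({..<D} - {j, l}))" using assms by auto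
  then have "(\<Sum>k<D. f k) = sum f (insert j (insert l ({..<D} - {j, l})))" by simp
  also have "\<dots> = f j + f l + (\<Sum>k\<in>{..<D} - {j, l}. f k)"
    using assms by (simp add: algebra_simps)
  finally show ?thesis .
qed

lemma mat_vec_rot:
  assumes "j < D" "l < D" "j \<noteq> l" "i < D"
  shows "mat_vec {..<D} (rot D j l a b) x i =
    (if i = j then a * x j + b * x l else if i = l then - cnj b * x j + cnj a * x l else x i)"
proof (cases "i = j \<or> i = l")
  case True
  have "(\<Sum>k\<in>{..<D} - {j, l}. rot D j l a b i k * x k) = 0"
    by (rule sum.neutral) (use True assms in \<open>auto simp: rot_def\<close>)
  then show ?thesis
    unfolding mat_vec_def sum_split2[OF assms(1-3)] using True assms by (auto simp: rot_def)
next
  case False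
  have "mat_vec {..<D} (rot D j l a b) x i = (\<Sum>k<D. if k = i then x i else 0)"
    unfolding mat_vec_def by (rule sum.cong) (use False assms in \<open>auto simp: rot_def\<close>)
  then show ?thesis using False assms by simp
qed

lemma madj_rot: "j \<noteq> l \<Longrightarrow> madj (rot D j l a b) = rot D j l (cnj a) (- b)"
  by (intro ext) (auto simp: madj_def rot_def)

lemma unitary_rot:
  assumes "j < D" "l < D" "j \<noteq> l" "cnj a * a + cnj b * b = 1"
  shows "unitary_on D (rot D j l a b)"
  unfolding unitary_on_def
proof (intro conjI supported_rot ext)
  fix i k
  show "mmult {..<D} (madj (rot D j l a b)) (rot D j l a b) i k = mat_id {..<D} i k"
  proof (cases "i < D \<and> k < D")
    case True
    have "mmult {..<D} (madj (rot D j l a b)) (rot D j l a b) i k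
        = mat_vec {..<D} (rot D j l (cnj a) (- b)) (\<lambda>m. rot D j l a b m k) i"
      using assms(3) by (simp add: mmult_def mat_vec_def madj_rot)
    also have "\<dots> = mat_id {..<D} i k"
      using True assms by (subst mat_vec_rot) (auto simp: rot_def mat_id_def algebra_simps)
    finally show ?thesis .
  next
    case False
    then show ?thesis
      by (auto simp: mmult_def madj_def rot_def mat_id_def)
  qed
qed

text \<open>A permutation that moves an index outside \<open>{j, l}\<close> meets a zero entry, so
  only the identity and the transposition survive. They contribute \<open>a * cnj a\<close> and
  \<open>b * cnj b\<close>, the sign of the transposition cancelling the minus of
  \<open>- cnj b\<close>.\<close>

lemma mdet_rot:
  assumes "j < D" "l < D" "j \<noteq> l" "cnj a * a + cnj b * b = 1"
  shows "mdet D (rot D j l a b) = 1"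
proof -
  let ?R = "rot D j l a b"
  let ?t = "Transposition.transpose j l"
  let ?f = "\<lambda>p. of_int (sign p) * (\<Prod>i<D. ?R i (p i))"
  have "mdet D ?R = sum ?f {id, ?t}"
    unfolding mdet_def
  proof (rule sum.mono_neutral_right)
    show "{id, ?t} \<subseteq> {p. p permutes {..<D}}"
      using assms by (auto intro: permutes_id permutes_swap_id)
    show "\<forall>p\<in>{p. p permutes {..<D}} - {id, ?t}. ?f p = 0"
    proof
      fix p assume p: "p \<in> {p. p permutes {..<D}} - {id, ?t}"
      have "\<exists>i\<in>{..<D} - {j, l}. p i \<noteq> i"
      proof (rule ccontr)
        assume h: "\<not> (\<exists>i\<in>{..<D} - {j, l}. p i \<noteq> i)"
        have "p permutes {j, l}"
          by (rule permutes_superset[of p "{..<D}"]) (use p h in blast)+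
        then have "p \<in> {id, ?t}"
          by (simp add: permutes_doubleton_iff)
        then show False using p by blast
      qed
      then obtain i where "i < D" "i \<noteq> j" "i \<noteq> l" "p i \<noteq> i" by auto
      then have "(\<Prod>i<D. ?R i (p i)) = 0"
        by (intro prod_zero) (auto simp: rot_def intro!: bexI[of _ i])
      then show "?f p = 0" by simp
    qed
  qed (simp add: finite_permutations)
  also have "\<dots> = ?f id + ?f ?t"
    using assms(3) by (subst sum.insert) (auto simp: fun_eq_iff Transposition.transpose_def split: if_splits)
  also have "?f id = a * cnj a"
  proof -
    have "(\<Prod>i<D. ?R i (id i)) = (\<Prod>i<D. if i = j then a else if i = l then cnj a else 1)"
      using assms by (intro prod.cong) (auto simp: rot_def)
    also have "\<dots> = (\<Prod>i\<in>{j, l}. if i = j then a else if i = l then cnj a else 1)"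
      using assms by (intro prod.mono_neutral_right) auto
    finally show ?thesis using assms by simp
  qed
  also have "?f ?t = b * cnj b"
  proof -
    have "(\<Prod>i<D. ?R i (?t i)) = (\<Prod>i<D. if i = j then b else if i = l then - cnj b else 1)"
      using assms by (intro prod.cong) (auto simp: rot_def Transposition.transpose_def)
    also have "\<dots> = (\<Prod>i\<in>{j, l}. if i = j then b else if i = l then - cnj b else 1)"
      using assms by (intro prod.mono_neutral_right) auto
    finally show ?thesis using assms by (simp add: sign_swap_id)
  qed
  finally show ?thesis using assms(4) by (simp add: mult.commute)
qed

lemma rot_in_SU:
  assumes "j < D" "l < D" "j \<noteq> l" "cnj a * a + cnj b * b = 1"
  shows "rot D j l a b \<in> SU D"
  using assms by (simp add: SU_iff unitary_rot mdet_rot)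

section \<open>Lebesgue measure on complex matrices\<close>

lemma measurable_matrix:
  fixes f :: "'x \<Rightarrow> nat \<Rightarrow> nat \<Rightarrow> complex"
  assumes "\<And>i j. (\<lambda>x. f x i j) \<in> borel_measurable M"
  shows "f \<in> borel_measurable M"
  by (intro measurable_coordinatewise_then_product assms)

lemma measurable_entry_borel: "(\<lambda>X :: nat \<Rightarrow> nat \<Rightarrow> complex. X i j) \<in> borel_measurable borel"
proof -
  have "(\<lambda>X :: nat \<Rightarrow> nat \<Rightarrow> complex. X i) \<in> borel_measurable borel"
    by (intro borel_measurable_continuous_onI continuous_on_product_coordinates)
  moreover have "(\<lambda>x :: nat \<Rightarrow> complex. x j) \<in> borel_measurable borel"
    by (intro borel_measurable_continuous_onI continuous_on_product_coordinates)
  ultimately show ?thesis by (rule measurable_compose)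
qed

lemma measurable_entry:
  fixes f :: "'x \<Rightarrow> nat \<Rightarrow> nat \<Rightarrow> complex"
  assumes "f \<in> borel_measurable M"
  shows "(\<lambda>x. f x i j) \<in> borel_measurable M"
  using measurable_compose[OF assms measurable_entry_borel] .

lemma borel_measurable_cnj [measurable]:
  assumes "f \<in> borel_measurable M"
  shows "(\<lambda>x. cnj (f x)) \<in> borel_measurable M"
proof -
  have "cnj \<in> borel_measurable borel"
    by (intro borel_measurable_continuous_onI continuous_on_cnj continuous_on_id)
  then show ?thesis by (rule measurable_compose[OF assms])
qed

lemma measurable_mmult:
  fixes f g :: "'x \<Rightarrow> nat \<Rightarrow> nat \<Rightarrow> complex"
  assumes "f \<in> borel_measurable M" "g \<in> borel_measurable M"
  shows "(\<lambda>x. mmult I (f x) (g x)) \<in> borel_measurable M"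
  unfolding mmult_def
  by (intro measurable_matrix borel_measurable_sum borel_measurable_times assms[THEN measurable_entry])

lemma measurable_madj:
  fixes f :: "'x \<Rightarrow> nat \<Rightarrow> nat \<Rightarrow> complex"
  assumes "f \<in> borel_measurable M"
  shows "(\<lambda>x. madj (f x)) \<in> borel_measurable M"
  unfolding madj_def by (intro measurable_matrix borel_measurable_cnj assms[THEN measurable_entry])

lemma nn_integral_distr_meas:
  assumes "T \<in> measurable M N" "f \<in> borel_measurable N"
  shows "(\<integral>\<^sup>+x. f x \<partial>distr M N T) = (\<integral>\<^sup>+x. f (T x) \<partial>M)"
  using assms by (simp add: nn_integral_distr)

text \<open>The product measure lives on functions that are undefined outside the index square,
  whereas \<open>haar\<close> is a measure on total functions; the padding by 0 carries one type
  into the other.\<close>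

definition matrix_of_fun :: "nat \<Rightarrow> (nat \<times> nat \<Rightarrow> complex) \<Rightarrow> nat \<Rightarrow> nat \<Rightarrow> complex" where
  "matrix_of_fun D f = (\<lambda>i j. if i < D \<and> j < D then f (i, j) else 0)"

abbreviation entry_lebesgue :: "nat \<Rightarrow> (nat \<times> nat \<Rightarrow> complex) measure" where
  "entry_lebesgue D \<equiv> Pi\<^sub>M ({..<D} \<times> {..<D}) (\<lambda>_. lborel)"

definition matrix_lebesgue :: "nat \<Rightarrow> (nat \<Rightarrow> nat \<Rightarrow> complex) measure" where
  "matrix_lebesgue D = distr (entry_lebesgue D) borel (matrix_of_fun D)"

lemma sets_matrix_lebesgue [measurable_cong]: "sets (matrix_lebesgue D) = sets borel"
  by (simp add: matrix_lebesgue_def)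

lemma space_matrix_lebesgue [simp]: "space (matrix_lebesgue D) = UNIV"
  by (simp add: matrix_lebesgue_def)

lemma measurable_matrix_of_fun: "matrix_of_fun D \<in> borel_measurable (entry_lebesgue D)"
proof (rule measurable_matrix)
  fix i j
  show "(\<lambda>f. matrix_of_fun D f i j) \<in> borel_measurable (entry_lebesgue D)"
  proof (cases "i < D \<and> j < D")
    case True
    then have "(\<lambda>f. f (i, j)) \<in> measurable (entry_lebesgue D) lborel"
      by (intro measurable_component_singleton) auto
    then show ?thesis using True by (simp add: matrix_of_fun_def)
  next
    case False
    then have "matrix_of_fun D f i j = 0" for f by (auto simp: matrix_of_fun_def)
    then show ?thesis by simp
  qed
qed

text \<open>Cancelling a unitary matrix against its adjoint is valid for supported matrices; this
  makes it available almost everywhere.\<close>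

lemma AE_matrix_lebesgue_supported: "AE X in matrix_lebesgue D. supported_on {..<D} X"
proof -
  have "{X. supported_on {..<D} X} \<in> sets borel"
  proof -
    have *: "{X. supported_on {..<D} X} = (\<Inter>i. \<Inter>j. {X. \<not> (i < D \<and> j < D) \<longrightarrow> X i j = 0})"
      by (auto simp: supported_on_def)
    have "{X :: nat \<Rightarrow> nat \<Rightarrow> complex. \<not> (i < D \<and> j < D) \<longrightarrow> X i j = 0} \<in> sets borel" for i j
    proof (cases "i < D \<and> j < D")
      case False
      have "(\<lambda>X :: nat \<Rightarrow> nat \<Rightarrow> complex. X i j) -` {0} \<inter> space borel \<in> sets borel"
        by (rule measurable_sets[OF measurable_entry_borel]) simp
      then show ?thesis using False by (simp add: vimage_def)
    qed simp
    then show ?thesis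
      unfolding * by (intro sets.countable_INT''[OF _ _ sets.countable_INT'']) (simp_all only: space_in_borel countableI_type)
  qed
  moreover have "supported_on {..<D} (matrix_of_fun D f)" for f
    by (simp add: supported_on_def matrix_of_fun_def)
  ultimately show ?thesis
    unfolding matrix_lebesgue_def by (subst AE_distr_iff[OF measurable_matrix_of_fun]) simp_all
qed

interpretation plb: product_sigma_finite "\<lambda>_ :: nat \<times> nat. lborel :: complex measure"
  by unfold_locales

text \<open>A measure that agrees with the product on all rectangles is the product, so translation
  is checked one coordinate at a time.\<close>

lemma entry_lebesgue_translate:
  "distr (entry_lebesgue D) (entry_lebesgue D) (\<lambda>f. \<lambda>p\<in>{..<D} \<times> {..<D}. a p + f p) = entry_lebesgue D" (is "distr _ _ ?T = _")
proof (rule plb.PiM_eqI)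
  let ?J = "{..<D} \<times> {..<D}"
  have T: "?T \<in> measurable (entry_lebesgue D) (entry_lebesgue D)"
  proof (rule measurable_restrict)
    fix p assume "p \<in> ?J"
    then have "(\<lambda>f. f p) \<in> measurable (entry_lebesgue D) lborel"
      by (rule measurable_component_singleton)
    then show "(\<lambda>f. a p + f p) \<in> measurable (entry_lebesgue D) lborel"
      by (simp add: measurable_lborel2)
  qed
  fix A :: "nat \<times> nat \<Rightarrow> complex set"
  assume A: "\<And>p. p \<in> ?J \<Longrightarrow> A p \<in> sets lborel"
  define B where "B p = (\<lambda>z. a p + z) -` A p" for p
  have B: "B p \<in> sets lborel" "emeasure lborel (B p) = emeasure lborel (A p)" if "p \<in> ?J" for p
  proof -
    have m: "(\<lambda>z. a p + z) \<in> borel_measurable borel" by measurable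
    show "B p \<in> sets lborel"
      using measurable_sets[OF m, of "A p"] A[OF that] by (simp add: B_def)
    have "emeasure lborel (A p) = emeasure (distr lborel borel (\<lambda>z. a p + z)) (A p)"
      by (simp add: lborel_distr_plus)
    also have "\<dots> = emeasure lborel (B p)"
      using A[OF that] by (subst emeasure_distr) (auto simp: B_def)
    finally show "emeasure lborel (B p) = emeasure lborel (A p)" by simp
  qed
  have pre: "?T -` Pi\<^sub>E ?J A \<inter> space (entry_lebesgue D) = Pi\<^sub>E ?J B"
  proof (rule Set.set_eqI)
    fix f
    show "f \<in> ?T -` Pi\<^sub>E ?J A \<inter> space (entry_lebesgue D) \<longleftrightarrow> f \<in> Pi\<^sub>E ?J B"
      unfolding space_PiM B_def PiE_iff Int_iff vimage_eq by simp
  qed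
  have "emeasure (distr (entry_lebesgue D) (entry_lebesgue D) ?T) (Pi\<^sub>E ?J A)
      = emeasure (entry_lebesgue D) (?T -` Pi\<^sub>E ?J A \<inter> space (entry_lebesgue D))"
    by (rule emeasure_distr[OF T]) (use A in \<open>auto intro: sets_PiM_I_finite\<close>)
  also note pre
  also have "emeasure (entry_lebesgue D) (Pi\<^sub>E ?J B) = (\<Prod>p\<in>?J. emeasure lborel (B p))"
    by (rule plb.emeasure_PiM) (use B in auto)
  also have "\<dots> = (\<Prod>p\<in>?J. emeasure lborel (A p))"
    using B by (intro prod.cong) auto
  finally show "emeasure (distr (entry_lebesgue D) (entry_lebesgue D) ?T) (Pi\<^sub>E ?J A) = (\<Prod>p\<in>?J. emeasure lborel (A p))" .
qed auto

definition mat_add :: "(nat \<Rightarrow> nat \<Rightarrow> complex) \<Rightarrow> (nat \<Rightarrow> nat \<Rightarrow> complex) \<Rightarrow> nat \<Rightarrow> nat \<Rightarrow> complex" where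
  "mat_add X Y = (\<lambda>i j. X i j + Y i j)"

definition mat_neg :: "(nat \<Rightarrow> nat \<Rightarrow> complex) \<Rightarrow> nat \<Rightarrow> nat \<Rightarrow> complex" where
  "mat_neg X = (\<lambda>i j. - X i j)"

lemma measurable_mat_add:
  assumes "f \<in> borel_measurable M" "g \<in> borel_measurable M"
  shows "(\<lambda>x. mat_add (f x) (g x)) \<in> borel_measurable M"
  unfolding mat_add_def by (intro measurable_matrix borel_measurable_add assms[THEN measurable_entry])

lemma measurable_mat_neg:
  assumes "f \<in> borel_measurable M"
  shows "(\<lambda>x. mat_neg (f x)) \<in> borel_measurable M"
  unfolding mat_neg_def by (intro measurable_matrix borel_measurable_uminus assms[THEN measurable_entry])

lemma matrix_lebesgue_translate:
  assumes F: "F \<in> borel_measurable borel" and a: "supported_on {..<D} a"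
  shows "(\<integral>\<^sup>+X. F (mat_add X a) \<partial>matrix_lebesgue D) = (\<integral>\<^sup>+X. F X \<partial>matrix_lebesgue D)"
proof -
  let ?J = "{..<D} \<times> {..<D}"
  let ?T = "\<lambda>f. \<lambda>p\<in>?J. (case p of (i, j) \<Rightarrow> a i j) + f p"
  have T: "?T \<in> measurable (entry_lebesgue D) (entry_lebesgue D)"
  proof (rule measurable_restrict)
    fix p assume "p \<in> ?J"
    then have "(\<lambda>f. f p) \<in> measurable (entry_lebesgue D) lborel"
      by (rule measurable_component_singleton)
    then show "(\<lambda>f. (case p of (i, j) \<Rightarrow> a i j) + f p) \<in> measurable (entry_lebesgue D) lborel"
      by (simp add: measurable_lborel2)
  qed
  have eq: "mat_add (matrix_of_fun D f) a = matrix_of_fun D (?T f)" for f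
    using a unfolding mat_add_def matrix_of_fun_def supported_on_def by (intro ext) (auto simp: add.commute)
  have FX: "(\<lambda>X. F (mat_add X a)) \<in> borel_measurable borel"
    by (rule measurable_compose[OF _ F]) (intro measurable_mat_add, auto)
  have FE: "(\<lambda>f. F (matrix_of_fun D f)) \<in> borel_measurable (entry_lebesgue D)"
    by (rule measurable_compose[OF measurable_matrix_of_fun F])
  have "(\<integral>\<^sup>+X. F (mat_add X a) \<partial>matrix_lebesgue D) = (\<integral>\<^sup>+f. F (matrix_of_fun D (?T f)) \<partial>entry_lebesgue D)"
    unfolding matrix_lebesgue_def by (subst nn_integral_distr_meas[OF measurable_matrix_of_fun FX]) (simp add: eq)
  also have "\<dots> = (\<integral>\<^sup>+f. F (matrix_of_fun D f) \<partial>distr (entry_lebesgue D) (entry_lebesgue D) ?T)"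
    by (subst nn_integral_distr_meas[OF T FE]) simp
  also have "\<dots> = (\<integral>\<^sup>+f. F (matrix_of_fun D f) \<partial>entry_lebesgue D)"
    by (subst entry_lebesgue_translate) simp
  also have "\<dots> = (\<integral>\<^sup>+X. F X \<partial>matrix_lebesgue D)"
    unfolding matrix_lebesgue_def by (subst nn_integral_distr_meas[OF measurable_matrix_of_fun F]) simp
  finally show ?thesis .
qed

section \<open>Boxes and the Hilbert--Schmidt ball\<close>

definition matrix_box :: "nat \<Rightarrow> (nat \<Rightarrow> nat \<Rightarrow> complex) \<Rightarrow> real \<Rightarrow> (nat \<Rightarrow> nat \<Rightarrow> complex) set" where
  "matrix_box D c r = {X. \<forall>i<D. \<forall>j<D. X i j \<in> cball (c i j) r}"

lemma matrix_box_sets: "matrix_box D c r \<in> sets borel"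
proof -
  have *: "matrix_box D c r = (\<Inter>i. \<Inter>j. {X. i < D \<and> j < D \<longrightarrow> X i j \<in> cball (c i j) r})"
    by (auto simp: matrix_box_def)
  have "{X :: nat \<Rightarrow> nat \<Rightarrow> complex. i < D \<and> j < D \<longrightarrow> X i j \<in> cball (c i j) r} \<in> sets borel" for i j
  proof (cases "i < D \<and> j < D")
    case True
    have mem: "(\<lambda>X :: nat \<Rightarrow> nat \<Rightarrow> complex. X i j) -` cball (c i j) r \<inter> space borel \<in> sets borel"
      by (rule measurable_sets[OF measurable_entry_borel]) simp
    have eq: "(\<lambda>X :: nat \<Rightarrow> nat \<Rightarrow> complex. X i j) -` cball (c i j) r \<inter> space borel
        = {X. i < D \<and> j < D \<longrightarrow> X i j \<in> cball (c i j) r}"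
      using True by auto
    show ?thesis using mem unfolding eq .
  next
    case False
    then have "{X :: nat \<Rightarrow> nat \<Rightarrow> complex. i < D \<and> j < D \<longrightarrow> X i j \<in> cball (c i j) r} = UNIV" by blast
    then show ?thesis by simp
  qed
  then show ?thesis
    unfolding * by (intro sets.countable_INT''[OF _ _ sets.countable_INT'']) (simp_all only: space_in_borel countableI_type)
qed

lemma emeasure_matrix_box:
  "emeasure (matrix_lebesgue D) (matrix_box D c r) = (\<Prod>p\<in>{..<D} \<times> {..<D}. emeasure lborel (cball (case p of (i, j) \<Rightarrow> c i j) r))"
proof -
  let ?J = "{..<D} \<times> {..<D}"
  have "emeasure (matrix_lebesgue D) (matrix_box D c r) = emeasure (entry_lebesgue D) (matrix_of_fun D -` matrix_box D c r \<inter> space (entry_lebesgue D))"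
    unfolding matrix_lebesgue_def by (rule emeasure_distr[OF measurable_matrix_of_fun matrix_box_sets])
  also have "matrix_of_fun D -` matrix_box D c r \<inter> space (entry_lebesgue D) = Pi\<^sub>E ?J (\<lambda>p. cball (case p of (i, j) \<Rightarrow> c i j) r)"
  proof (rule Set.set_eqI)
    fix f
    show "f \<in> matrix_of_fun D -` matrix_box D c r \<inter> space (entry_lebesgue D) \<longleftrightarrow> f \<in> Pi\<^sub>E ?J (\<lambda>p. cball (case p of (i, j) \<Rightarrow> c i j) r)"
      unfolding space_PiM PiE_iff Int_iff vimage_eq matrix_box_def matrix_of_fun_def by auto
  qed
  also have "emeasure (entry_lebesgue D) \<dots> = (\<Prod>p\<in>?J. emeasure lborel (cball (case p of (i, j) \<Rightarrow> c i j) r))"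
    by (rule plb.emeasure_PiM) auto
  finally show ?thesis .
qed

lemma emeasure_matrix_box_finite: "emeasure (matrix_lebesgue D) (matrix_box D c r) < \<infinity>"
  unfolding emeasure_matrix_box
  by (simp add: ennreal_prod_eq_top emeasure_lborel_cball_finite less_top[symmetric])
     (metis emeasure_lborel_cball_finite infinity_ennreal_def order_less_irrefl)

lemma emeasure_matrix_box_pos:
  assumes "r > 0"
  shows "emeasure (matrix_lebesgue D) (matrix_box D c r) > 0"
proof -
  have "emeasure lborel (cball z r) \<noteq> 0" for z :: complex
    using assms by (simp add: emeasure_cball ennreal_eq_0_iff unit_ball_vol_pos not_le)
  then have "emeasure (matrix_lebesgue D) (matrix_box D c r) \<noteq> 0"
    unfolding emeasure_matrix_box by (simp add: prod_zero_iff split: prod.splits)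
  then show ?thesis by (simp add: zero_less_iff_neq_zero)
qed

lemma sigma_finite_matrix_lebesgue: "sigma_finite_measure (matrix_lebesgue D)"
proof
  let ?A = "range (\<lambda>n. matrix_box D (\<lambda>_ _. 0) (real n))"
  have "X \<in> \<Union> ?A" for X
  proof -
    obtain n where n: "(\<Sum>i<D. \<Sum>j<D. cmod (X i j)) \<le> real n"
      using real_arch_simple by blast
    have "cmod (X i j) \<le> real n" if "i < D" "j < D" for i j
    proof -
      have "cmod (X i j) \<le> (\<Sum>j<D. cmod (X i j))"
        using that by (intro member_le_sum) auto
      also have "\<dots> \<le> (\<Sum>i<D. \<Sum>j<D. cmod (X i j))"
        using that by (intro member_le_sum[of i _ "\<lambda>i. \<Sum>j<D. cmod (X i j)"]) (auto intro: sum_nonneg)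
      finally show ?thesis using n by simp
    qed
    then show ?thesis by (auto simp: matrix_box_def dist_norm)
  qed
  then show "\<exists>A. countable A \<and> A \<subseteq> sets (matrix_lebesgue D) \<and> \<Union> A = space (matrix_lebesgue D) \<and> (\<forall>a\<in>A. emeasure (matrix_lebesgue D) a \<noteq> \<infinity>)"
    using emeasure_matrix_box_finite[of D] by (intro exI[of _ ?A]) (auto simp: sets_matrix_lebesgue matrix_box_sets less_top)
qed

lemma mmult_eq_mat_vec: "mmult I A B = (\<lambda>i k. mat_vec I A (\<lambda>j. B j k) i)"
  by (simp add: mmult_def mat_vec_def)

lemma mmult_mat_add: "mmult I V (mat_add X Y) = mat_add (mmult I V X) (mmult I V Y)"
  by (simp add: mmult_def mat_add_def distrib_left sum.distrib)

lemma mmult_mat_neg: "mmult I V (mat_neg X) = mat_neg (mmult I V X)"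
  by (simp add: mmult_def mat_neg_def sum_negf)

lemma supported_mat_neg: "supported_on I X \<Longrightarrow> supported_on I (mat_neg X)"
  by (simp add: supported_on_def mat_neg_def)

lemma mmult_unitary_cancel:
  assumes "unitary_on D V" "supported_on {..<D} Y"
  shows "mmult {..<D} V (mmult {..<D} (madj V) Y) = Y"
  using assms by (simp add: unitary_right_inverse mmult_mat_id_left flip: mmult_assoc)

definition hs_norm2 :: "nat \<Rightarrow> (nat \<Rightarrow> nat \<Rightarrow> complex) \<Rightarrow> real" where
  "hs_norm2 D X = (\<Sum>k<D. \<Sum>i<D. (cmod (X i k))\<^sup>2)"

lemma hs_norm2_mmult:
  assumes "unitary_on D V"
  shows "hs_norm2 D (mmult {..<D} V X) = hs_norm2 D X"
proof -
  have "complex_of_real (hs_norm2 D Y) = (\<Sum>k<D. ip {..<D} (\<lambda>i. Y i k) (\<lambda>i. Y i k))" for Y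
    by (simp add: hs_norm2_def ip_self)
  then have "complex_of_real (hs_norm2 D (mmult {..<D} V X)) = complex_of_real (hs_norm2 D X)"
    by (simp add: mmult_eq_mat_vec ip_unitary[OF assms])
  then show ?thesis by simp
qed

lemma hs_norm2_mat_neg: "hs_norm2 D (mat_neg X) = hs_norm2 D X"
  by (simp add: hs_norm2_def mat_neg_def)

lemma measurable_hs_norm2: "hs_norm2 D \<in> borel_measurable borel"
  unfolding hs_norm2_def
  by (intro borel_measurable_sum borel_measurable_power measurable_compose[OF measurable_entry_borel borel_measurable_norm])

definition hs_ball :: "nat \<Rightarrow> (nat \<Rightarrow> nat \<Rightarrow> complex) set" where
  "hs_ball D = {X. hs_norm2 D X \<le> 1}"

lemma hs_ball_sets: "hs_ball D \<in> sets borel"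
proof -
  have "hs_norm2 D -` {..1} \<inter> space borel \<in> sets borel"
    by (rule measurable_sets[OF measurable_hs_norm2]) simp
  moreover have "hs_norm2 D -` {..1} \<inter> space borel = hs_ball D"
    by (auto simp: hs_ball_def)
  ultimately show ?thesis by (simp only:)
qed

text \<open>There are D^2 entries, so modulus at most 1/D for each of them keeps the sum of squares
  at most 1.\<close>

lemma matrix_box_subset_hs_ball:
  assumes "\<And>i j. i < D \<Longrightarrow> j < D \<Longrightarrow> cmod (c i j) + r \<le> 1 / real D"
  shows "matrix_box D c r \<subseteq> hs_ball D"
proof
  fix X assume X: "X \<in> matrix_box D c r"
  have "(cmod (X i k))\<^sup>2 \<le> (1 / real D)\<^sup>2" if "i < D" "k < D" for i k
  proof (rule power_mono)
    have "cmod (X i k) \<le> cmod (c i k) + cmod (c i k - X i k)"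
      by (metis norm_minus_commute norm_triangle_sub)
    also have "\<dots> \<le> cmod (c i k) + r"
      using X that by (auto simp: matrix_box_def dist_norm)
    finally show "cmod (X i k) \<le> 1 / real D" using assms[OF that] by simp
  qed simp
  then have "hs_norm2 D X \<le> (\<Sum>k<D. \<Sum>i<D. (1 / real D)\<^sup>2)"
    unfolding hs_norm2_def by (intro sum_mono) auto
  also have "\<dots> \<le> 1" by (cases "D = 0") (auto simp: field_simps power2_eq_square)
  finally show "X \<in> hs_ball D" by (simp add: hs_ball_def)
qed

lemma emeasure_hs_ball_finite: "emeasure (matrix_lebesgue D) (hs_ball D) < \<infinity>"
proof -
  have "hs_ball D \<subseteq> matrix_box D (\<lambda>_ _. 0) 1"
  proof
    fix X assume X: "X \<in> hs_ball D"
    have "cmod (X i j) \<le> 1" if "i < D" "j < D" for i j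
    proof -
      have "(cmod (X i j))\<^sup>2 \<le> (\<Sum>i<D. (cmod (X i j))\<^sup>2)"
        using that by (intro member_le_sum) auto
      also have "\<dots> \<le> hs_norm2 D X"
        unfolding hs_norm2_def using that
        by (intro member_le_sum[of j _ "\<lambda>j. \<Sum>i<D. (cmod (X i j))\<^sup>2"]) (auto intro: sum_nonneg)
      also have "\<dots> \<le> 1" using X by (simp add: hs_ball_def)
      finally show ?thesis by (simp add: power_le_one_iff)
    qed
    then show "X \<in> matrix_box D (\<lambda>_ _. 0) 1" by (simp add: matrix_box_def dist_norm)
  qed
  then have "emeasure (matrix_lebesgue D) (hs_ball D) \<le> emeasure (matrix_lebesgue D) (matrix_box D (\<lambda>_ _. 0) 1)"
    by (intro emeasure_mono) (auto simp: sets_matrix_lebesgue matrix_box_sets)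
  then show ?thesis using emeasure_matrix_box_finite by (rule le_less_trans)
qed

lemma measurable_matrix_lebesgue_iff: "f \<in> borel_measurable (matrix_lebesgue D) \<longleftrightarrow> f \<in> borel_measurable borel"
  by (simp cong: measurable_cong_sets add: sets_matrix_lebesgue)

text \<open>Both sides of the identity \<open>c * \<integral> F (V X) = c * \<integral> F X\<close>, with \<open>c\<close> the volume of the
  Hilbert--Schmidt unit ball, are evaluations of one double integral: translation invariance lets
  \<open>V X\<close> be replaced by \<open>V X + Y\<close>, and the ball is symmetric and invariant under \<open>V\<close>.\<close>

lemma matrix_lebesgue_unitary_invariant:
  assumes F: "F \<in> borel_measurable borel" and V: "unitary_on D V"
  shows "(\<integral>\<^sup>+X. F (mmult {..<D} V X) \<partial>matrix_lebesgue D) = (\<integral>\<^sup>+X. F X \<partial>matrix_lebesgue D)"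
proof -
  interpret sigma_finite_measure "matrix_lebesgue D" by (rule sigma_finite_matrix_lebesgue)
  interpret P: pair_sigma_finite "matrix_lebesgue D" "matrix_lebesgue D" ..
  let ?L = "matrix_lebesgue D" and ?V = "mmult {..<D} V" and ?W = "mmult {..<D} (madj V)"
  define h :: "(nat \<Rightarrow> nat \<Rightarrow> complex) \<Rightarrow> ennreal" where "h = indicator (hs_ball D)"
  have h: "h \<in> borel_measurable borel"
    unfolding h_def by (intro borel_measurable_indicator hs_ball_sets)
  have hV: "h (?V X) = h X" and hneg: "h (mat_neg X) = h X" for X
    by (auto simp: h_def indicator_def hs_ball_def hs_norm2_mmult[OF V] hs_norm2_mat_neg)
  have supV: "supported_on {..<D} V"
    using V by (simp add: unitary_on_def)
  have fst: "(\<lambda>p. fst p) \<in> borel_measurable (?L \<Otimes>\<^sub>M ?L)" and snd: "(\<lambda>p. snd p) \<in> borel_measurable (?L \<Otimes>\<^sub>M ?L)"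
    using measurable_fst[of ?L ?L] measurable_snd[of ?L ?L]
    by (simp_all cong: measurable_cong_sets add: sets_matrix_lebesgue)
  have mV: "?V \<in> borel_measurable borel"
    by (intro measurable_mmult) auto
  have Vfst: "(\<lambda>p. ?V (fst p)) \<in> borel_measurable (?L \<Otimes>\<^sub>M ?L)"
    by (intro measurable_mmult fst, simp)
  let ?c = "\<integral>\<^sup>+X. h X \<partial>?L"
  have "?c * (\<integral>\<^sup>+X. F (?V X) \<partial>?L) = (\<integral>\<^sup>+Y. h Y * (\<integral>\<^sup>+X. F (?V X) \<partial>?L) \<partial>?L)"
    by (rule nn_integral_multc[symmetric]) (simp add: measurable_matrix_lebesgue_iff h)
  also have "\<dots> = (\<integral>\<^sup>+Y. (\<integral>\<^sup>+X. h Y * F (mat_add (?V X) Y) \<partial>?L) \<partial>?L)"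
  proof (rule nn_integral_cong_AE, use AE_matrix_lebesgue_supported[of D] in eventually_elim)
    \<comment> \<open>With \<open>W\<close> the adjoint of \<open>V\<close>, the matrix
      \<open>V X + Y\<close> is \<open>V\<close> applied to \<open>X + W Y\<close>, so a translation
      of \<open>X\<close> absorbs \<open>Y\<close>.\<close>
    fix Y assume Y: "supported_on {..<D} Y"
    have mF: "(\<lambda>X. F (mat_add (?V X) Y)) \<in> borel_measurable borel"
      by (rule measurable_compose[OF _ F]) (intro measurable_mat_add mV, simp)
    have "(\<integral>\<^sup>+X. F (mat_add (?V X) Y) \<partial>?L) = (\<integral>\<^sup>+X. F (?V (mat_add X (?W Y))) \<partial>?L)"
      by (simp add: mmult_mat_add mmult_unitary_cancel[OF V Y])
    also have "\<dots> = (\<integral>\<^sup>+X. F (?V X) \<partial>?L)"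
      by (rule matrix_lebesgue_translate[where F = "\<lambda>X. F (?V X)"])
         (intro measurable_compose[OF mV F], intro supported_mmult supported_madj supV Y)
    finally show "h Y * (\<integral>\<^sup>+X. F (?V X) \<partial>?L) = (\<integral>\<^sup>+X. h Y * F (mat_add (?V X) Y) \<partial>?L)"
      by (subst nn_integral_cmult) (simp_all add: measurable_matrix_lebesgue_iff mF)
  qed
  also have "\<dots> = (\<integral>\<^sup>+X. (\<integral>\<^sup>+Y. h Y * F (mat_add (?V X) Y) \<partial>?L) \<partial>?L)"
  proof -
    have "(\<lambda>p. h (snd p) * F (mat_add (?V (fst p)) (snd p))) \<in> borel_measurable (?L \<Otimes>\<^sub>M ?L)"
      by (intro borel_measurable_times_ennreal measurable_compose[OF snd h]
          measurable_compose[OF measurable_mat_add[OF Vfst snd] F])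
    from P.Fubini[OF this] show ?thesis by simp
  qed
  also have "\<dots> = (\<integral>\<^sup>+X. (\<integral>\<^sup>+Y. h (mat_add Y (mat_neg (?V X))) * F Y \<partial>?L) \<partial>?L)"
  proof (rule nn_integral_cong_AE, use AE_matrix_lebesgue_supported[of D] in eventually_elim)
    \<comment> \<open>Substituting \<open>Y - V X\<close> for \<open>Y\<close> moves the dependence
      on \<open>X\<close> out of \<open>F\<close> and into the indicator of the ball.\<close>
    fix X assume X: "supported_on {..<D} X"
    have "(\<integral>\<^sup>+Y. h Y * F (mat_add (?V X) Y) \<partial>?L)
        = (\<integral>\<^sup>+Y. h (mat_add (mat_add Y (?V X)) (mat_neg (?V X))) * F (mat_add Y (?V X)) \<partial>?L)"
      by (intro nn_integral_cong arg_cong2[where f = "(*)"] arg_cong[where f = h] arg_cong[where f = F])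
         (simp_all add: mat_add_def mat_neg_def add.commute)
    also have "\<dots> = (\<integral>\<^sup>+Y. h (mat_add Y (mat_neg (?V X))) * F Y \<partial>?L)"
      by (rule matrix_lebesgue_translate[where F = "\<lambda>Y. h (mat_add Y (mat_neg (?V X))) * F Y"])
         (intro borel_measurable_times_ennreal F measurable_compose[OF measurable_mat_add h], simp, simp,
          intro supported_mmult supV X)
    finally show "(\<integral>\<^sup>+Y. h Y * F (mat_add (?V X) Y) \<partial>?L) = (\<integral>\<^sup>+Y. h (mat_add Y (mat_neg (?V X))) * F Y \<partial>?L)" .
  qed
  also have "\<dots> = (\<integral>\<^sup>+Y. (\<integral>\<^sup>+X. h (mat_add Y (mat_neg (?V X))) * F Y \<partial>?L) \<partial>?L)"
  proof -
    have "(\<lambda>p. h (mat_add (snd p) (mat_neg (?V (fst p)))) * F (snd p)) \<in> borel_measurable (?L \<Otimes>\<^sub>M ?L)"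
      by (intro borel_measurable_times_ennreal measurable_compose[OF snd F]
          measurable_compose[OF measurable_mat_add[OF snd measurable_mat_neg[OF Vfst]] h])
    from P.Fubini[OF this] show ?thesis by simp
  qed
  also have "\<dots> = (\<integral>\<^sup>+Y. ?c * F Y \<partial>?L)"
  proof (rule nn_integral_cong_AE, use AE_matrix_lebesgue_supported[of D] in eventually_elim)
    fix Y assume Y: "supported_on {..<D} Y"
    \<comment> \<open>\<open>Y - V X\<close> is the negative of \<open>V (X - W Y)\<close>, and the
      ball is insensitive to \<open>V\<close> and to the sign; the inner integral over
      \<open>X\<close> becomes a translate of the volume of the ball.\<close>
    have "h (mat_add Y (mat_neg (?V X))) = h (mat_add X (mat_neg (?W Y)))" for X
    proof -
      have "h (mat_add X (mat_neg (?W Y))) = h (mat_neg (?V (mat_add X (mat_neg (?W Y)))))"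
        by (simp add: hV hneg)
      also have "mat_neg (?V (mat_add X (mat_neg (?W Y)))) = mat_add Y (mat_neg (?V X))"
        unfolding mmult_mat_add mmult_mat_neg mmult_unitary_cancel[OF V Y]
        by (simp add: mat_add_def mat_neg_def)
      finally show ?thesis by simp
    qed
    then have "(\<integral>\<^sup>+X. h (mat_add Y (mat_neg (?V X))) * F Y \<partial>?L) = (\<integral>\<^sup>+X. h (mat_add X (mat_neg (?W Y))) * F Y \<partial>?L)"
      by simp
    also have "\<dots> = (\<integral>\<^sup>+X. h X * F Y \<partial>?L)"
      by (rule matrix_lebesgue_translate[where F = "\<lambda>X. h X * F Y"])
         (intro borel_measurable_times_ennreal h, simp, intro supported_mat_neg supported_mmult supported_madj supV Y)
    also have "\<dots> = ?c * F Y"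
      by (rule nn_integral_multc) (simp add: measurable_matrix_lebesgue_iff h)
    finally show "(\<integral>\<^sup>+X. h (mat_add Y (mat_neg (?V X))) * F Y \<partial>?L) = ?c * F Y" .
  qed
  also have "\<dots> = ?c * (\<integral>\<^sup>+Y. F Y \<partial>?L)"
    by (rule nn_integral_cmult) (simp add: measurable_matrix_lebesgue_iff F)
  finally have eq: "?c * (\<integral>\<^sup>+X. F (?V X) \<partial>?L) = ?c * (\<integral>\<^sup>+X. F X \<partial>?L)" .
  have c: "?c = emeasure ?L (hs_ball D)"
    unfolding h_def by (rule nn_integral_indicator) (simp add: sets_matrix_lebesgue hs_ball_sets)
  have "?c < \<infinity>" using c emeasure_hs_ball_finite by simp
  moreover have "?c \<noteq> 0"
  proof -
    have "0 < emeasure ?L (matrix_box D (\<lambda>_ _. 0) (1 / (real D + 1)))"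
      by (rule emeasure_matrix_box_pos) simp
    also have "\<dots> \<le> ?c"
      unfolding c by (intro emeasure_mono matrix_box_subset_hs_ball) (auto simp: sets_matrix_lebesgue hs_ball_sets frac_le)
    finally show ?thesis by simp
  qed
  ultimately show ?thesis
    using eq by (auto simp: ennreal_mult_cancel_left)
qed

section \<open>Gram--Schmidt orthonormalisation and Haar measure\<close>

definition vnormalize :: "nat \<Rightarrow> (nat \<Rightarrow> complex) \<Rightarrow> nat \<Rightarrow> complex" where
  "vnormalize D w = (\<lambda>i. w i / of_real (sqrt (Re (ip {..<D} w w))))"

fun gs_vec :: "nat \<Rightarrow> (nat \<Rightarrow> nat \<Rightarrow> complex) \<Rightarrow> nat \<Rightarrow> nat \<Rightarrow> complex" where
  "gs_vec D X k = vnormalize D (\<lambda>i. X i k - (\<Sum>j\<in>{..<k}. ip {..<D} (gs_vec D X j) (\<lambda>l. X l k) * gs_vec D X j i))"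

declare gs_vec.simps [simp del]

definition gs_residual :: "nat \<Rightarrow> (nat \<Rightarrow> nat \<Rightarrow> complex) \<Rightarrow> nat \<Rightarrow> nat \<Rightarrow> complex" where
  "gs_residual D X k = (\<lambda>i. X i k - (\<Sum>j<k. ip {..<D} (gs_vec D X j) (\<lambda>l. X l k) * gs_vec D X j i))"

lemma gs_vec_eq: "gs_vec D X k = vnormalize D (gs_residual D X k)"
  by (subst gs_vec.simps) (simp add: gs_residual_def)

text \<open>Normalising a vanishing residual divides by 0 and yields the zero vector; this condition
  excludes it for the first \<open>D\<close> columns.\<close>

definition gs_defined :: "nat \<Rightarrow> (nat \<Rightarrow> nat \<Rightarrow> complex) \<Rightarrow> bool" where
  "gs_defined D X \<longleftrightarrow> (\<forall>k<D. Re (ip {..<D} (gs_residual D X k) (gs_residual D X k)) \<noteq> 0)"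

lemma mat_vec_diff: "mat_vec I A (\<lambda>i. x i - y i) = (\<lambda>i. mat_vec I A x i - mat_vec I A y i)"
  by (simp add: mat_vec_def algebra_simps sum_subtractf)

lemma mat_vec_sum: "mat_vec I A (\<lambda>i. \<Sum>j\<in>J. f j i) = (\<lambda>i. \<Sum>j\<in>J. mat_vec I A (f j) i)"
proof
  fix i
  show "mat_vec I A (\<lambda>i. \<Sum>j\<in>J. f j i) i = (\<Sum>j\<in>J. mat_vec I A (f j) i)"
    unfolding mat_vec_def sum_distrib_left by (rule sum.swap)
qed

lemma ip_diff_right: "ip I z (\<lambda>i. x i - y i) = ip I z x - ip I z y"
  by (simp add: ip_def algebra_simps sum_subtractf)

lemma ip_sum_right: "ip I z (\<lambda>i. \<Sum>j\<in>J. f j i) = (\<Sum>j\<in>J. ip I z (f j))"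
  unfolding ip_def sum_distrib_left by (rule sum.swap)

lemma vnormalize_mat_vec:
  assumes "unitary_on D V"
  shows "vnormalize D (mat_vec {..<D} V w) = mat_vec {..<D} V (vnormalize D w)"
  using mat_vec_scale[of "{..<D}" V "1 / of_real (sqrt (Re (ip {..<D} w w)))" w]
  by (simp add: vnormalize_def ip_unitary[OF assms])

text \<open>\<open>V\<close> preserves inner products, hence every Gram--Schmidt coefficient.
  Residual and vector share one induction because each residual is built from the earlier
  vectors.\<close>

lemma gs_vec_unitary:
  assumes V: "unitary_on D V"
  shows "gs_vec D (mmult {..<D} V X) k = mat_vec {..<D} V (gs_vec D X k)"
    and "gs_residual D (mmult {..<D} V X) k = mat_vec {..<D} V (gs_residual D X k)"
proof -
  have "gs_residual D (mmult {..<D} V X) k = mat_vec {..<D} V (gs_residual D X k) \<and>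
      gs_vec D (mmult {..<D} V X) k = mat_vec {..<D} V (gs_vec D X k)"
  proof (induction k rule: less_induct)
    case (less k)
    have "gs_residual D (mmult {..<D} V X) k = (\<lambda>i. mmult {..<D} V X i k -
        (\<Sum>j<k. ip {..<D} (mat_vec {..<D} V (gs_vec D X j)) (\<lambda>l. mmult {..<D} V X l k) * mat_vec {..<D} V (gs_vec D X j) i))"
      unfolding gs_residual_def using less by (intro ext arg_cong2[where f = "(-)"] refl sum.cong) auto
    also have "\<dots> = (\<lambda>i. mat_vec {..<D} V (\<lambda>l. X l k) i -
        (\<Sum>j<k. ip {..<D} (gs_vec D X j) (\<lambda>l. X l k) * mat_vec {..<D} V (gs_vec D X j) i))"
      unfolding mmult_eq_mat_vec ip_unitary[OF V] ..
    also have "\<dots> = mat_vec {..<D} V (gs_residual D X k)"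
      unfolding gs_residual_def mat_vec_diff mat_vec_sum mat_vec_scale ..
    finally have "gs_residual D (mmult {..<D} V X) k = mat_vec {..<D} V (gs_residual D X k)" .
    then show ?case by (simp add: gs_vec_eq vnormalize_mat_vec[OF V])
  qed
  then show "gs_vec D (mmult {..<D} V X) k = mat_vec {..<D} V (gs_vec D X k)"
    "gs_residual D (mmult {..<D} V X) k = mat_vec {..<D} V (gs_residual D X k)" by auto
qed

lemma gs_defined_unitary:
  assumes "unitary_on D V"
  shows "gs_defined D (mmult {..<D} V X) = gs_defined D X"
  by (simp add: gs_defined_def gs_vec_unitary[OF assms] ip_unitary[OF assms])

text \<open>The restriction \<open>j \<le> k\<close> suits strong induction on \<open>k\<close>; the
  other order of the indices follows by conjugation.\<close>

lemma gs_vec_orthonormal_aux: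
  assumes "gs_defined D X" "k < D"
  shows "\<forall>j\<le>k. ip {..<D} (gs_vec D X j) (gs_vec D X k) = (if j = k then 1 else 0)"
  using assms(2)
proof (induction k rule: less_induct)
  case (less k)
  let ?n = "Re (ip {..<D} (gs_residual D X k) (gs_residual D X k))"
  have n0: "?n > 0"
    using assms(1) less.prems unfolding gs_defined_def
    by (metis ip_self_Re order_le_less sum_nonneg zero_le_power2)
  have gsk: "gs_vec D X k = (\<lambda>i. (1 / of_real (sqrt ?n)) * gs_residual D X k i)"
    by (simp add: gs_vec_eq vnormalize_def)
  have IH: "ip {..<D} (gs_vec D X j) (gs_vec D X j') = (if j = j' then 1 else 0)" if "j < k" "j' < k" for j j'
  proof (cases "j \<le> j'")
    case True
    then show ?thesis using less that by auto
  next
    case False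
    then have "ip {..<D} (gs_vec D X j') (gs_vec D X j) = 0" using less that by auto
    then show ?thesis using False cnj_ip[of "{..<D}" "gs_vec D X j'" "gs_vec D X j"] by auto
  qed
  have orth: "ip {..<D} (gs_vec D X j) (gs_residual D X k) = 0" if "j < k" for j
  proof -
    have "ip {..<D} (gs_vec D X j) (gs_residual D X k) = ip {..<D} (gs_vec D X j) (\<lambda>l. X l k)
        - (\<Sum>j'<k. ip {..<D} (gs_vec D X j') (\<lambda>l. X l k) * ip {..<D} (gs_vec D X j) (gs_vec D X j'))"
      unfolding gs_residual_def ip_diff_right ip_sum_right ip_scale_right ..
    also have "(\<Sum>j'<k. ip {..<D} (gs_vec D X j') (\<lambda>l. X l k) * ip {..<D} (gs_vec D X j) (gs_vec D X j'))
        = (\<Sum>j'<k. if j' = j then ip {..<D} (gs_vec D X j) (\<lambda>l. X l k) else 0)"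
      using that by (intro sum.cong) (auto simp: IH)
    finally show ?thesis using that by simp
  qed
  have "ip {..<D} (gs_residual D X k) (gs_residual D X k) = of_real ?n"
    by (simp add: ip_self)
  then have "ip {..<D} (gs_vec D X k) (gs_vec D X k) = of_real ?n / (of_real (sqrt ?n) * of_real (sqrt ?n))"
    unfolding gsk ip_scale_left ip_scale_right by simp
  also have "\<dots> = 1"
    using n0 by (simp flip: of_real_mult)
  finally have "ip {..<D} (gs_vec D X k) (gs_vec D X k) = 1" .
  moreover have "ip {..<D} (gs_vec D X j) (gs_vec D X k) = 0" if "j < k" for j
    using orth[OF that] gsk by (metis ip_scale_right mult_zero_right)
  ultimately show ?case by (auto simp: order_le_less)
qed

lemma gs_vec_orthonormal:
  assumes "gs_defined D X" "j < D" "k < D"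
  shows "ip {..<D} (gs_vec D X j) (gs_vec D X k) = (if j = k then 1 else 0)"
proof (cases "j \<le> k")
  case True
  then show ?thesis using gs_vec_orthonormal_aux[OF assms(1,3)] by auto
next
  case False
  then have "ip {..<D} (gs_vec D X k) (gs_vec D X j) = 0" using gs_vec_orthonormal_aux[OF assms(1,2)] by auto
  then show ?thesis using False cnj_ip[of "{..<D}" "gs_vec D X k" "gs_vec D X j"] by auto
qed

definition gs_matrix :: "nat \<Rightarrow> (nat \<Rightarrow> nat \<Rightarrow> complex) \<Rightarrow> nat \<Rightarrow> nat \<Rightarrow> complex" where
  "gs_matrix D X = (\<lambda>i k. if i < D \<and> k < D then gs_vec D X k i else 0)"

lemma unitary_gs_matrix:
  assumes "gs_defined D X"
  shows "unitary_on D (gs_matrix D X)"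
  unfolding unitary_on_def
proof (intro conjI ext)
  show "supported_on {..<D} (gs_matrix D X)"
    by (simp add: supported_on_def gs_matrix_def)
  fix j k
  show "mmult {..<D} (madj (gs_matrix D X)) (gs_matrix D X) j k = mat_id {..<D} j k"
  proof (cases "j < D \<and> k < D")
    case True
    then show ?thesis
      using gs_vec_orthonormal[OF assms, of j k] by (auto simp: mmult_def madj_def gs_matrix_def mat_id_def ip_def)
  next
    case False
    then show ?thesis by (auto simp: mmult_def madj_def gs_matrix_def mat_id_def)
  qed
qed

lemma gs_matrix_unitary:
  assumes "unitary_on D V"
  shows "gs_matrix D (mmult {..<D} V X) = mmult {..<D} V (gs_matrix D X)"
proof (intro ext)
  fix i k
  show "gs_matrix D (mmult {..<D} V X) i k = mmult {..<D} V (gs_matrix D X) i k"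
  proof (cases "i < D \<and> k < D")
    case True
    then have "gs_matrix D (mmult {..<D} V X) i k = mat_vec {..<D} V (gs_vec D X k) i"
      unfolding gs_matrix_def gs_vec_unitary[OF assms] by simp
    then show ?thesis using True by (simp add: gs_matrix_def mmult_def mat_vec_def)
  next
    case False
    then show ?thesis
      using assms by (auto simp: gs_matrix_def mmult_def unitary_on_def supported_on_def)
  qed
qed

text \<open>Dividing the first column by the determinant moves a unitary matrix into the special unitary
  group, and does so equivariantly because left factors from \<open>SU D\<close> leave the determinant unchanged.\<close>

definition det_normalize :: "nat \<Rightarrow> (nat \<Rightarrow> nat \<Rightarrow> complex) \<Rightarrow> nat \<Rightarrow> nat \<Rightarrow> complex" where
  "det_normalize D U = (\<lambda>i k. U i k * (if k = 0 then cnj (mdet D U) else 1))"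

lemma det_normalize_in_SU:
  assumes U: "unitary_on D U" and D: "0 < D"
  shows "det_normalize D U \<in> SU D"
proof -
  have c: "cnj (mdet D U) * mdet D U = 1" by (rule cmod_mdet_unitary[OF U])
  have "unitary_on D (det_normalize D U)"
    unfolding unitary_on_def
  proof (intro conjI ext)
    show "supported_on {..<D} (det_normalize D U)"
      using U by (simp add: unitary_on_def supported_on_def det_normalize_def)
    fix j k
    let ?s = "\<lambda>k :: nat. if k = 0 then cnj (mdet D U) else 1"
    have "mmult {..<D} (madj (det_normalize D U)) (det_normalize D U) j k
        = cnj (?s j) * ?s k * mmult {..<D} (madj U) U j k"
      by (simp add: mmult_def madj_def det_normalize_def sum_distrib_left mult_ac)
    also have "\<dots> = mat_id {..<D} j k"
      using U c by (auto simp: unitary_on_def mat_id_def mult.commute)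
    finally show "mmult {..<D} (madj (det_normalize D U)) (det_normalize D U) j k = mat_id {..<D} j k" .
  qed
  moreover have "mdet D (det_normalize D U) = cnj (mdet D U) * mdet D U"
  proof -
    have "(\<Prod>i<D. det_normalize D U i (p i)) = cnj (mdet D U) * (\<Prod>i<D. U i (p i))" if "p permutes {..<D}" for p
    proof -
      \<comment> \<open>A permutation sends exactly one row to column 0, so the extra factor occurs
        once in every product.\<close>
      have "(\<Prod>i<D. if p i = 0 then cnj (mdet D U) else 1) = (\<Prod>i<D. if i = 0 then cnj (mdet D U) else 1)"
        using prod.permute[OF that, of "\<lambda>i. if i = 0 then cnj (mdet D U) else 1"] by (simp add: o_def)
      also have "\<dots> = cnj (mdet D U)" using D by simp
      finally show ?thesis by (simp add: det_normalize_def prod.distrib)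
    qed
    then show ?thesis
      unfolding mdet_def[of D "det_normalize D U"] mdet_def[of D U] sum_distrib_left
      by (intro sum.cong) (simp_all add: mdet_def mult_ac)
  qed
  ultimately show ?thesis using c by (simp add: SU_iff)
qed

lemma det_normalize_mmult:
  assumes "V \<in> SU D"
  shows "det_normalize D (mmult {..<D} V U) = mmult {..<D} V (det_normalize D U)"
  using assms by (intro ext) (simp add: det_normalize_def mdet_mmult SU_iff, simp add: mmult_def sum_distrib_right mult.assoc)

section \<open>Matrices on which Gram--Schmidt succeeds\<close>

definition colspan :: "(nat \<Rightarrow> nat \<Rightarrow> complex) \<Rightarrow> nat \<Rightarrow> (nat \<Rightarrow> complex) set" where
  "colspan X k = {v. \<exists>b. \<forall>i. v i = (\<Sum>j<k. b j * X i j)}"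

lemma colspan_mono:
  assumes "v \<in> colspan X k" "k \<le> k'"
  shows "v \<in> colspan X k'"
proof -
  obtain b where b: "\<And>i. v i = (\<Sum>j<k. b j * X i j)"
    using assms(1) by (auto simp: colspan_def)
  have "v i = (\<Sum>j<k'. (if j < k then b j else 0) * X i j)" for i
    unfolding b using assms(2) by (intro sum.mono_neutral_cong_left) auto
  then show ?thesis unfolding colspan_def by auto
qed

lemma colspan_scale:
  assumes "v \<in> colspan X k"
  shows "(\<lambda>i. c * v i) \<in> colspan X k"
proof -
  obtain b where b: "\<And>i. v i = (\<Sum>j<k. b j * X i j)"
    using assms(1) by (auto simp: colspan_def)
  have "c * v i = (\<Sum>j<k. (c * b j) * X i j)" for i
    by (simp add: b sum_distrib_left mult.assoc)
  then show ?thesis unfolding colspan_def by auto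
qed

lemma colspan_sum:
  assumes "\<And>j. j \<in> J \<Longrightarrow> f j \<in> colspan X k"
  shows "(\<lambda>i. \<Sum>j\<in>J. f j i) \<in> colspan X k"
proof -
  have "\<forall>j\<in>J. \<exists>b. \<forall>i. f j i = (\<Sum>m<k. b m * X i m)"
    using assms by (auto simp: colspan_def)
  then obtain b where b: "\<And>i j. j \<in> J \<Longrightarrow> f j i = (\<Sum>m<k. b j m * X i m)"
    by (auto dest: bchoice)
  have "(\<Sum>j\<in>J. f j i) = (\<Sum>m<k. (\<Sum>j\<in>J. b j m) * X i m)" for i
  proof -
    have "(\<Sum>j\<in>J. f j i) = (\<Sum>j\<in>J. \<Sum>m<k. b j m * X i m)"
      using b by simp
    also have "\<dots> = (\<Sum>m<k. \<Sum>j\<in>J. b j m * X i m)" by (rule sum.swap)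
    finally show ?thesis by (simp add: sum_distrib_right)
  qed
  then show ?thesis unfolding colspan_def by auto
qed

text \<open>Needed to turn a vanishing residual into a linear dependence of column \<open>k\<close>
  on the earlier columns. The residual uses earlier vectors and the vector is a multiple of the
  residual, hence the joint induction.\<close>

lemma gs_residual_colspan: "gs_vec D X k \<in> colspan X (Suc k) \<and> (\<lambda>i. X i k - gs_residual D X k i) \<in> colspan X k"
proof (induction k rule: less_induct)
  case (less k)
  have gk: "gs_vec D X j \<in> colspan X k" if "j < k" for j
    by (rule colspan_mono[of _ _ "Suc j"]) (use less that in auto)
  have *: "(\<lambda>i. X i k - gs_residual D X k i) \<in> colspan X k"
    unfolding gs_residual_def diff_diff_eq2 add_diff_cancel_left'
    by (intro colspan_sum colspan_scale gk) simp
  then obtain b where b: "\<And>i. X i k - gs_residual D X k i = (\<Sum>j<k. b j * X i j)"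
    by (auto simp: colspan_def)
  have "gs_residual D X k i = (\<Sum>j<Suc k. (if j = k then 1 else - b j) * X i j)" for i
    using b[of i] by (simp add: sum_negf algebra_simps)
  then have "gs_residual D X k \<in> colspan X (Suc k)"
    unfolding colspan_def by (intro CollectI exI[where x = "\<lambda>j. if j = k then 1 else - b j"] allI)
  then have "(\<lambda>i. (1 / of_real (sqrt (Re (ip {..<D} (gs_residual D X k) (gs_residual D X k))))) * gs_residual D X k i) \<in> colspan X (Suc k)"
    by (rule colspan_scale)
  then show ?case using * by (simp add: gs_vec_eq vnormalize_def)
qed

text \<open>A vanishing residual would give a linear relation between the columns in which column
  \<open>k\<close> has coefficient 1. In the row of the largest coefficient the diagonal term
  outweighs the \<open>D - 1\<close> others. The first hypothesis is
  \<open>(D - 1) e < |X i i|\<close> freed of the subtraction.\<close>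

lemma gs_defined_diag_dominant:
  assumes diag: "\<And>i. i < D \<Longrightarrow> real D * e < cmod (X i i) + e"
    and off: "\<And>i j. i < D \<Longrightarrow> j < D \<Longrightarrow> i \<noteq> j \<Longrightarrow> cmod (X i j) \<le> e"
  shows "gs_defined D X"
  unfolding gs_defined_def
proof (intro allI impI notI)
  fix k assume k: "k < D" and z: "Re (ip {..<D} (gs_residual D X k) (gs_residual D X k)) = 0"
  have r0: "gs_residual D X k i = 0" if "i < D" for i
    using z that unfolding ip_self_Re by (subst (asm) sum_nonneg_eq_0_iff) auto
  obtain b where b: "\<And>i. X i k - gs_residual D X k i = (\<Sum>j<k. b j * X i j)"
    using gs_residual_colspan[of D X k] by (auto simp: colspan_def)
  define x where "x j = (if j = k then 1 else if j < k then - b j else 0)" for j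
  have zero: "(\<Sum>j<D. X i j * x j) = 0" if "i < D" for i
  proof -
    have "(\<Sum>j<D. X i j * x j) = (\<Sum>j<Suc k. X i j * x j)"
      using k by (intro sum.mono_neutral_right) (auto simp: x_def)
    also have "\<dots> = X i k - (\<Sum>j<k. b j * X i j)"
      by (simp add: x_def sum_negf mult.commute)
    also have "\<dots> = 0" using b[of i] r0[OF that] by simp
    finally show ?thesis .
  qed
  define m where "m = Max ((\<lambda>j. cmod (x j)) ` {..<D})"
  have le: "cmod (x j) \<le> m" if "j < D" for j
    unfolding m_def using that by (intro Max_ge) auto
  have "m \<in> (\<lambda>j. cmod (x j)) ` {..<D}"
    unfolding m_def using k by (intro Max_in) auto
  then obtain i where i: "i < D" "cmod (x i) = m" by auto
  have m1: "m \<ge> 1" using le[OF k] by (simp add: x_def)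
  have "X i i * x i = - (\<Sum>j\<in>{..<D} - {i}. X i j * x j)"
    using zero[OF i(1)] i(1) by (simp add: sum.remove[of "{..<D}" i] eq_neg_iff_add_eq_0)
  then have "cmod (X i i) * m = cmod (\<Sum>j\<in>{..<D} - {i}. X i j * x j)"
    by (metis i(2) norm_minus_cancel norm_mult)
  also have "\<dots> \<le> (\<Sum>j\<in>{..<D} - {i}. e * m)"
  proof (rule sum_norm_le)
    fix j assume j: "j \<in> {..<D} - {i}"
    have "0 \<le> e" using order_trans[OF norm_ge_zero off[of i j]] i j by auto
    then show "cmod (X i j * x j) \<le> e * m"
      unfolding norm_mult using j i le off by (intro mult_mono) auto
  qed
  also have "\<dots> = (real D - 1) * e * m"
    using i(1) by (simp add: of_nat_diff Suc_le_eq)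
  finally have "cmod (X i i) \<le> (real D - 1) * e"
    using m1 by simp
  then show False using diag[OF i(1)] by (simp add: algebra_simps)
qed

lemma measurable_gs_vec: "(\<lambda>X. gs_vec D X k i) \<in> borel_measurable borel"
  and measurable_gs_residual: "(\<lambda>X. gs_residual D X k i) \<in> borel_measurable borel"
proof -
  have "\<forall>i. (\<lambda>X. gs_vec D X k i) \<in> borel_measurable borel \<and> (\<lambda>X. gs_residual D X k i) \<in> borel_measurable borel"
  proof (induction k rule: less_induct)
    case (less k)
    have r: "(\<lambda>X. gs_residual D X k i) \<in> borel_measurable borel" for i
      unfolding gs_residual_def ip_def
      using less by (intro borel_measurable_diff borel_measurable_sum borel_measurable_times
        borel_measurable_cnj measurable_entry_borel) auto
    have "(\<lambda>X. gs_residual D X k i / of_real (sqrt (Re (\<Sum>l<D. cnj (gs_residual D X k l) * gs_residual D X k l)))) \<in> borel_measurable borel" for i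
      using r by measurable
    then show ?case using r by (simp add: gs_vec_eq vnormalize_def ip_def)
  qed
  then show "(\<lambda>X. gs_vec D X k i) \<in> borel_measurable borel" "(\<lambda>X. gs_residual D X k i) \<in> borel_measurable borel"
    by auto
qed

lemma gs_defined_sets: "{X. gs_defined D X} \<in> sets borel"
proof -
  have [measurable]: "(\<lambda>X. Re (ip {..<D} (gs_residual D X k) (gs_residual D X k))) \<in> borel_measurable borel" for k
    unfolding ip_def using measurable_gs_residual[of D k] by measurable
  have "{X \<in> space borel. gs_defined D X} \<in> sets borel"
    unfolding gs_defined_def by measurable
  then show ?thesis by simp
qed

lemma measurable_mdet:
  fixes f :: "'x \<Rightarrow> nat \<Rightarrow> nat \<Rightarrow> complex"
  assumes "f \<in> borel_measurable M"
  shows "(\<lambda>x. mdet D (f x)) \<in> borel_measurable M"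
  unfolding mdet_def
  by (intro borel_measurable_sum borel_measurable_times borel_measurable_prod assms[THEN measurable_entry]
      borel_measurable_const)

lemma measurable_gs_matrix: "gs_matrix D \<in> borel_measurable borel"
proof (rule measurable_matrix)
  fix i k
  show "(\<lambda>X. gs_matrix D X i k) \<in> borel_measurable borel"
    unfolding gs_matrix_def using measurable_gs_vec by (cases "i < D \<and> k < D") auto
qed

lemma measurable_det_normalize: "det_normalize D \<in> borel_measurable borel"
proof (rule measurable_matrix)
  fix i k
  have m: "(\<lambda>U. mdet D U) \<in> borel_measurable borel"
    by (intro measurable_mdet) simp
  show "(\<lambda>U. det_normalize D U i k) \<in> borel_measurable borel"
    unfolding det_normalize_def
    by (cases "k = 0") (auto intro!: borel_measurable_times borel_measurable_cnj m measurable_entry_borel)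
qed


section \<open>Existence and uniqueness of Haar measure\<close>

definition is_haar :: "nat \<Rightarrow> (nat \<Rightarrow> nat \<Rightarrow> complex) measure \<Rightarrow> bool" where
  "is_haar D M \<longleftrightarrow> sets M = sets (borel :: (nat \<Rightarrow> nat \<Rightarrow> complex) measure) \<and>
      emeasure M (space M) = 1 \<and> emeasure M (SU D) = 1 \<and>
      (\<forall>V\<in>SU D. distr M borel (\<lambda>U. mmult {..<D} V U) = M)"

text \<open>The ball makes the volume finite, so that it can be normalised. Left multiplication by a
  unitary matrix preserves both sets.\<close>

definition gs_domain :: "nat \<Rightarrow> (nat \<Rightarrow> nat \<Rightarrow> complex) set" where
  "gs_domain D = hs_ball D \<inter> {X. gs_defined D X}"

lemma gs_domain_sets: "gs_domain D \<in> sets borel"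
  unfolding gs_domain_def by (intro sets.Int hs_ball_sets gs_defined_sets)

lemma emeasure_gs_domain:
  assumes "0 < D"
  shows "emeasure (matrix_lebesgue D) (gs_domain D) \<noteq> 0" "emeasure (matrix_lebesgue D) (gs_domain D) \<noteq> \<infinity>"
proof -
  \<comment> \<open>Centre and radius of a box inside the domain: entries stay below 1/(2 D) + 1/(4
    D), hence below 1/D, and \<open>real D * e\<close> is 1/(4 D), which the diagonal value 1/(2 D)
    dominates.\<close>
  define c where "c = (\<lambda>i j :: nat. if i = j then of_real (1 / (2 * real D)) else 0 :: complex)"
  define e where "e = 1 / (4 * (real D)\<^sup>2)"
  have D1: "real D \<ge> 1" using assms by simp
  have e0: "e > 0" using assms by (simp add: e_def)
  have De: "real D * e = 1 / (4 * real D)"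
    using assms by (simp add: e_def power2_eq_square)
  have eD: "e \<le> 1 / (4 * real D)"
    using D1 e0 unfolding De[symmetric] by simp
  have "matrix_box D c e \<subseteq> hs_ball D"
  proof (rule matrix_box_subset_hs_ball)
    fix i j
    have "cmod (c i j) \<le> 1 / (2 * real D)" by (simp add: c_def norm_divide norm_mult)
    then show "cmod (c i j) + e \<le> 1 / real D"
      using eD D1 by (simp add: field_simps)
  qed
  moreover have "gs_defined D X" if "X \<in> matrix_box D c e" for X
  proof (rule gs_defined_diag_dominant)
    fix i assume i: "i < D"
    have "dist (c i i) (X i i) \<le> e" using that i by (auto simp: matrix_box_def)
    then have "1 / (2 * real D) \<le> cmod (X i i) + e"
      using norm_triangle_sub[of "c i i" "X i i"] by (simp add: c_def dist_norm norm_divide norm_mult)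
    moreover have "1 / (4 * real D) < 1 / (2 * real D)"
      using D1 by (simp add: field_simps)
    ultimately show "real D * e < cmod (X i i) + e"
      unfolding De by linarith
  next
    fix i j assume ij: "i < D" "j < D" "i \<noteq> j"
    then have "dist (c i j) (X i j) \<le> e" using that by (auto simp: matrix_box_def)
    then show "cmod (X i j) \<le> e" using ij by (simp add: c_def dist_norm)
  qed
  ultimately have "matrix_box D c e \<subseteq> gs_domain D" by (auto simp: gs_domain_def)
  then have "emeasure (matrix_lebesgue D) (matrix_box D c e) \<le> emeasure (matrix_lebesgue D) (gs_domain D)"
    by (intro emeasure_mono) (simp_all add: sets_matrix_lebesgue gs_domain_sets)
  then show "emeasure (matrix_lebesgue D) (gs_domain D) \<noteq> 0"
    using emeasure_matrix_box_pos[OF e0, of D c] by auto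
  have "emeasure (matrix_lebesgue D) (gs_domain D) \<le> emeasure (matrix_lebesgue D) (hs_ball D)"
    by (intro emeasure_mono) (auto simp: sets_matrix_lebesgue hs_ball_sets gs_domain_def)
  then show "emeasure (matrix_lebesgue D) (gs_domain D) \<noteq> \<infinity>"
    using emeasure_hs_ball_finite[of D] by auto
qed

lemma SU_sets: "SU D \<in> sets borel"
proof -
  have s: "{X \<in> space borel. \<forall>i j. \<not> (i < D \<and> j < D) \<longrightarrow> X i j = (0::complex)} \<in> sets borel"
    using measurable_entry_borel by measurable
  have u: "{X \<in> space borel. \<forall>i j. mmult {..<D} (madj X) X i j = mat_id {..<D} i j} \<in> sets borel"
  proof -
    have "(\<lambda>X. mmult {..<D} (madj X) X) \<in> borel_measurable borel"
      by (intro measurable_mmult measurable_madj) auto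
    from measurable_entry[OF this] show ?thesis by measurable
  qed
  have d: "{X \<in> space borel. mdet D X = 1} \<in> sets borel"
    using measurable_mdet[of "\<lambda>X. X" borel D] by measurable
  have "SU D = {X \<in> space borel. \<forall>i j. \<not> (i < D \<and> j < D) \<longrightarrow> X i j = (0::complex)}
      \<inter> {X \<in> space borel. \<forall>i j. mmult {..<D} (madj X) X i j = mat_id {..<D} i j}
      \<inter> {X \<in> space borel. mdet D X = 1}"
    unfolding set_eq_iff by (simp add: SU_iff unitary_on_def supported_on_def fun_eq_iff)
  then show ?thesis using s u d by (simp only: sets.Int)
qed

text \<open>The map \<open>F\<close> intertwines left multiplication by elements of
  \<open>SU D\<close>, and the domain is preserved by it, so invariance of Lebesgue measure passes
  to the image of its normalised restriction.\<close>

lemma haar_exists: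
  assumes D: "0 < D"
  shows "\<exists>M. is_haar D M"
proof -
  let ?L = "matrix_lebesgue D" and ?K = "gs_domain D"
  define F where "F = (\<lambda>X. det_normalize D (gs_matrix D X))"
  have F: "F \<in> borel_measurable borel"
    unfolding F_def by (rule measurable_compose[OF measurable_gs_matrix measurable_det_normalize])
  have FSU: "F X \<in> SU D" if "X \<in> ?K" for X
    unfolding F_def using that D by (intro det_normalize_in_SU unitary_gs_matrix) (auto simp: gs_domain_def)
  define M where "M = distr (uniform_measure ?L ?K) borel F"
  have FL: "F \<in> borel_measurable (uniform_measure ?L ?K)"
    using F by (simp cong: measurable_cong_sets add: sets_matrix_lebesgue)
  have em: "emeasure M S = emeasure ?L (?K \<inter> F -` S) / emeasure ?L ?K" if "S \<in> sets borel" for S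
  proof -
    have FS: "F -` S \<in> sets borel"
      using measurable_sets[OF F that] by simp
    have "emeasure M S = emeasure (uniform_measure ?L ?K) (F -` S)"
      unfolding M_def using FL that by (subst emeasure_distr) simp_all
    also have "\<dots> = emeasure ?L (?K \<inter> F -` S) / emeasure ?L ?K"
      by (rule emeasure_uniform_measure) (simp_all add: sets_matrix_lebesgue gs_domain_sets FS)
    finally show ?thesis .
  qed
  have one: "emeasure ?L ?K / emeasure ?L ?K = 1"
    using emeasure_gs_domain[OF D] by (simp add: ennreal_divide_self less_top)
  have sets: "sets M = sets borel" by (simp add: M_def)
  have "emeasure M (space M) = 1"
    using em[of UNIV] one by (simp add: M_def)
  moreover have "emeasure M (SU D) = 1"
  proof -
    have "?K \<inter> F -` SU D = ?K" using FSU by auto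
    then show ?thesis using em[OF SU_sets] one by simp
  qed
  moreover have "distr M borel (mmult {..<D} V) = M" if V: "V \<in> SU D" for V
  proof (rule measure_eqI)
    fix S assume "S \<in> sets (distr M borel (mmult {..<D} V))"
    then have S: "S \<in> sets borel" by simp
    let ?V = "mmult {..<D} V"
    have U: "unitary_on D V" using V by (simp add: SU_iff)
    have mV: "?V \<in> borel_measurable borel" by (intro measurable_mmult) auto
    have VS: "?V -` S \<in> sets borel" using measurable_sets[OF mV S] by simp
    have FS: "?K \<inter> F -` T \<in> sets borel" if "T \<in> sets borel" for T
      using measurable_sets[OF F that] gs_domain_sets by auto
    have FV: "F (?V X) = ?V (F X)" for X
      by (simp add: F_def gs_matrix_unitary[OF U] det_normalize_mmult[OF V])
    have KV: "?V X \<in> ?K \<longleftrightarrow> X \<in> ?K" for X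
      by (simp add: gs_domain_def hs_ball_def hs_norm2_mmult[OF U] gs_defined_unitary[OF U])
    have "emeasure ?L (?K \<inter> F -` (?V -` S)) = (\<integral>\<^sup>+X. indicator (?K \<inter> F -` (?V -` S)) X \<partial>?L)"
      by (rule nn_integral_indicator[symmetric]) (simp add: sets_matrix_lebesgue FS[OF VS])
    also have "\<dots> = (\<integral>\<^sup>+X. indicator (?K \<inter> F -` S) (?V X) \<partial>?L)"
      by (intro nn_integral_cong) (simp add: indicator_def FV KV)
    also have "\<dots> = (\<integral>\<^sup>+X. indicator (?K \<inter> F -` S) X \<partial>?L)"
      by (rule matrix_lebesgue_unitary_invariant[OF _ U]) (intro borel_measurable_indicator FS[OF S])
    also have "\<dots> = emeasure ?L (?K \<inter> F -` S)"
      by (rule nn_integral_indicator) (simp add: sets_matrix_lebesgue FS[OF S])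
    finally have "emeasure M (?V -` S) = emeasure M S"
      by (simp add: em S VS)
    moreover have "emeasure (distr M borel ?V) S = emeasure M (?V -` S)"
      using mV S by (subst emeasure_distr) (simp_all add: M_def)
    ultimately show "emeasure (distr M borel ?V) S = emeasure M S" by simp
  qed (simp add: sets)
  ultimately show ?thesis
    using sets unfolding is_haar_def by blast
qed

lemma is_haar_AE:
  assumes "is_haar D M"
  shows "AE U in M. U \<in> SU D"
proof -
  interpret prob_space M
    using assms by (intro prob_spaceI) (simp add: is_haar_def)
  have "prob (SU D) = 1"
    using assms by (simp add: is_haar_def measure_def)
  then show ?thesis
    using assms SU_sets by (intro AE_prob_1) simp
qed

lemma is_haar_nn_integral:
  assumes M: "is_haar D M" and V: "V \<in> SU D" and F: "F \<in> borel_measurable borel"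
  shows "(\<integral>\<^sup>+U. F (mmult {..<D} V U) \<partial>M) = (\<integral>\<^sup>+U. F U \<partial>M)"
proof -
  have s: "sets M = sets borel" using M by (simp add: is_haar_def)
  have mV: "mmult {..<D} V \<in> measurable M borel"
    unfolding measurable_cong_sets[OF s refl] by (intro measurable_mmult) auto
  have "(\<integral>\<^sup>+U. F U \<partial>M) = (\<integral>\<^sup>+U. F U \<partial>distr M borel (mmult {..<D} V))"
    using M V by (simp add: is_haar_def)
  also have "\<dots> = (\<integral>\<^sup>+U. F (mmult {..<D} V U) \<partial>M)"
    by (rule nn_integral_distr_meas[OF mV F])
  finally show ?thesis by simp
qed

text \<open>Averaging over \<open>V\<close> with respect to \<open>N\<close> changes
  \<open>F U\<close> into \<open>F (madj V U)\<close>. After swapping the integrals,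
  \<open>madj V U\<close> is the adjoint of \<open>madj U V\<close>, and left invariance of
  \<open>N\<close> removes \<open>U\<close>. The right side does not mention \<open>M\<close>,
  whence uniqueness.\<close>

lemma is_haar_inverse:
  assumes M: "is_haar D M" and N: "is_haar D N" and F: "F \<in> borel_measurable borel"
  shows "(\<integral>\<^sup>+U. F U \<partial>M) = (\<integral>\<^sup>+V. F (madj V) \<partial>N)"
proof -
  interpret M: prob_space M
    using M by (intro prob_spaceI) (simp add: is_haar_def)
  interpret N: prob_space N
    using N by (intro prob_spaceI) (simp add: is_haar_def)
  interpret P: pair_sigma_finite N M ..
  have s: "sets M = sets borel" "sets N = sets borel"
    using M N by (simp_all add: is_haar_def)
  have Fadj: "(\<lambda>V. F (madj V)) \<in> borel_measurable borel"
    by (rule measurable_compose[OF _ F]) (intro measurable_madj, simp)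
  have fst: "(\<lambda>p. fst p) \<in> borel_measurable (N \<Otimes>\<^sub>M M)" and snd: "(\<lambda>p. snd p) \<in> borel_measurable (N \<Otimes>\<^sub>M M)"
    using measurable_fst[of N M] measurable_snd[of N M]
    unfolding measurable_cong_sets[OF refl s(1)] measurable_cong_sets[OF refl s(2)] by auto
  have "(\<integral>\<^sup>+U. F U \<partial>M) = (\<integral>\<^sup>+V. (\<integral>\<^sup>+U. F U \<partial>M) \<partial>N)"
    by (simp add: N.emeasure_space_1)
  also have "\<dots> = (\<integral>\<^sup>+V. (\<integral>\<^sup>+U. F (mmult {..<D} (madj V) U) \<partial>M) \<partial>N)"
    using is_haar_AE[OF N]
    by (intro nn_integral_cong_AE, eventually_elim) (simp add: is_haar_nn_integral[OF M SU_madj F])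
  also have "\<dots> = (\<integral>\<^sup>+U. (\<integral>\<^sup>+V. F (mmult {..<D} (madj V) U) \<partial>N) \<partial>M)"
  proof -
    have "(\<lambda>p. F (mmult {..<D} (madj (fst p)) (snd p))) \<in> borel_measurable (N \<Otimes>\<^sub>M M)"
      by (rule measurable_compose[OF measurable_mmult[OF measurable_madj[OF fst] snd] F])
    from P.Fubini[OF this] show ?thesis by simp
  qed
  also have "\<dots> = (\<integral>\<^sup>+U. (\<integral>\<^sup>+V. F (madj V) \<partial>N) \<partial>M)"
    using is_haar_AE[OF M]
  proof (intro nn_integral_cong_AE, eventually_elim)
    fix U assume U: "U \<in> SU D"
    have "(\<integral>\<^sup>+V. F (mmult {..<D} (madj V) U) \<partial>N) = (\<integral>\<^sup>+V. F (madj (mmult {..<D} (madj U) V)) \<partial>N)"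
      by (simp add: madj_mmult madj_madj)
    also have "\<dots> = (\<integral>\<^sup>+V. F (madj V) \<partial>N)"
      by (rule is_haar_nn_integral[OF N SU_madj[OF U] Fadj])
    finally show "(\<integral>\<^sup>+V. F (mmult {..<D} (madj V) U) \<partial>N) = (\<integral>\<^sup>+V. F (madj V) \<partial>N)" .
  qed
  also have "\<dots> = (\<integral>\<^sup>+V. F (madj V) \<partial>N)"
    by (simp add: M.emeasure_space_1)
  finally show ?thesis .
qed

lemma is_haar_unique:
  assumes M: "is_haar D M" and N: "is_haar D N"
  shows "M = N"
proof (rule measure_eqI)
  have s: "sets M = sets borel" "sets N = sets borel"
    using M N by (simp_all add: is_haar_def)
  then show "sets M = sets N" by simp
  fix S assume S: "S \<in> sets M"
  then have "indicator S \<in> borel_measurable (borel :: (nat \<Rightarrow> nat \<Rightarrow> complex) measure)"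
    using s by (intro borel_measurable_indicator) simp
  from is_haar_inverse[OF M N this] is_haar_inverse[OF N N this]
  show "emeasure M S = emeasure N S"
    using S s by simp
qed

lemma haar_is_haar:
  assumes "0 < D"
  shows "is_haar D (haar D)"
proof -
  obtain M where M: "is_haar D M" using haar_exists[OF assms] by blast
  have "haar D = M"
    unfolding haar_def is_haar_def[symmetric]
    by (rule the_equality[where P = "is_haar D", OF M]) (rule is_haar_unique[OF _ M])
  then show ?thesis using M by simp
qed

section \<open>Moments of Haar measure\<close>

locale haar_space =
  fixes D :: nat
  assumes D_pos: "0 < D"
begin

abbreviation "H \<equiv> haar D"
abbreviation "H2 \<equiv> H \<Otimes>\<^sub>M H"

lemma sets_H: "sets H = sets borel"
  using haar_is_haar[OF D_pos] by (simp add: is_haar_def)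

lemma space_H: "space H = UNIV"
  using sets_eq_imp_space_eq[OF sets_H] by simp

sublocale H: prob_space H
  using haar_is_haar[OF D_pos] by (intro prob_spaceI) (simp add: is_haar_def)

sublocale P: pair_prob_space H H ..

lemma AE_SU: "AE U in H. U \<in> SU D"
  by (rule is_haar_AE[OF haar_is_haar[OF D_pos]])

lemma measurable_H: "measurable H M = measurable borel M"
  by (rule measurable_cong_sets[OF sets_H refl])

lemma integral_invariant:
  fixes f :: "(nat \<Rightarrow> nat \<Rightarrow> complex) \<Rightarrow> complex"
  assumes "V \<in> SU D" "f \<in> borel_measurable H"
  shows "(\<integral>U. f (mmult {..<D} V U) \<partial>H) = (\<integral>U. f U \<partial>H)"
proof -
  have V: "mmult {..<D} V \<in> measurable H borel"
    unfolding measurable_H by (intro measurable_mmult) auto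
  have "(\<integral>U. f U \<partial>H) = (\<integral>U. f U \<partial>distr H borel (mmult {..<D} V))"
    using haar_is_haar[OF D_pos] assms(1) by (simp add: is_haar_def)
  also have "\<dots> = (\<integral>U. f (mmult {..<D} V U) \<partial>H)"
    by (rule integral_distr[OF V assms(2)[unfolded measurable_H]])
  finally show ?thesis by simp
qed

text \<open>Entries are unbounded on the whole space, so the bound is required only on
  \<open>SU D\<close>, which has full measure. Closure under arithmetic then gives integrability of
  all polynomials in the entries and their conjugates.\<close>

definition bounded_fun :: "((nat \<Rightarrow> nat \<Rightarrow> complex) \<Rightarrow> complex) \<Rightarrow> bool" where
  "bounded_fun f \<longleftrightarrow> f \<in> borel_measurable H \<and> (\<exists>C. \<forall>U\<in>SU D. cmod (f U) \<le> C)"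

definition bounded_fun2 :: "((nat \<Rightarrow> nat \<Rightarrow> complex) \<times> (nat \<Rightarrow> nat \<Rightarrow> complex) \<Rightarrow> complex) \<Rightarrow> bool" where
  "bounded_fun2 f \<longleftrightarrow> f \<in> borel_measurable H2 \<and> (\<exists>C. \<forall>W\<in>SU D. \<forall>U\<in>SU D. cmod (f (W, U)) \<le> C)"

lemma bounded_fun_integrable:
  assumes "bounded_fun f"
  shows "integrable H f"
proof -
  obtain C where C: "\<And>U. U \<in> SU D \<Longrightarrow> cmod (f U) \<le> C" and f: "f \<in> borel_measurable H"
    using assms by (auto simp: bounded_fun_def)
  have "AE U in H. cmod (f U) \<le> C" using AE_SU by eventually_elim (rule C)
  then show ?thesis using f by (rule H.integrable_const_bound)
qed

lemma AE2_SU: "AE p in H2. fst p \<in> SU D \<and> snd p \<in> SU D"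
proof -
  have S: "SU D \<in> sets H" by (simp add: sets_H SU_sets)
  have "AE W in H. AE U in H. fst (W, U) \<in> SU D \<and> snd (W, U) \<in> SU D"
    using AE_SU
  proof eventually_elim
    case (elim W)
    show ?case using AE_SU by eventually_elim (use elim in simp)
  qed
  moreover have "{p \<in> space H2. fst p \<in> SU D \<and> snd p \<in> SU D} \<in> sets H2"
  proof -
    have "{p \<in> space H2. fst p \<in> SU D \<and> snd p \<in> SU D} = SU D \<times> SU D"
      by (auto simp: space_pair_measure space_H)
    then show ?thesis using S by simp
  qed
  ultimately show ?thesis by (intro P.AE_pair_measure) auto
qed

lemma bounded_fun2_integrable:
  assumes "bounded_fun2 f"
  shows "integrable H2 f"
proof -
  obtain C where C: "\<And>W U. W \<in> SU D \<Longrightarrow> U \<in> SU D \<Longrightarrow> cmod (f (W, U)) \<le> C"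
    and f: "f \<in> borel_measurable H2"
    using assms by (auto simp: bounded_fun2_def)
  have "AE p in H2. cmod (f p) \<le> C"
    using AE2_SU by eventually_elim (use C in auto)
  then show ?thesis using f by (rule P.integrable_const_bound)
qed

lemma bounded_fun2_fubini:
  assumes "bounded_fun2 f"
  shows "(\<integral>p. f p \<partial>H2) = (\<integral>W. (\<integral>U. f (W, U) \<partial>H) \<partial>H)"
  using P.integral_fst'[OF bounded_fun2_integrable[OF assms]] by simp

lemma integral2_invariant:
  assumes V: "V \<in> SU D" and f: "bounded_fun2 f" and f': "bounded_fun2 (\<lambda>p. f (mmult {..<D} V (fst p), mmult {..<D} V (snd p)))"
  shows "(\<integral>p. f (mmult {..<D} V (fst p), mmult {..<D} V (snd p)) \<partial>H2) = (\<integral>p. f p \<partial>H2)"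
proof -
  have m: "f \<in> borel_measurable H2" using f by (simp add: bounded_fun2_def)
  have "(\<integral>p. f (mmult {..<D} V (fst p), mmult {..<D} V (snd p)) \<partial>H2)
      = (\<integral>W. (\<integral>U. f (mmult {..<D} V W, mmult {..<D} V U) \<partial>H) \<partial>H)"
    using bounded_fun2_fubini[OF f'] by simp
  also have "\<dots> = (\<integral>W. (\<integral>U. f (mmult {..<D} V W, U) \<partial>H) \<partial>H)"
  proof (rule Bochner_Integration.integral_cong[OF refl])
    fix W
    have "(\<lambda>U. f (mmult {..<D} V W, U)) \<in> borel_measurable H"
      by (rule measurable_Pair2[OF m]) (simp add: space_H)
    then show "(\<integral>U. f (mmult {..<D} V W, mmult {..<D} V U) \<partial>H) = (\<integral>U. f (mmult {..<D} V W, U) \<partial>H)"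
      by (rule integral_invariant[OF V])
  qed
  also have "\<dots> = (\<integral>W. (\<integral>U. f (W, U) \<partial>H) \<partial>H)"
  proof (rule integral_invariant[OF V, where f = "\<lambda>W. \<integral>U. f (W, U) \<partial>H"])
    show "(\<lambda>W. \<integral>U. f (W, U) \<partial>H) \<in> borel_measurable H"
      using m by (intro H.borel_measurable_lebesgue_integral) simp
  qed
  also have "\<dots> = (\<integral>p. f p \<partial>H2)"
    using bounded_fun2_fubini[OF f] by simp
  finally show ?thesis .
qed

lemma bounded_fun_const: "bounded_fun (\<lambda>_. c)"
  by (auto simp: bounded_fun_def)

lemma bounded_fun_entry: "bounded_fun (\<lambda>U. U i j)"
  unfolding bounded_fun_def measurable_H
  using measurable_entry_borel unitary_entry_le_1 by (auto simp: SU_iff intro!: exI[of _ 1])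

lemma bounded_fun_cnj: "bounded_fun f \<Longrightarrow> bounded_fun (\<lambda>U. cnj (f U))"
  unfolding bounded_fun_def using borel_measurable_cnj by auto

lemma bounded_fun_mult:
  assumes "bounded_fun f" "bounded_fun g"
  shows "bounded_fun (\<lambda>U. f U * g U)"
proof -
  obtain C C' where "\<And>U. U \<in> SU D \<Longrightarrow> cmod (f U) \<le> C" "\<And>U. U \<in> SU D \<Longrightarrow> cmod (g U) \<le> C'"
    using assms by (auto simp: bounded_fun_def)
  then have "\<forall>U\<in>SU D. cmod (f U * g U) \<le> C * C'"
    unfolding norm_mult by (meson mult_mono norm_ge_zero order_trans)
  then show ?thesis using assms unfolding bounded_fun_def by (auto intro: borel_measurable_times)
qed

lemma bounded_fun_add:
  assumes "bounded_fun f" "bounded_fun g"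
  shows "bounded_fun (\<lambda>U. f U + g U)"
proof -
  obtain C C' where "\<And>U. U \<in> SU D \<Longrightarrow> cmod (f U) \<le> C" "\<And>U. U \<in> SU D \<Longrightarrow> cmod (g U) \<le> C'"
    using assms by (auto simp: bounded_fun_def)
  then have "\<forall>U\<in>SU D. cmod (f U + g U) \<le> C + C'"
    by (meson add_mono norm_triangle_ineq order_trans)
  then show ?thesis using assms unfolding bounded_fun_def by (auto intro: borel_measurable_add)
qed

lemma bounded_fun_power: "bounded_fun f \<Longrightarrow> bounded_fun (\<lambda>U. f U ^ n)"
  by (induction n) (simp_all add: bounded_fun_const bounded_fun_mult)

lemma bounded_fun_sum: "(\<And>i. i \<in> I \<Longrightarrow> bounded_fun (f i)) \<Longrightarrow> bounded_fun (\<lambda>U. \<Sum>i\<in>I. f i U)"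
  by (induction I rule: infinite_finite_induct) (simp_all add: bounded_fun_const bounded_fun_add)

lemma bounded_fun_prod: "(\<And>i. i \<in> I \<Longrightarrow> bounded_fun (f i)) \<Longrightarrow> bounded_fun (\<lambda>U. \<Prod>i\<in>I. f i U)"
  by (induction I rule: infinite_finite_induct) (simp_all add: bounded_fun_const bounded_fun_mult)

lemmas bounded_fun_intros = bounded_fun_const bounded_fun_entry bounded_fun_cnj bounded_fun_mult bounded_fun_add bounded_fun_power bounded_fun_sum bounded_fun_prod

lemma bounded_fun2_fst:
  assumes "bounded_fun f"
  shows "bounded_fun2 (\<lambda>p. f (fst p))"
  using assms measurable_compose[OF measurable_fst, of f H borel H] by (auto simp: bounded_fun_def bounded_fun2_def)

lemma bounded_fun2_snd:
  assumes "bounded_fun f"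
  shows "bounded_fun2 (\<lambda>p. f (snd p))"
  using assms measurable_compose[OF measurable_snd, of f H borel H] by (auto simp: bounded_fun_def bounded_fun2_def)

lemma bounded_fun2_mult:
  assumes "bounded_fun2 f" "bounded_fun2 g"
  shows "bounded_fun2 (\<lambda>p. f p * g p)"
proof -
  obtain C C' where "\<forall>W\<in>SU D. \<forall>U\<in>SU D. cmod (f (W, U)) \<le> C"
    "\<forall>W\<in>SU D. \<forall>U\<in>SU D. cmod (g (W, U)) \<le> C'"
    using assms unfolding bounded_fun2_def by blast
  then have "\<forall>W\<in>SU D. \<forall>U\<in>SU D. cmod (f (W, U) * g (W, U)) \<le> C * C'"
    unfolding norm_mult by (meson mult_mono norm_ge_zero order_trans)
  then show ?thesis using assms unfolding bounded_fun2_def by (auto intro: borel_measurable_times)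
qed

lemma bounded_fun2_add:
  assumes "bounded_fun2 f" "bounded_fun2 g"
  shows "bounded_fun2 (\<lambda>p. f p + g p)"
proof -
  obtain C C' where "\<forall>W\<in>SU D. \<forall>U\<in>SU D. cmod (f (W, U)) \<le> C"
    "\<forall>W\<in>SU D. \<forall>U\<in>SU D. cmod (g (W, U)) \<le> C'"
    using assms unfolding bounded_fun2_def by blast
  then have "\<forall>W\<in>SU D. \<forall>U\<in>SU D. cmod (f (W, U) + g (W, U)) \<le> C + C'"
    by (meson add_mono norm_triangle_ineq order_trans)
  then show ?thesis using assms unfolding bounded_fun2_def by (auto intro: borel_measurable_add)
qed

lemma bounded_fun2_const: "bounded_fun2 (\<lambda>_. c)"
  by (auto simp: bounded_fun2_def)

lemma bounded_fun2_cnj: "bounded_fun2 f \<Longrightarrow> bounded_fun2 (\<lambda>p. cnj (f p))"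
  unfolding bounded_fun2_def using borel_measurable_cnj by auto

lemma bounded_fun2_power: "bounded_fun2 f \<Longrightarrow> bounded_fun2 (\<lambda>p. f p ^ n)"
  by (induction n) (simp_all add: bounded_fun2_const bounded_fun2_mult)

lemma bounded_fun2_sum: "(\<And>i. i \<in> I \<Longrightarrow> bounded_fun2 (f i)) \<Longrightarrow> bounded_fun2 (\<lambda>p. \<Sum>i\<in>I. f i p)"
  by (induction I rule: infinite_finite_induct) (simp_all add: bounded_fun2_const bounded_fun2_add)

lemmas bounded_fun2_intros = bounded_fun2_const bounded_fun2_fst[OF bounded_fun_entry] bounded_fun2_snd[OF bounded_fun_entry] bounded_fun2_cnj bounded_fun2_mult bounded_fun2_add bounded_fun2_power bounded_fun2_sum

lemma mmult_rot:
  assumes "j < D" "l < D" "j \<noteq> l" "i < D"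
  shows "mmult {..<D} (rot D j l a b) U i k =
    (if i = j then a * U j k + b * U l k else if i = l then - cnj b * U j k + cnj a * U l k else U i k)"
  using mat_vec_rot[OF assms, of a b "\<lambda>m. U m k"] by (simp add: mmult_eq_mat_vec)

section \<open>Moments of a single Haar column\<close>

definition moment :: "nat \<Rightarrow> complex" where
  "moment k = (\<integral>U. (U 0 0 * cnj (U 0 0)) ^ k \<partial>H)"

lemma moment_0: "moment 0 = 1"
  by (simp add: moment_def H.prob_space)

text \<open>A diagonal matrix of determinant 1 multiplies the entries 0 and \<open>l\<close> by
  opposite phases. Since \<open>r - s = q - p\<close>, the integrand gains the total phase
  \<open>2 (p - q) t\<close>.\<close>

lemma phase_vanish:
  assumes l: "l < D" "l \<noteq> 0" and pq: "p \<noteq> q" "p + r = q + s"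
  shows "(\<integral>U. U 0 0 ^ p * cnj (U 0 0) ^ q * U l 0 ^ r * cnj (U l 0) ^ s \<partial>H) = 0" (is "integral\<^sup>L H ?f = 0")
proof -
  \<comment> \<open>Chosen so that the total phase is pi and the integral equals its own
    negative.\<close>
  define t where "t = pi / (2 * (real p - real q))"
  let ?V = "rot D 0 l (cis t) 0"
  have V: "?V \<in> SU D"
    using D_pos l by (intro rot_in_SU) (auto simp: cis_cnj cis_mult)
  have bmf: "bounded_fun ?f" by (intro bounded_fun_intros)
  have rs: "real s = real p + real r - real q" using pq(2) by linarith
  have "?f (mmult {..<D} ?V U) = - ?f U" for U
  proof -
    have "?f (mmult {..<D} ?V U) = cis t ^ p * cis (- t) ^ q * cis (- t) ^ r * cis t ^ s * ?f U"
      using D_pos l by (simp add: mmult_rot power_mult_distrib cis_cnj mult_ac)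
    also have "cis t ^ p * cis (- t) ^ q * cis (- t) ^ r * cis t ^ s = cis (real p * t - real q * t - real r * t + real s * t)"
      by (simp add: Complex.DeMoivre cis_mult)
    also have "real p * t - real q * t - real r * t + real s * t = 2 * (real p - real q) * t"
      unfolding rs by (simp add: algebra_simps)
    also have "\<dots> = pi" using pq(1) by (simp add: t_def)
    finally show ?thesis by simp
  qed
  then have "integral\<^sup>L H ?f = - integral\<^sup>L H ?f"
    using integral_invariant[OF V, of ?f] bmf by (simp add: bounded_fun_def)
  then show ?thesis by simp
qed

text \<open>In the coordinates 0 and \<open>l\<close>, the unit vector (1, x) / sqrt(1 + x^2) is the
  first row of a rotation, so \<open>U 0 0 + x U l 0\<close> is sqrt(1 + x^2) times an entry
  distributed like \<open>U 0 0\<close>.\<close>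

lemma rotation_identity:
  assumes l: "l < D" "l \<noteq> 0"
  shows "(\<integral>U. ((U 0 0 + of_real x * U l 0) * cnj (U 0 0 + of_real x * U l 0)) ^ k \<partial>H)
    = (1 + of_real x ^ 2) ^ k * moment k"
proof -
  define c where "c = 1 / sqrt (1 + x\<^sup>2)"
  have c2: "c * c * (1 + x\<^sup>2) = 1"
    by (simp add: c_def power2_eq_square[symmetric] add_nonneg_eq_0_iff power_divide)
  let ?V = "rot D 0 l (of_real c) (of_real (c * x))"
  have "c * c + (c * x) * (c * x) = 1" using c2 by (simp add: power2_eq_square algebra_simps)
  then have V: "?V \<in> SU D"
    using D_pos l by (intro rot_in_SU) (auto simp flip: of_real_mult of_real_add)
  let ?I = "\<integral>U. ((U 0 0 + of_real x * U l 0) * cnj (U 0 0 + of_real x * U l 0)) ^ k \<partial>H"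
  let ?f = "\<lambda>U :: nat \<Rightarrow> nat \<Rightarrow> complex. (U 0 0 * cnj (U 0 0)) ^ k"
  have "bounded_fun ?f" by (intro bounded_fun_intros)
  then have "moment k = (\<integral>U. ?f (mmult {..<D} ?V U) \<partial>H)"
    using integral_invariant[OF V, of ?f] by (simp add: moment_def bounded_fun_def)
  also have "\<dots> = (\<integral>U. of_real (c * c) ^ k * ((U 0 0 + of_real x * U l 0) * cnj (U 0 0 + of_real x * U l 0)) ^ k \<partial>H)"
  proof (intro Bochner_Integration.integral_cong refl)
    fix U :: "nat \<Rightarrow> nat \<Rightarrow> complex"
    have "mmult {..<D} ?V U 0 0 = of_real c * (U 0 0 + of_real x * U l 0)"
      using D_pos l by (simp add: mmult_rot algebra_simps)
    then show "?f (mmult {..<D} ?V U) = of_real (c * c) ^ k * ((U 0 0 + of_real x * U l 0) * cnj (U 0 0 + of_real x * U l 0)) ^ k"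
      by (simp only: power_mult_distrib[symmetric]) (simp add: mult_ac)
  qed
  also have "\<dots> = of_real (c * c) ^ k * ?I" by simp
  finally have "(1 + of_real x ^ 2) ^ k * moment k = of_real (c * c * (1 + x\<^sup>2)) ^ k * ?I"
    by (simp add: power_mult_distrib mult_ac)
  then show ?thesis unfolding c2 by simp
qed

text \<open>The rotation identity holds for every real \<open>x\<close>. Phases kill the terms with
  unequal powers, which leaves an identity of polynomials in x^2; its linear coefficients read
  \<open>(k + 1)^2 m 1 = (k + 1) moment (k + 1)\<close>.\<close>

lemma mixed_moment:
  assumes l: "l < D" "l \<noteq> 0"
  shows "of_nat (Suc k) * (\<integral>U. (U 0 0 * cnj (U 0 0)) ^ k * (U l 0 * cnj (U l 0)) \<partial>H) = moment (Suc k)"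
proof -
  let ?K = "Suc k"
  define T where "T = (\<lambda>i j (U :: nat \<Rightarrow> nat \<Rightarrow> complex).
      U 0 0 ^ (?K - i) * cnj (U 0 0) ^ (?K - j) * U l 0 ^ i * cnj (U l 0) ^ j)"
  define m where "m i = integral\<^sup>L H (T i i)" for i
  have bmT: "bounded_fun (T i j)" for i j unfolding T_def by (intro bounded_fun_intros)
  have T0: "integral\<^sup>L H (T i j) = (if i = j then m i else 0)" if "i \<le> ?K" "j \<le> ?K" for i j
    unfolding m_def using that phase_vanish[OF l, of "?K - i" "?K - j" i j] by (auto simp: T_def)
  \<comment> \<open>Coefficients of the difference of both sides, as a polynomial in
    \<open>y = x^2\<close>.\<close>
  define cf where "cf i = of_nat (?K choose i) ^ 2 * m i - of_nat (?K choose i) * moment ?K" for i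
  have root: "(\<Sum>i\<le>?K. cf i * (of_real y) ^ i) = 0" if "y \<ge> 0" for y :: real
  proof -
    define x where "x = sqrt y"
    have y: "of_real x ^ 2 = (of_real y :: complex)"
      using that by (simp add: x_def flip: of_real_power)
    have xx: "of_real x ^ (i + i) = (of_real y ^ i :: complex)" for i
      unfolding y[symmetric] power_mult[symmetric] mult_2[symmetric] ..
    have "(1 + of_real x ^ 2) ^ ?K * moment ?K
        = (\<integral>U. ((U 0 0 + of_real x * U l 0) * cnj (U 0 0 + of_real x * U l 0)) ^ ?K \<partial>H)"
      by (rule rotation_identity[OF l, symmetric])
    also have "\<dots> = (\<integral>U. (\<Sum>i\<le>?K. \<Sum>j\<le>?K. (of_nat (?K choose i) * of_nat (?K choose j) * of_real x ^ (i + j)) * T i j U) \<partial>H)"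
    proof (intro Bochner_Integration.integral_cong refl)
      fix U :: "nat \<Rightarrow> nat \<Rightarrow> complex"
      have "((U 0 0 + of_real x * U l 0) * cnj (U 0 0 + of_real x * U l 0)) ^ ?K
          = (of_real x * U l 0 + U 0 0) ^ ?K * (of_real x * cnj (U l 0) + cnj (U 0 0)) ^ ?K"
        by (simp only: power_mult_distrib) (simp add: add.commute)
      also have "\<dots> = (\<Sum>i\<le>?K. of_nat (?K choose i) * (of_real x * U l 0) ^ i * U 0 0 ^ (?K - i))
          * (\<Sum>j\<le>?K. of_nat (?K choose j) * (of_real x * cnj (U l 0)) ^ j * cnj (U 0 0) ^ (?K - j))"
        by (simp only: binomial_ring)
      also have "\<dots> = (\<Sum>i\<le>?K. \<Sum>j\<le>?K. (of_nat (?K choose i) * of_nat (?K choose j) * of_real x ^ (i + j)) * T i j U)"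
        unfolding sum_product T_def by (intro sum.cong refl) (simp add: power_mult_distrib power_add mult_ac)
      finally show "((U 0 0 + of_real x * U l 0) * cnj (U 0 0 + of_real x * U l 0)) ^ ?K
        = (\<Sum>i\<le>?K. \<Sum>j\<le>?K. (of_nat (?K choose i) * of_nat (?K choose j) * of_real x ^ (i + j)) * T i j U)" .
    qed
    also have "\<dots> = (\<Sum>i\<le>?K. \<Sum>j\<le>?K. (of_nat (?K choose i) * of_nat (?K choose j) * of_real x ^ (i + j)) * integral\<^sup>L H (T i j))"
      by (subst Bochner_Integration.integral_sum, intro bounded_fun_integrable bounded_fun_sum bounded_fun_mult bounded_fun_const bmT)+ simp
    also have "\<dots> = (\<Sum>i\<le>?K. \<Sum>j\<le>?K. if j = i then of_nat (?K choose i) ^ 2 * of_real y ^ i * m i else 0)"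
      by (intro sum.cong refl) (auto simp: T0 power2_eq_square xx)
    also have "\<dots> = (\<Sum>i\<le>?K. of_nat (?K choose i) ^ 2 * of_real y ^ i * m i)"
      by (intro sum.cong refl) simp
    finally have "(of_real y + 1) ^ ?K * moment ?K = (\<Sum>i\<le>?K. of_nat (?K choose i) ^ 2 * of_real y ^ i * m i)"
      unfolding y by (simp add: add.commute)
    then have "(\<Sum>i\<le>?K. of_nat (?K choose i) ^ 2 * of_real y ^ i * m i)
        = (\<Sum>i\<le>?K. of_nat (?K choose i) * of_real y ^ i * moment ?K)"
      unfolding binomial_ring by (simp only: sum_distrib_right power_one mult_1_right)
    then show ?thesis
      unfolding cf_def by (simp add: algebra_simps sum_subtractf del: sum.atMost_Suc)
  qed
  have "cf 1 = 0"
  proof (rule ccontr)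
    assume "cf 1 \<noteq> 0"
    then have "finite {z. (\<Sum>i\<le>?K. cf i * z ^ i) = 0}"
      by (intro iffD2[OF polyfun_finite_roots] exI[of _ 1]) simp
    moreover have "of_real ` {0::real..} \<subseteq> {z. (\<Sum>i\<le>?K. cf i * z ^ i) = 0}"
      using root by auto
    ultimately have "finite (complex_of_real ` {0..})"
      by (rule rev_finite_subset)
    then have "finite {0::real..}"
      by (rule finite_imageD) (simp add: inj_on_def)
    then show False by (simp add: infinite_Ici)
  qed
  then have "of_nat ?K * (of_nat ?K * m 1 - moment ?K) = 0"
    by (simp add: cf_def power2_eq_square algebra_simps)
  then have "of_nat ?K * m 1 = moment ?K"
    by (metis eq_iff_diff_eq_0 mult_eq_0_iff of_nat_eq_0_iff nat.distinct(1))
  moreover have "m 1 = (\<integral>U. (U 0 0 * cnj (U 0 0)) ^ k * (U l 0 * cnj (U l 0)) \<partial>H)"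
    unfolding m_def T_def by (simp add: power_mult_distrib mult_ac)
  ultimately show ?thesis by simp
qed

text \<open>Insert the squared length of the column, which is 1. The term \<open>l = 0\<close> gives
  \<open>moment (k + 1)\<close>, and each of the other \<open>D - 1\<close> terms gives 1/(k + 1) of
  it.\<close>

lemma moment_rec: "of_nat (Suc k) * moment k = of_nat (D + k) * moment (Suc k)"
proof -
  have "moment k = (\<integral>U. (\<Sum>l<D. (U 0 0 * cnj (U 0 0)) ^ k * (U l 0 * cnj (U l 0))) \<partial>H)"
    unfolding moment_def
  proof (rule integral_cong_AE)
    show "AE U in H. (U 0 0 * cnj (U 0 0)) ^ k = (\<Sum>l<D. (U 0 0 * cnj (U 0 0)) ^ k * (U l 0 * cnj (U l 0)))"
      using AE_SU
    proof eventually_elim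
      case (elim U)
      then have "(\<Sum>l<D. U l 0 * cnj (U l 0)) = 1"
        using unitary_col_sum[of D U 0] D_pos by (simp add: SU_iff mult.commute)
      then show ?case by (simp flip: sum_distrib_left)
    qed
    have "bounded_fun (\<lambda>U. (U 0 0 * cnj (U 0 0)) ^ k)" "bounded_fun (\<lambda>U. \<Sum>l<D. (U 0 0 * cnj (U 0 0)) ^ k * (U l 0 * cnj (U l 0)))"
      by (intro bounded_fun_intros)+
    then show "(\<lambda>U. (U 0 0 * cnj (U 0 0)) ^ k) \<in> borel_measurable H"
      "(\<lambda>U. \<Sum>l<D. (U 0 0 * cnj (U 0 0)) ^ k * (U l 0 * cnj (U l 0))) \<in> borel_measurable H"
      by (simp_all add: bounded_fun_def)
  qed
  also have "\<dots> = (\<Sum>l<D. \<integral>U. (U 0 0 * cnj (U 0 0)) ^ k * (U l 0 * cnj (U l 0)) \<partial>H)"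
    by (intro Bochner_Integration.integral_sum bounded_fun_integrable bounded_fun_intros)
  finally have "of_nat (Suc k) * moment k = (\<Sum>l<D. of_nat (Suc k) * (\<integral>U. (U 0 0 * cnj (U 0 0)) ^ k * (U l 0 * cnj (U l 0)) \<partial>H))"
    by (simp add: sum_distrib_left)
  also have "\<dots> = (\<Sum>l<D. if l = 0 then of_nat (Suc k) * moment (Suc k) else moment (Suc k))"
  proof (intro sum.cong refl)
    fix l assume "l \<in> {..<D}"
    then show "of_nat (Suc k) * (\<integral>U. (U 0 0 * cnj (U 0 0)) ^ k * (U l 0 * cnj (U l 0)) \<partial>H)
        = (if l = 0 then of_nat (Suc k) * moment (Suc k) else moment (Suc k))"
      using mixed_moment[of l k] by (auto simp: moment_def mult.commute)
  qed
  also have "\<dots> = of_nat (Suc k) * moment (Suc k) + (\<Sum>l\<in>{..<D} - {0}. moment (Suc k))"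
    using D_pos by (subst sum.remove[of "{..<D}" 0]) (auto intro!: sum.cong)
  also have "\<dots> = of_nat (D + k) * moment (Suc k)"
    using D_pos by (simp add: of_nat_diff algebra_simps)
  finally show ?thesis .
qed

text \<open>For \<open>D = 2^n\<close> the binomial is \<open>dsym n k\<close>, so this moment is
  exactly what the normalisation of \<open>Phi\<close> cancels.\<close>

lemma moment_eq: "of_nat ((D + k - 1) choose k) * moment k = 1"
proof (induction k)
  case 0
  then show ?case by (simp add: moment_0)
next
  case (Suc k)
  have "Suc k * ((D + k) choose Suc k) = (D + k) * ((D + k - 1) choose k)"
    using Suc_times_binomial[of k "D + k - 1"] D_pos by simp
  then have "of_nat (Suc k) * (of_nat ((D + k) choose Suc k) * moment (Suc k))
      = of_nat ((D + k - 1) choose k) * (of_nat (D + k) * moment (Suc k))"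
    by (metis (no_types, lifting) mult.assoc mult.commute of_nat_mult)
  also have "\<dots> = of_nat (Suc k)"
    unfolding moment_rec[symmetric] using Suc by (simp add: mult_ac)
  finally have "of_nat ((D + k) choose Suc k) * moment (Suc k) = 1"
    by (metis mult_cancel_left1 of_nat_eq_0_iff nat.distinct(1) mult.right_neutral)
  then show ?case by simp
qed

end

section \<open>The reduced state\<close>

text \<open>Used for the partial trace: each traced-out pair contributes the same factor, so the sum
  over lists is a power.\<close>

lemma sum_lists_pairs:
  fixes h :: "nat \<Rightarrow> nat \<Rightarrow> complex"
  shows "(\<Sum>ys\<in>{ys. length ys = 2 * k \<and> set ys \<subseteq> {..<D}}. \<Prod>i<k. h (ys ! (2 * i)) (ys ! (2 * i + 1)))
    = (\<Sum>x<D. \<Sum>y<D. h x y) ^ k"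
proof (induction k)
  case 0
  have "{ys. ys = [] \<and> set ys \<subseteq> {..<D}} = {[]}" by auto
  then show ?case by simp
next
  case (Suc k)
  let ?S = "\<lambda>k. {ys. length ys = 2 * k \<and> set ys \<subseteq> {..<D}}"
  let ?P = "\<lambda>k ys. \<Prod>i<k. h (ys ! (2 * i)) (ys ! (2 * i + 1))"
  have "bij_betw (\<lambda>(x, y, ys). x # y # ys) ({..<D} \<times> {..<D} \<times> ?S k) (?S (Suc k))"
    unfolding bij_betw_def
  proof
    show "inj_on (\<lambda>(x, y, ys). x # y # ys) ({..<D} \<times> {..<D} \<times> ?S k)"
      by (auto simp: inj_on_def)
    show "(\<lambda>(x, y, ys). x # y # ys) ` ({..<D} \<times> {..<D} \<times> ?S k) = ?S (Suc k)"
    proof (intro equalityI subsetI)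
      fix zs assume zs: "zs \<in> ?S (Suc k)"
      then obtain x y ys where "zs = x # y # ys"
        by (cases zs; cases "tl zs") auto
      with zs show "zs \<in> (\<lambda>(x, y, ys). x # y # ys) ` ({..<D} \<times> {..<D} \<times> ?S k)"
        by (auto intro!: image_eqI[of _ _ "(x, y, ys)"])
    qed auto
  qed
  then have "(\<Sum>zs\<in>?S (Suc k). ?P (Suc k) zs)
      = (\<Sum>t\<in>{..<D} \<times> {..<D} \<times> ?S k. ?P (Suc k) (case t of (x, y, ys) \<Rightarrow> x # y # ys))"
    by (intro sum.reindex_bij_betw[symmetric])
  also have "\<dots> = (\<Sum>t\<in>{..<D} \<times> {..<D} \<times> ?S k. case t of (x, y, ys) \<Rightarrow> h x y * ?P k ys)"
    by (intro sum.cong refl) (auto simp: prod.lessThan_Suc_shift simp del: prod.lessThan_Suc)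
  also have "\<dots> = (\<Sum>x<D. \<Sum>y<D. \<Sum>ys\<in>?S k. h x y * ?P k ys)"
    by (simp add: sum.cartesian_product)
  also have "\<dots> = (\<Sum>x<D. \<Sum>y<D. h x y) * (\<Sum>ys\<in>?S k. ?P k ys)"
    by (simp only: sum_distrib_left[symmetric] sum_distrib_right[symmetric])
  finally show ?case using Suc.IH by simp
qed

text \<open>Two transpositions suffice: one carries \<open>a\<close> to \<open>c\<close>, the next
  carries the image of \<open>b\<close> to \<open>d\<close> and fixes \<open>c\<close>.\<close>

lemma offdiag_constant:
  assumes inv: "\<And>j l a b. j < D \<Longrightarrow> l < D \<Longrightarrow> j \<noteq> l \<Longrightarrow> a < D \<Longrightarrow> b < D \<Longrightarrow>
      f a b = f (Transposition.transpose j l a) (Transposition.transpose j l b)"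
    and ab: "a < D" "b < D" "a \<noteq> b" and cd: "c < D" "d < D" "c \<noteq> d"
  shows "f a b = f c d"
proof -
  \<comment> \<open>The hypothesis offers only transpositions of distinct indices, so
    \<open>a = c\<close> is kept apart.\<close>
  define b1 where "b1 = (if a = c then b else Transposition.transpose a c b)"
  have b1: "b1 < D" "b1 \<noteq> c"
    using ab cd by (auto simp: b1_def Transposition.transpose_def)
  have "f a b = f c b1"
    using inv[of a c a b] ab cd by (auto simp: b1_def)
  also have "\<dots> = f c d"
  proof (cases "b1 = d")
    case False
    then have "f c b1 = f (Transposition.transpose b1 d c) (Transposition.transpose b1 d b1)"
      using inv[of b1 d c b1] b1 cd by auto
    then show ?thesis using b1 cd by (simp add: Transposition.transpose_def)
  qed simp
  finally show ?thesis .
qed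

context haar_space
begin

section \<open>Correlations of two independent columns\<close>

definition overlap :: "(nat \<Rightarrow> nat \<Rightarrow> complex) \<times> (nat \<Rightarrow> nat \<Rightarrow> complex) \<Rightarrow> complex" where
  "overlap p = (\<Sum>x<D. cnj (fst p x 0) * snd p x 0)"

definition overlap2 :: "(nat \<Rightarrow> nat \<Rightarrow> complex) \<times> (nat \<Rightarrow> nat \<Rightarrow> complex) \<Rightarrow> complex" where
  "overlap2 p = overlap p * cnj (overlap p)"

text \<open>Column 0 of \<open>snd p\<close> comes from an amplitude of \<open>Phi\<close>, column 0
  of \<open>fst p\<close> from a conjugated one. The exponent counts the traced-out pairs, one less
  than the number of pairs in \<open>Phi\<close>.\<close>

definition corr_fun :: "nat \<Rightarrow> nat \<Rightarrow> nat \<Rightarrow> nat \<Rightarrow> nat \<Rightarrow> (nat \<Rightarrow> nat \<Rightarrow> complex) \<times> (nat \<Rightarrow> nat \<Rightarrow> complex) \<Rightarrow> complex" where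
  "corr_fun k a b a' b' p = snd p a 0 * cnj (snd p b 0) * cnj (fst p a' 0) * fst p b' 0 * overlap2 p ^ k"

definition corr :: "nat \<Rightarrow> nat \<Rightarrow> nat \<Rightarrow> nat \<Rightarrow> nat \<Rightarrow> complex" where
  "corr k a b a' b' = (\<integral>p. corr_fun k a b a' b' p \<partial>H2)"

lemma bounded_fun2_overlap2: "bounded_fun2 overlap2"
  unfolding overlap2_def[abs_def] overlap_def by (intro bounded_fun2_intros)

lemma bounded_fun2_corr_fun: "bounded_fun2 (corr_fun k a b a' b')"
  unfolding corr_fun_def[abs_def] by (intro bounded_fun2_intros bounded_fun2_overlap2)

lemma overlap_ip: "overlap p = ip {..<D} (\<lambda>x. fst p x 0) (\<lambda>x. snd p x 0)"
  by (simp add: overlap_def ip_def)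

lemma overlap2_invariant:
  assumes "V \<in> SU D"
  shows "overlap2 (mmult {..<D} V W, mmult {..<D} V U) = overlap2 (W, U)"
  using assms by (simp add: overlap2_def overlap_ip mmult_eq_mat_vec SU_iff ip_unitary)

text \<open>For fixed \<open>W\<close> in \<open>SU D\<close> the overlap is the entry (0, 0) of
  \<open>madj W U\<close>, so invariance makes the inner integral independent of
  \<open>W\<close>.\<close>

lemma overlap2_moment: "(\<integral>p. overlap2 p ^ k \<partial>H2) = moment k"
proof -
  have b: "bounded_fun2 (\<lambda>p. overlap2 p ^ k)" by (intro bounded_fun2_power bounded_fun2_overlap2)
  have b1: "bounded_fun (\<lambda>U. (U 0 0 * cnj (U 0 0)) ^ k)" by (intro bounded_fun_intros)
  have "(\<integral>p. overlap2 p ^ k \<partial>H2) = (\<integral>W. (\<integral>U. overlap2 (W, U) ^ k \<partial>H) \<partial>H)"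
    by (rule bounded_fun2_fubini[OF b])
  also have "\<dots> = (\<integral>W. moment k \<partial>H)"
  proof (rule integral_cong_AE)
    show "AE W in H. (\<integral>U. overlap2 (W, U) ^ k \<partial>H) = moment k"
      using AE_SU
    proof eventually_elim
      case (elim W)
      have "overlap2 (W, U) = mmult {..<D} (madj W) U 0 0 * cnj (mmult {..<D} (madj W) U 0 0)" for U
        by (simp add: overlap2_def overlap_def mmult_def madj_def)
      then have "(\<integral>U. overlap2 (W, U) ^ k \<partial>H)
          = (\<integral>U. (mmult {..<D} (madj W) U 0 0 * cnj (mmult {..<D} (madj W) U 0 0)) ^ k \<partial>H)"
        by simp
      also have "\<dots> = moment k"
        unfolding moment_def using b1 by (intro integral_invariant SU_madj elim) (simp add: bounded_fun_def)
      finally show ?case .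
    qed
    show "(\<lambda>W. \<integral>U. overlap2 (W, U) ^ k \<partial>H) \<in> borel_measurable H"
      using b by (intro H.borel_measurable_lebesgue_integral) (simp add: bounded_fun2_def case_prod_beta')
  qed simp
  also have "\<dots> = moment k" by (simp add: H.prob_space)
  finally show ?thesis .
qed

text \<open>Treats phases and signed swaps together: \<open>V\<close> acts on column 0 as a
  relabelling \<open>t\<close> with factors \<open>c\<close>, while the overlap of the two columns
  does not change.\<close>

lemma corr_monomial:
  assumes V: "V \<in> SU D" and act: "\<And>U i. i < D \<Longrightarrow> mmult {..<D} V U i 0 = c i * U (t i) 0"
    and lt: "a < D" "b < D" "a' < D" "b' < D"
  shows "corr k a b a' b' = c a * cnj (c b) * cnj (c a') * c b' * corr k (t a) (t b) (t a') (t b')"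
proof -
  let ?c = "c a * cnj (c b) * cnj (c a') * c b'"
  have eq: "corr_fun k a b a' b' (mmult {..<D} V (fst p), mmult {..<D} V (snd p))
      = ?c * corr_fun k (t a) (t b) (t a') (t b') p" for p
    using lt overlap2_invariant[OF V, of "fst p" "snd p"] by (simp add: corr_fun_def act mult_ac)
  have "bounded_fun2 (\<lambda>p. ?c * corr_fun k (t a) (t b) (t a') (t b') p)"
    by (intro bounded_fun2_mult bounded_fun2_const bounded_fun2_corr_fun)
  then have "corr k a b a' b' = (\<integral>p. ?c * corr_fun k (t a) (t b) (t a') (t b') p \<partial>H2)"
    using integral2_invariant[OF V bounded_fun2_corr_fun[of k a b a' b']] unfolding eq by (simp add: corr_def)
  then show ?thesis by (simp add: corr_def)
qed

lemma corr_phase: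
  fixes z :: complex
  assumes jl: "j < D" "l < D" "j \<noteq> l" and z: "cnj z * z = 1"
    and lt: "a < D" "b < D" "a' < D" "b' < D"
  defines "ph \<equiv> \<lambda>i. if i = j then z else if i = l then cnj z else 1"
  assumes ne: "ph a * cnj (ph b) * cnj (ph a') * ph b' \<noteq> 1"
  shows "corr k a b a' b' = 0"
proof -
  have V: "rot D j l z 0 \<in> SU D" using jl z by (intro rot_in_SU) auto
  have "corr k a b a' b' = ph a * cnj (ph b) * cnj (ph a') * ph b' * corr k a b a' b'"
    using lt jl by (intro corr_monomial[OF V, where t = "\<lambda>i. i"]) (simp_all add: mmult_rot ph_def)
  then show ?thesis using ne by (metis mult_cancel_right1)
qed

text \<open>If the indices do not pair up, some phase does not cancel. Determinant 1 forces the
  conjugate phase on a second coordinate; the three cases choose both coordinates so that the total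
  factor is a power of \<open>z\<close> with exponent between 1 and 4.\<close>

lemma corr_eq_0:
  assumes lt: "a < D" "b < D" "a' < D" "b' < D"
    and ne: "\<not> (a = b \<and> a' = b')" "\<not> (a = a' \<and> b = b')"
  shows "corr k a b a' b' = 0"
proof -
  \<comment> \<open>A point of the unit circle, from the 3-4-5 triangle, whose first four powers all
    differ from 1.\<close>
  define z where "z = Complex (3/5) (4/5)"
  have z: "cnj z * z = 1" "z * cnj z = 1" by (simp_all add: z_def complex_eq_iff)
  have zp: "z \<noteq> 1" "z * z \<noteq> 1" "z * z * z \<noteq> 1" "z * z * z * z \<noteq> 1"
    by (simp_all add: z_def complex_eq_iff)
  have zz: "z * z * cnj z = z" using z by (simp add: mult.assoc)
  have zzz: "z * z * z * cnj z = z * z" using z by (simp add: mult.assoc)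
  consider "a \<noteq> b" "a \<noteq> a'" | "a = b" "a' \<noteq> b'" | "a = a'" "a \<noteq> b" "b \<noteq> b'"
    using ne by blast
  then show ?thesis
  proof cases
    case 1
    show ?thesis
      using 1 lt z(1) by (intro corr_phase[of a b z]) (auto simp: zp zz zzz)
  next
    case 2
    then show ?thesis
      using lt z zp by (intro corr_phase[of b' a' z]) (auto simp: zz zzz)
  next
    case 3
    then show ?thesis
      using lt z zp by (intro corr_phase[of b' b z]) (auto simp: zz zzz)
  qed
qed

text \<open>A plain swap has determinant -1, so one sign is flipped. Each index occurs an even
  number of times, and the signs cancel.\<close>

lemma corr_swap:
  assumes jl: "j < D" "l < D" "j \<noteq> l" and lt: "a < D" "b < D"
  defines "\<tau> \<equiv> Transposition.transpose j l"
  shows "corr k a b a b = corr k (\<tau> a) (\<tau> b) (\<tau> a) (\<tau> b)" "corr k a a b b = corr k (\<tau> a) (\<tau> a) (\<tau> b) (\<tau> b)"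
proof -
  let ?c = "\<lambda>i. if i = l then - 1 else 1 :: complex"
  have V: "rot D j l 0 1 \<in> SU D" using jl by (intro rot_in_SU) auto
  have act: "mmult {..<D} (rot D j l 0 1) U i 0 = ?c i * U (\<tau> i) 0" if "i < D" for U i
    using that jl by (simp add: mmult_rot \<tau>_def Transposition.transpose_def)
  show "corr k a b a b = corr k (\<tau> a) (\<tau> b) (\<tau> a) (\<tau> b)" "corr k a a b b = corr k (\<tau> a) (\<tau> a) (\<tau> b) (\<tau> b)"
    using corr_monomial[OF V act, where k = k, of a b a b] corr_monomial[OF V act, where k = k, of a a b b] lt
    by (simp_all split: if_splits)
qed

lemma corr_diag_constant:
  assumes "a < D"
  shows "corr k a a a a = corr k 0 0 0 0"
proof (cases "a = 0")
  case False
  then show ?thesis using corr_swap(1)[of a 0 a a k] assms D_pos by simp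
qed simp

lemma corr_offdiag_constant:
  assumes "a < D" "b < D" "a \<noteq> b" "c < D" "d < D" "c \<noteq> d"
  shows "corr k a b a b = corr k c d c d" "corr k a a b b = corr k c c d d"
  using offdiag_constant[of D "\<lambda>a b. corr k a b a b" a b c d] offdiag_constant[of D "\<lambda>a b. corr k a a b b" a b c d]
    corr_swap assms by blast+

text \<open>The trace rule: summing the four single entries over both indices produces one more
  factor of the squared overlap.\<close>

lemma corr_sum_trace: "(\<Sum>a<D. \<Sum>b<D. corr k a b a b) = moment (Suc k)"
proof -
  have "(\<Sum>a<D. \<Sum>b<D. corr k a b a b) = (\<integral>p. (\<Sum>a<D. \<Sum>b<D. corr_fun k a b a b p) \<partial>H2)"
    unfolding corr_def
    by (subst Bochner_Integration.integral_sum, intro bounded_fun2_integrable bounded_fun2_sum bounded_fun2_corr_fun)+ simp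
  also have "\<dots> = (\<integral>p. overlap2 p ^ Suc k \<partial>H2)"
  proof (intro Bochner_Integration.integral_cong refl)
    fix p :: "(nat \<Rightarrow> nat \<Rightarrow> complex) \<times> (nat \<Rightarrow> nat \<Rightarrow> complex)"
    have "overlap2 p = (\<Sum>a<D. \<Sum>b<D. snd p a 0 * cnj (snd p b 0) * cnj (fst p a 0) * fst p b 0)"
      unfolding overlap2_def overlap_def cnj_sum sum_product by (intro sum.cong refl) (simp add: mult_ac)
    then show "(\<Sum>a<D. \<Sum>b<D. corr_fun k a b a b p) = overlap2 p ^ Suc k"
      by (simp add: corr_fun_def sum_distrib_right)
  qed
  finally show ?thesis by (simp only: overlap2_moment)
qed

text \<open>The rule for the maximally entangled vector: here the two sums are squared lengths of
  columns, equal to 1 on \<open>SU D\<close>, so the power of the overlap stays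
  \<open>k\<close>.\<close>

lemma corr_sum_fidelity: "(\<Sum>a<D. \<Sum>b<D. corr k a a b b) = moment k"
proof -
  have "(\<Sum>a<D. \<Sum>b<D. corr k a a b b) = (\<integral>p. (\<Sum>a<D. \<Sum>b<D. corr_fun k a a b b p) \<partial>H2)"
    unfolding corr_def
    by (subst Bochner_Integration.integral_sum, intro bounded_fun2_integrable bounded_fun2_sum bounded_fun2_corr_fun)+ simp
  also have "\<dots> = (\<integral>p. overlap2 p ^ k \<partial>H2)"
  proof (rule integral_cong_AE)
    show "AE p in H2. (\<Sum>a<D. \<Sum>b<D. corr_fun k a a b b p) = overlap2 p ^ k"
      using AE2_SU
    proof eventually_elim
      case (elim p)
      have "(\<Sum>a<D. \<Sum>b<D. corr_fun k a a b b p)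
          = (\<Sum>a<D. cnj (snd p a 0) * snd p a 0) * (\<Sum>b<D. cnj (fst p b 0) * fst p b 0) * overlap2 p ^ k"
        unfolding corr_fun_def sum_product unfolding sum_distrib_right by (intro sum.cong refl) (simp add: mult_ac)
      then show ?case
        using elim D_pos by (simp add: unitary_col_sum SU_iff)
    qed
    have "bounded_fun2 (\<lambda>p. \<Sum>a<D. \<Sum>b<D. corr_fun k a a b b p)" "bounded_fun2 (\<lambda>p. overlap2 p ^ k)"
      by (intro bounded_fun2_sum bounded_fun2_corr_fun bounded_fun2_power bounded_fun2_overlap2)+
    then show "(\<lambda>p. \<Sum>a<D. \<Sum>b<D. corr_fun k a a b b p) \<in> borel_measurable H2" "(\<lambda>p. overlap2 p ^ k) \<in> borel_measurable H2"
      by (simp_all add: bounded_fun2_def)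
  qed
  finally show ?thesis by (simp only: overlap2_moment)
qed

text \<open>The difference of the two sides is the integral of a squared modulus weighted by a power
  of the overlap. It yields \<open>\<beta> \<le> s\<close>, which makes the weights of the separable
  mixture nonnegative.\<close>

lemma corr_le: "Re (corr k a b a b) + Re (corr k b a b a) \<le> Re (corr k a a a a) + Re (corr k b b b b)"
proof -
  define w where "w p = cmod (snd p a 0 * cnj (fst p a 0) - snd p b 0 * cnj (fst p b 0)) ^ 2 * (cmod (overlap p) ^ 2) ^ k"
    for p :: "(nat \<Rightarrow> nat \<Rightarrow> complex) \<times> (nat \<Rightarrow> nat \<Rightarrow> complex)"
  have w: "complex_of_real (w p) = corr_fun k a a a a p + corr_fun k b b b b p - corr_fun k a b a b p - corr_fun k b a b a p" for p
  proof -
    have pw: "complex_of_real (x ^ k) = complex_of_real x ^ k" for x by simp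
    have "complex_of_real (w p) = (snd p a 0 * cnj (fst p a 0) - snd p b 0 * cnj (fst p b 0))
        * cnj (snd p a 0 * cnj (fst p a 0) - snd p b 0 * cnj (fst p b 0)) * overlap2 p ^ k"
      unfolding w_def overlap2_def of_real_mult pw complex_norm_square ..
    then show ?thesis by (simp add: corr_fun_def algebra_simps)
  qed
  have "complex_of_real (\<integral>p. w p \<partial>H2) = (\<integral>p. complex_of_real (w p) \<partial>H2)"
    by simp
  also have "\<dots> = corr k a a a a + corr k b b b b - corr k a b a b - corr k b a b a"
    unfolding w corr_def by (simp add: bounded_fun2_integrable bounded_fun2_corr_fun)
  finally have "(\<integral>p. w p \<partial>H2) = Re (corr k a a a a + corr k b b b b - corr k a b a b - corr k b a b a)"
    by (metis Re_complex_of_real)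
  moreover have "0 \<le> (\<integral>p. w p \<partial>H2)" by (intro Bochner_Integration.integral_nonneg) (simp add: w_def)
  ultimately show ?thesis by simp
qed

text \<open>An amplitude times a conjugate amplitude is an integral over two independent matrices.
  Pulling the partial trace inside turns the traced-out pairs into the power of the squared
  overlap.\<close>

lemma rho12_eq_corr:
  assumes D: "D = 2 ^ n"
  shows "rho12 n (2 * Suc k) (a, b) (a', b') = of_nat (dsym n (Suc k)) * corr k a b a' b'"
proof -
  let ?S = "{ys. length ys = 2 * k \<and> set ys \<subseteq> {..<D}}"
  define g where "g ys U = (\<Prod>i<k. U (ys ! (2 * i)) 0 * cnj (U (ys ! (2 * i + 1)) 0) :: complex)"
    for ys and U :: "nat \<Rightarrow> nat \<Rightarrow> complex"
  define f where "f a b ys U = U a 0 * cnj (U b 0) * g ys U" for a b ys and U :: "nat \<Rightarrow> nat \<Rightarrow> complex"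
  have bmf: "bounded_fun (f a b ys)" for a b ys
    unfolding f_def[abs_def] g_def by (intro bounded_fun_intros)
  have Phi: "Phi n (2 * Suc k) (a # b # ys) = of_real (sqrt (real (dsym n (Suc k)))) * (\<integral>U. f a b ys U \<partial>H)" for a b ys
    unfolding Phi_def f_def g_def D[symmetric]
    by (simp add: prod.lessThan_Suc_shift del: prod.lessThan_Suc)
  have prod_int: "(\<integral>U. f a b ys U \<partial>H) * cnj (\<integral>U. f a' b' ys U \<partial>H)
      = (\<integral>p. cnj (f a' b' ys (fst p)) * f a b ys (snd p) \<partial>H2)" for ys
  proof -
    have "bounded_fun2 (\<lambda>p. cnj (f a' b' ys (fst p)) * f a b ys (snd p))"
      by (intro bounded_fun2_mult bounded_fun2_cnj bounded_fun2_fst[OF bmf] bounded_fun2_snd[OF bmf])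
    then have "(\<integral>p. cnj (f a' b' ys (fst p)) * f a b ys (snd p) \<partial>H2)
        = (\<integral>W. (\<integral>U. cnj (f a' b' ys W) * f a b ys U \<partial>H) \<partial>H)"
      using bounded_fun2_fubini by fastforce
    then show ?thesis by (simp add: mult.commute)
  qed
  have "rho12 n (2 * Suc k) (a, b) (a', b')
      = (\<Sum>ys\<in>?S. of_nat (dsym n (Suc k)) * (\<integral>p. cnj (f a' b' ys (fst p)) * f a b ys (snd p) \<partial>H2))"
  proof -
    have "of_real (sqrt (real d)) * I * cnj (of_real (sqrt (real d)) * J) = of_nat d * (I * cnj J)" for d and I J :: complex
    proof -
      have "of_real (sqrt (real d)) * of_real (sqrt (real d)) = (of_nat d :: complex)"
        by (metis of_nat_0_le_iff of_real_mult of_real_of_nat_eq real_sqrt_mult_self abs_of_nonneg)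
      then show ?thesis by (simp add: mult_ac)
    qed
    then have "Phi n (2 * Suc k) (a # b # ys) * cnj (Phi n (2 * Suc k) (a' # b' # ys))
        = of_nat (dsym n (Suc k)) * (\<integral>p. cnj (f a' b' ys (fst p)) * f a b ys (snd p) \<partial>H2)" for ys
      unfolding Phi prod_int[symmetric] .
    then show ?thesis unfolding rho12_def D[symmetric] by simp
  qed
  also have "\<dots> = of_nat (dsym n (Suc k)) * (\<Sum>ys\<in>?S. (\<integral>p. cnj (f a' b' ys (fst p)) * f a b ys (snd p) \<partial>H2))"
    by (simp add: sum_distrib_left)
  also have "(\<Sum>ys\<in>?S. (\<integral>p. cnj (f a' b' ys (fst p)) * f a b ys (snd p) \<partial>H2))
      = (\<integral>p. (\<Sum>ys\<in>?S. cnj (f a' b' ys (fst p)) * f a b ys (snd p)) \<partial>H2)"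
    by (intro Bochner_Integration.integral_sum[symmetric] bounded_fun2_integrable bounded_fun2_mult bounded_fun2_cnj bounded_fun2_fst[OF bmf] bounded_fun2_snd[OF bmf])
  also have "\<dots> = corr k a b a' b'"
    unfolding corr_def
  proof (intro Bochner_Integration.integral_cong refl)
    fix p :: "(nat \<Rightarrow> nat \<Rightarrow> complex) \<times> (nat \<Rightarrow> nat \<Rightarrow> complex)"
    let ?h = "\<lambda>x y. cnj (fst p x 0) * fst p y 0 * (snd p x 0 * cnj (snd p y 0))"
    let ?c = "snd p a 0 * cnj (snd p b 0) * cnj (fst p a' 0) * fst p b' 0"
    have "(\<Sum>ys\<in>?S. cnj (f a' b' ys (fst p)) * f a b ys (snd p))
        = ?c * (\<Sum>ys\<in>?S. \<Prod>i<k. ?h (ys ! (2 * i)) (ys ! (2 * i + 1)))"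
      unfolding sum_distrib_left
    proof (intro sum.cong refl)
      fix ys
      have "(\<Prod>i<k. ?h (ys ! (2 * i)) (ys ! (2 * i + 1))) = cnj (g ys (fst p)) * g ys (snd p)"
        by (simp add: g_def prod.distrib)
      then show "cnj (f a' b' ys (fst p)) * f a b ys (snd p) = ?c * (\<Prod>i<k. ?h (ys ! (2 * i)) (ys ! (2 * i + 1)))"
        by (simp add: f_def mult_ac)
    qed
    also have "\<dots> = ?c * (\<Sum>x<D. \<Sum>y<D. ?h x y) ^ k"
      using sum_lists_pairs[where h = ?h and k = k and D = D] by simp
    also have "(\<Sum>x<D. \<Sum>y<D. ?h x y) = overlap2 p"
      unfolding overlap2_def overlap_def cnj_sum sum_product by (intro sum.cong refl) (simp add: mult_ac)
    finally show "(\<Sum>ys\<in>?S. cnj (f a' b' ys (fst p)) * f a b ys (snd p)) = corr_fun k a b a' b' p"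
      by (simp add: corr_fun_def)
  qed
  finally show ?thesis .
qed

end

section \<open>A nearby separable state\<close>

lemma double_sum_diag:
  fixes x y :: "'a :: comm_ring_1"
  shows "(\<Sum>a<D. \<Sum>b<D. if a = b then x else y) = of_nat D * x + of_nat D * (of_nat D - 1) * y"
proof -
  have "(\<Sum>b<D. if a = b then x else y) = x + (of_nat D - 1) * y" if "a < D" for a
  proof -
    have "(\<Sum>b<D. if a = b then x else y) = (\<Sum>b<D. y + (if b = a then x - y else 0))"
      by (intro sum.cong) auto
    also have "\<dots> = of_nat D * y + (x - y)"
      using that by (simp add: sum.distrib)
    finally show ?thesis by (simp add: algebra_simps)
  qed
  then have "(\<Sum>a<D. \<Sum>b<D. if a = b then x else y) = (\<Sum>a<D. x + (of_nat D - 1) * y)"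
    by (intro sum.cong) auto
  then show ?thesis by (simp add: algebra_simps)
qed

text \<open>Supplies realness and sign of the diagonal entries without evaluating any
  moment.\<close>

lemma rho12_diag_nonneg: "\<exists>r\<ge>0. rho12 n m (a, b) (a, b) = complex_of_real r"
proof (intro exI conjI)
  let ?S = "{ys. length ys = m - 2 \<and> set ys \<subseteq> {..<2 ^ n :: nat}}"
  show "rho12 n m (a, b) (a, b) = complex_of_real (\<Sum>ys\<in>?S. (cmod (Phi n m (a # b # ys)))\<^sup>2)"
    unfolding rho12_def of_real_sum complex_norm_square by simp
qed (intro sum_nonneg zero_le_power2)

lemma rho12_structure:
  fixes n :: nat
  defines "D \<equiv> 2 ^ n"
  obtains s \<beta> :: real where "0 \<le> \<beta>" "\<beta> \<le> s" "real D * s + real D * (real D - 1) * \<beta> = 1"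
    "\<And>a b a' b'. a < D \<Longrightarrow> b < D \<Longrightarrow> a' < D \<Longrightarrow> b' < D \<Longrightarrow>
      rho12 n (2 * Suc n) (a, b) (a', b') = complex_of_real
        (if a = b \<and> a' = b' then (if a = a' then s else \<beta> + 1 / (real (Suc n) * real D))
         else if a = a' \<and> b = b' then \<beta> else 0)"
proof -
  interpret haar_space D by unfold_locales (simp add: D_def)
  let ?d = "of_nat (dsym n (Suc n)) :: complex"
  define q where "q a b a' b' = ?d * corr n a b a' b'" for a b a' b'
  have rq: "rho12 n (2 * Suc n) (a, b) (a', b') = q a b a' b'"
    for a b a' b'
    using rho12_eq_corr[of n n a b a' b'] by (simp add: q_def D_def)
  have real: "q a b a b = of_real (Re (q a b a b)) \<and> 0 \<le> Re (q a b a b)" if "a < D" "b < D" for a b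
    using rho12_diag_nonneg[of n "2 * Suc n" a b] rq[of a b a b] that by auto
  define s where "s = Re (q 0 0 0 0)"
  \<comment> \<open>For \<open>n = 0\<close> there are no distinct indices; the trace rule then
    ignores \<beta>, and 0 satisfies both required inequalities.\<close>
  define \<beta> where "\<beta> = (if D = 1 then 0 else Re (q 0 1 0 1))"
  have ss: "q a a a a = of_real s" if "a < D" for a
    using real[of 0 0] D_pos corr_diag_constant[OF that] by (simp add: s_def q_def)
  have bb: "q a b a b = of_real \<beta>" if "a < D" "b < D" "a \<noteq> b" for a b
  proof -
    have "1 < D" using that by auto
    then show ?thesis
      using real[of 0 1] corr_offdiag_constant(1)[OF that, of 0 1 n] by (simp add: \<beta>_def q_def)
  qed
  have dm: "?d * moment (Suc n) = 1"
    using moment_eq[of "Suc n"] by (simp add: dsym_def D_def)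
  have dm': "of_nat (Suc n) * (?d * moment n) = of_nat (D + n)"
  proof -
    have "of_nat (Suc n) * (?d * moment n) = ?d * (of_nat (Suc n) * moment n)" by (simp only: mult_ac)
    also have "\<dots> = of_nat (D + n) * (?d * moment (Suc n))" unfolding moment_rec by (simp only: mult_ac)
    finally show ?thesis using dm by simp
  qed
  have sum1: "real D * s + real D * (real D - 1) * \<beta> = 1"
  proof -
    have "1 = (\<Sum>a<D. \<Sum>b<D. q a b a b)"
      unfolding q_def sum_distrib_left[symmetric] corr_sum_trace dm ..
    also have "\<dots> = (\<Sum>a<D. \<Sum>b<D. if a = b then of_real s else of_real \<beta>)"
      by (intro sum.cong refl) (auto simp: ss bb)
    also have "\<dots> = of_real (real D * s + real D * (real D - 1) * \<beta>)"
      unfolding double_sum_diag by simp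
    finally show ?thesis by (metis of_real_eq_1_iff)
  qed
  have rr: "q a a b b = of_real (\<beta> + 1 / (real (Suc n) * real D))" if "a < D" "b < D" "a \<noteq> b" for a b
  proof -
    define r where "r = q a a b b"
    have D1: "1 < D" using that by auto
    have "?d * moment n = (\<Sum>a<D. \<Sum>b<D. q a a b b)"
      unfolding q_def sum_distrib_left[symmetric] corr_sum_fidelity ..
    also have "\<dots> = (\<Sum>a<D. \<Sum>b<D. if a = b then of_real s else r)"
    proof (intro sum.cong refl)
      fix c e assume ce: "c \<in> {..<D}" "e \<in> {..<D}"
      show "q c c e e = (if c = e then of_real s else r)"
        using ss ce corr_offdiag_constant(2)[of c e a b n] that by (auto simp: r_def q_def)
    qed
    also have "\<dots> = of_nat D * of_real s + of_nat D * (of_nat D - 1) * r"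
      by (rule double_sum_diag)
    finally have e1: "of_nat (D + n) = of_nat (Suc n) * (of_nat D * of_real s + of_nat D * (of_nat D - 1) * r)"
      using dm' by simp
    have e2: "of_nat D * of_real s + of_nat D * (of_nat D - 1) * of_real \<beta> = (1 :: complex)"
      using arg_cong[OF sum1, of complex_of_real] by simp
    have nz: "of_nat D - 1 \<noteq> (0::complex)" "of_nat D \<noteq> (0::complex)" "of_nat (Suc n) \<noteq> (0::complex)"
      using D1 by (auto simp del: of_nat_Suc)
    \<comment> \<open>The overlap rule minus the trace rule, both multiplied by
      \<open>n + 1\<close>: their right sides \<open>D + n\<close> and \<open>n + 1\<close> differ
      by \<open>D - 1\<close>, the factor that is cancelled afterwards.\<close>
    have "(of_nat D - 1) * (of_nat (Suc n) * of_nat D * (r - of_real \<beta>) - 1)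
        = (of_nat (Suc n) * (of_nat D * of_real s + of_nat D * (of_nat D - 1) * r) - of_nat (D + n))
          - of_nat (Suc n) * (of_nat D * of_real s + of_nat D * (of_nat D - 1) * of_real \<beta> - 1)"
      by (simp add: algebra_simps)
    also have "\<dots> = 0" unfolding e1 e2 by simp
    finally have "(of_nat D - 1) * (of_nat (Suc n) * of_nat D * (r - of_real \<beta>) - 1) = 0" .
    then have "of_nat (Suc n) * of_nat D * (r - of_real \<beta>) = 1"
      using nz(1) by (simp only: mult_eq_0_iff right_minus_eq simp_thms)
    then have "r - of_real \<beta> = 1 / (of_nat (Suc n) * of_nat D)"
      using nz(2,3) by (metis mult_eq_0_iff nonzero_mult_div_cancel_left)
    then have "r = of_real \<beta> + 1 / (of_nat (Suc n) * of_nat D)"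
      by (metis add.commute diff_add_cancel)
    then show ?thesis by (simp add: r_def)
  qed
  have "0 \<le> \<beta>"
    using real[of 0 1] D_pos by (auto simp: \<beta>_def)
  moreover have "\<beta> \<le> s"
  proof (cases "D = 1")
    case True
    then show ?thesis using sum1 by (simp add: \<beta>_def)
  next
    case False
    then have lt: "0 < D" "1 < D" using D_pos by auto
    have Re_q: "Re (q a b a' b') = real (dsym n (Suc n)) * Re (corr n a b a' b')" for a b a' b'
      by (simp add: q_def)
    have "real (dsym n (Suc n)) * (Re (corr n 0 1 0 1) + Re (corr n 1 0 1 0))
        \<le> real (dsym n (Suc n)) * (Re (corr n 0 0 0 0) + Re (corr n 1 1 1 1))"
      by (intro mult_left_mono corr_le) simp
    then have "Re (q 0 1 0 1) + Re (q 1 0 1 0) \<le> Re (q 0 0 0 0) + Re (q 1 1 1 1)"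
      by (simp only: Re_q distrib_left)
    then show ?thesis
      using ss[OF lt(1)] ss[OF lt(2)] bb[OF lt] bb[OF lt(2,1)] by simp
  qed
  moreover have "rho12 n (2 * Suc n) (a, b) (a', b') = complex_of_real
        (if a = b \<and> a' = b' then (if a = a' then s else \<beta> + 1 / (real (Suc n) * real D))
         else if a = a' \<and> b = b' then \<beta> else 0)"
    if lt: "a < D" "b < D" "a' < D" "b' < D" for a b a' b'
  proof -
    have "q a b a' b' = 0" if "\<not> (a = b \<and> a' = b')" "\<not> (a = a' \<and> b = b')"
      using corr_eq_0[OF lt that] by (simp add: q_def)
    then show ?thesis
      unfolding rq using lt by (auto simp: ss bb rr)
  qed
  ultimately show ?thesis using that sum1 by blast
qed

section \<open>The separable mixture\<close>

lemma separable_finite_sumI: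
  fixes A B :: "'x \<Rightarrow> nat \<Rightarrow> nat \<Rightarrow> complex"
  assumes S: "finite S" and p: "\<And>x. x \<in> S \<Longrightarrow> 0 \<le> p x" "(\<Sum>x\<in>S. p x) = 1"
    and AB: "\<And>x. x \<in> S \<Longrightarrow> density_on {..<D} (A x)" "\<And>x. x \<in> S \<Longrightarrow> density_on {..<D} (B x)"
  shows "separable D (\<lambda>u v. \<Sum>x\<in>S. complex_of_real (p x) * mtensor (A x) (B x) u v)"
proof -
  obtain h where h: "bij_betw h {..<card S} S"
    using ex_bij_betw_nat_finite[OF S] by (auto simp: atLeast0LessThan)
  have mem: "h i \<in> S" if "i < card S" for i
    using h that by (auto simp: bij_betw_def)
  show ?thesis
    unfolding separable_def
  proof (intro exI conjI)
    show "\<forall>i<card S. 0 \<le> (p \<circ> h) i \<and> density_on {..<D} ((A \<circ> h) i) \<and> density_on {..<D} ((B \<circ> h) i)"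
      using mem p AB by simp
    show "(\<Sum>i<card S. (p \<circ> h) i) = 1"
      using sum.reindex_bij_betw[OF h, of p] p(2) by simp
    show "(\<lambda>u v. \<Sum>x\<in>S. complex_of_real (p x) * mtensor (A x) (B x) u v)
        = (\<lambda>u v. \<Sum>i<card S. complex_of_real ((p \<circ> h) i) * mtensor ((A \<circ> h) i) ((B \<circ> h) i) u v)"
      by (intro ext) (simp add: sum.reindex_bij_betw[OF h, of "\<lambda>x. complex_of_real (p x) * mtensor (A x) (B x) _ _", symmetric])
  qed
qed

lemma density_rank_one:
  assumes "finite I" "(\<Sum>i\<in>I. v i * cnj (v i)) = 1"
  shows "density_on I (\<lambda>i j. v i * cnj (v j))"
  unfolding density_on_def psd_on_def
proof (intro conjI allI)
  show "hermitian_on I (\<lambda>i j. v i * cnj (v j))"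
    by (simp add: hermitian_on_def mult.commute)
  fix x
  have "(\<Sum>i\<in>I. \<Sum>j\<in>I. cnj (x i) * (v i * cnj (v j)) * x j) = cnj (\<Sum>j\<in>I. cnj (v j) * x j) * (\<Sum>j\<in>I. cnj (v j) * x j)"
    unfolding cnj_sum sum_product by (intro sum.cong refl) (simp add: mult_ac)
  also have "\<dots> = complex_of_real ((cmod (\<Sum>j\<in>I. cnj (v j) * x j))\<^sup>2)"
    by (simp only: complex_norm_square mult.commute)
  finally show "0 \<le> Re (\<Sum>i\<in>I. \<Sum>j\<in>I. cnj (x i) * (v i * cnj (v j)) * x j)"
    by simp
qed (use assms in \<open>simp add: mtrace_def\<close>)

abbreviation phases :: "nat \<Rightarrow> (nat \<Rightarrow> nat) set" where
  "phases D \<equiv> {..<D} \<rightarrow>\<^sub>E {..<4}"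

definition phase_product :: "nat \<Rightarrow> nat \<Rightarrow> nat \<Rightarrow> nat \<Rightarrow> (nat \<Rightarrow> nat) \<Rightarrow> complex" where
  "phase_product a a' b b' f = \<i> ^ f a * cnj (\<i> ^ f a') * cnj (\<i> ^ f b) * \<i> ^ f b'"

text \<open>A quarter turn of the phase at \<open>j\<close> permutes \<open>phases D\<close>, so the
  sum is reproduced with a factor; it vanishes when the factor is not 1.\<close>

lemma phases_shift:
  assumes j: "j < D"
  defines "\<eta> \<equiv> \<lambda>i. if i = j then \<i> else 1"
  shows "(\<Sum>f\<in>phases D. phase_product a a' b b' f) = \<eta> a * cnj (\<eta> a') * cnj (\<eta> b) * \<eta> b' * (\<Sum>f\<in>phases D. phase_product a a' b b' f)"
proof -
  let ?t = "\<lambda>f. f(j := (f j + 1) mod 4)"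
  have t: "?t f \<in> phases D" if "f \<in> phases D" for f
    using that j by (auto simp: PiE_iff extensional_def)
  have inj: "inj_on ?t (phases D)"
  proof (rule inj_onI)
    fix f g assume fg: "f \<in> phases D" "g \<in> phases D" "?t f = ?t g"
    have "f j < 4" "g j < 4" using fg(1,2) j by (auto simp: PiE_iff)
    moreover have "(f j + 1) mod 4 = (g j + 1) mod 4"
      using fun_cong[OF fg(3), of j] by simp
    ultimately have "f j = g j"
      by (simp add: mod_if split: if_splits)
    moreover have "f x = g x" if "x \<noteq> j" for x
      using fun_cong[OF fg(3), of x] that by simp
    ultimately show "f = g" by (metis ext)
  qed
  have "finite (phases D)" by (intro finite_PiE) auto
  then have "bij_betw ?t (phases D) (phases D)"
    using inj t by (intro bij_betw_imageI endo_inj_surj) auto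
  then have "(\<Sum>f\<in>phases D. phase_product a a' b b' f) = (\<Sum>f\<in>phases D. phase_product a a' b b' (?t f))"
    by (rule sum.reindex_bij_betw[symmetric])
  also have "\<dots> = (\<Sum>f\<in>phases D. \<eta> a * cnj (\<eta> a') * cnj (\<eta> b) * \<eta> b' * phase_product a a' b b' f)"
  proof (intro sum.cong refl)
    fix f assume f: "f \<in> phases D"
    have "\<i> ^ (m mod 4) = \<i> ^ m" for m
    proof -
      have "\<i> ^ m = \<i> ^ (4 * (m div 4) + m mod 4)" by simp
      also have "\<dots> = (\<i> ^ 4) ^ (m div 4) * \<i> ^ (m mod 4)"
        by (simp only: power_add power_mult)
      finally show ?thesis by simp
    qed
    then have "\<i> ^ (?t f x) = \<eta> x * \<i> ^ f x" for x
      by (simp add: \<eta>_def)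
    then show "phase_product a a' b b' (?t f) = \<eta> a * cnj (\<eta> a') * cnj (\<eta> b) * \<eta> b' * phase_product a a' b b' f"
      unfolding phase_product_def by (simp only: complex_cnj_mult mult_ac)
  qed
  also have "\<dots> = \<eta> a * cnj (\<eta> a') * cnj (\<eta> b) * \<eta> b' * (\<Sum>f\<in>phases D. phase_product a a' b b' f)"
    by (rule sum_distrib_left[symmetric])
  finally show ?thesis .
qed

text \<open>Unless the indices pair up, a quarter turn at a suitable coordinate has a factor other
  than 1. Signs would not separate the case \<open>a = b'\<close>, \<open>a' = b\<close>,
  \<open>a \<noteq> a'\<close>: there the factor is a square, -1 for \<open>\<i>\<close> but 1 for a
  sign.\<close>

lemma phases_sum:
  assumes lt: "a < D" "a' < D" "b < D" "b' < D"
  shows "(\<Sum>f\<in>phases D. phase_product a a' b b' f)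
    = (if a = a' \<and> b = b' \<or> a = b \<and> a' = b' then of_nat (card (phases D)) else 0)"
proof -
  have ii: "\<i> ^ m * cnj (\<i> ^ m) = 1" "cnj (\<i> ^ m) * \<i> ^ m = 1" for m
    by (simp_all flip: power_mult_distrib)
  have zero: "(\<Sum>f\<in>phases D. phase_product a a' b b' f) = 0"
    if "j < D" "(if a = j then \<i> else 1) * cnj (if a' = j then \<i> else 1) * cnj (if b = j then \<i> else 1)
      * (if b' = j then \<i> else 1) \<noteq> 1" for j
    using phases_shift[OF that(1), of a a' b b'] that(2) by (metis mult_cancel_right1)
  consider "a = a'" "b = b'" | "a = b" "a' = b'" | "a \<noteq> a'" "a \<noteq> b" | "a = a'" "b \<noteq> b'" | "a = b" "a \<noteq> a'" "a' \<noteq> b'"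
    by blast
  then show ?thesis
  proof cases
    case 1
    then have "phase_product a a' b b' f = 1" for f using ii by (simp add: phase_product_def mult.assoc)
    then show ?thesis using 1 by simp
  next
    case 2
    then have "phase_product a a' b b' f = (\<i> ^ f a * cnj (\<i> ^ f a)) * (\<i> ^ f b' * cnj (\<i> ^ f b'))" for f
      by (simp only: phase_product_def mult_ac)
    then show ?thesis using 2 ii by simp
  next
    case 3
    then have "(\<Sum>f\<in>phases D. phase_product a a' b b' f) = 0"
      using lt by (intro zero[of a]) (auto simp: complex_eq_iff)
    with 3 show ?thesis by auto
  next
    case 4
    then have "(\<Sum>f\<in>phases D. phase_product a a' b b' f) = 0"
      using lt by (intro zero[of b]) (auto simp: complex_eq_iff)
    with 4 show ?thesis by auto
  next
    case 5
    then have "(\<Sum>f\<in>phases D. phase_product a a' b b' f) = 0"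
      using lt by (intro zero[of a']) (auto simp: complex_eq_iff)
    with 5 show ?thesis by auto
  qed
qed

text \<open>The uniform average of the phase states has one common value on all three kinds of
  paired entries, so it can supply \<beta> everywhere. The entries at \<open>(aa, aa)\<close> then
  lack \<open>s - \<beta>\<close>, which the basis states add.\<close>

lemma separable_approximant:
  assumes D: "0 < D" and \<beta>: "0 \<le> \<beta>" "\<beta> \<le> s" and total: "real D * s + real D * (real D - 1) * \<beta> = 1"
  obtains \<sigma> where "separable D \<sigma>"
    "\<And>a b a' b'. a < D \<Longrightarrow> b < D \<Longrightarrow> a' < D \<Longrightarrow> b' < D \<Longrightarrow>
      \<sigma> (a, b) (a', b') = complex_of_real
        (if a = b \<and> a' = b' then (if a = a' then s else \<beta>) else if a = a' \<and> b = b' then \<beta> else 0)"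
proof -
  let ?N = "card (phases D)"
  define v where "v f i = of_real (1 / sqrt (real D)) * \<i> ^ f i" for f :: "nat \<Rightarrow> nat" and i
  define e where "e a i = (if i = a then 1 else 0 :: complex)" for a i :: nat
  define A where "A x = (case x of Inl f \<Rightarrow> (\<lambda>i j. v f i * cnj (v f j)) | Inr a \<Rightarrow> (\<lambda>i j. e a i * cnj (e a j)))" for x
  define B where "B x = (case x of Inl f \<Rightarrow> (\<lambda>i j. cnj (v f i) * cnj (cnj (v f j))) | Inr a \<Rightarrow> (\<lambda>i j. e a i * cnj (e a j)))" for x
  \<comment> \<open>Entries of a phase state have modulus 1/D^2, so these states carry total weight
    \<open>\<beta> * D^2\<close>; with \<open>D * (s - \<beta>)\<close> for the basis states the sum
    is the left side of \<open>total\<close>.\<close>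
  define p where "p x = (case x of Inl f \<Rightarrow> \<beta> * (real D)\<^sup>2 / real ?N | Inr a \<Rightarrow> s - \<beta>)"
    for x :: "(nat \<Rightarrow> nat) + nat"
  define S where "S = phases D <+> {..<D}"
  define \<sigma> where "\<sigma> = (\<lambda>u w. \<Sum>x\<in>S. complex_of_real (p x) * mtensor (A x) (B x) u w)"
  have finP: "finite (phases D)" by (intro finite_PiE) auto
  have "phases D \<noteq> {}" by (simp add: PiE_eq_empty_iff lessThan_empty_iff)
  then have N: "?N > 0" using finP by (simp add: card_gt_0_iff)
  have r2: "complex_of_real (1 / sqrt (real D)) * complex_of_real (1 / sqrt (real D)) = 1 / of_nat D"
    using D by (simp flip: of_real_mult)
  have vv: "v f i * cnj (v f j) = (1 / of_nat D) * (\<i> ^ f i * cnj (\<i> ^ f j))" for f i j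
    unfolding v_def r2[symmetric] by (simp add: mult_ac)
  have ii: "\<i> ^ m * cnj (\<i> ^ m) = 1" for m
    by (simp flip: power_mult_distrib)
  have dv: "(\<Sum>i<D. v f i * cnj (v f i)) = 1" for f
    unfolding vv ii using D by simp
  have de: "(\<Sum>i<D. e a i * cnj (e a i)) = 1" if "a < D" for a
    using that by (simp add: e_def if_distrib if_distribR sum.delta cong: if_cong)
  have "separable D \<sigma>"
    unfolding \<sigma>_def
  proof (rule separable_finite_sumI)
    show "finite S" using finP by (simp add: S_def)
    show "0 \<le> p x" for x using \<beta> by (auto simp: p_def split: sum.splits)
    have "(\<Sum>x\<in>S. p x) = real ?N * (\<beta> * (real D)\<^sup>2 / real ?N) + real D * (s - \<beta>)"
      unfolding S_def by (subst sum.Plus) (use finP in \<open>auto simp: p_def o_def\<close>)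
    also have "\<dots> = real D * s + real D * (real D - 1) * \<beta>"
      using N by (simp add: power2_eq_square algebra_simps)
    finally show "(\<Sum>x\<in>S. p x) = 1" using total by simp
    fix x assume x: "x \<in> S"
    show "density_on {..<D} (A x)"
    proof (cases x)
      case (Inl f)
      then show ?thesis using density_rank_one[OF _ dv, of f] by (simp add: A_def)
    next
      case (Inr a)
      then show ?thesis using density_rank_one[OF _ de, of a] x by (auto simp: A_def S_def)
    qed
    show "density_on {..<D} (B x)"
    proof (cases x)
      case (Inl f)
      have "(\<Sum>i<D. cnj (v f i) * cnj (cnj (v f i))) = 1"
        using dv[of f] by (simp add: mult.commute)
      from density_rank_one[OF _ this] show ?thesis using Inl by (simp add: B_def)
    next
      case (Inr a)
      then show ?thesis using density_rank_one[OF _ de, of a] x by (auto simp: B_def S_def)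
    qed
  qed
  moreover have "\<sigma> (a, b) (a', b') = complex_of_real
        (if a = b \<and> a' = b' then (if a = a' then s else \<beta>) else if a = a' \<and> b = b' then \<beta> else 0)"
    if lt: "a < D" "b < D" "a' < D" "b' < D" for a b a' b'
  proof -
    have "\<sigma> (a, b) (a', b') = (\<Sum>f\<in>phases D. complex_of_real (p (Inl f)) * mtensor (A (Inl f)) (B (Inl f)) (a, b) (a', b'))
        + (\<Sum>c<D. complex_of_real (p (Inr c)) * mtensor (A (Inr c)) (B (Inr c)) (a, b) (a', b'))"
      unfolding \<sigma>_def S_def by (subst sum.Plus) (use finP in \<open>auto simp: o_def\<close>)
    also have "(\<Sum>f\<in>phases D. complex_of_real (p (Inl f)) * mtensor (A (Inl f)) (B (Inl f)) (a, b) (a', b'))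
        = (\<Sum>f\<in>phases D. of_real (\<beta> / real ?N) * phase_product a a' b b' f)"
    proof (intro sum.cong refl)
      fix f
      have "mtensor (A (Inl f)) (B (Inl f)) (a, b) (a', b') = (v f a * cnj (v f a')) * (v f b' * cnj (v f b))"
        by (simp add: mtensor_def A_def B_def mult_ac)
      also have "\<dots> = 1 / (of_nat D)\<^sup>2 * phase_product a a' b b' f"
        unfolding vv phase_product_def by (simp add: power2_eq_square mult_ac)
      finally show "complex_of_real (p (Inl f)) * mtensor (A (Inl f)) (B (Inl f)) (a, b) (a', b')
          = of_real (\<beta> / real ?N) * phase_product a a' b b' f"
        using D by (simp add: p_def)
    qed
    also have "\<dots> = (if a = a' \<and> b = b' \<or> a = b \<and> a' = b' then of_real \<beta> else 0)"
      unfolding sum_distrib_left[symmetric] phases_sum[OF lt(1,3,2,4)] using N by simp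
    also have "(\<Sum>c<D. complex_of_real (p (Inr c)) * mtensor (A (Inr c)) (B (Inr c)) (a, b) (a', b'))
        = (\<Sum>c<D. if c = a then (if a = b \<and> a = a' \<and> a = b' then of_real (s - \<beta>) else 0) else 0)"
      by (intro sum.cong refl) (auto simp: mtensor_def A_def B_def p_def e_def)
    also have "\<dots> = (if a = b \<and> a = a' \<and> a = b' then of_real (s - \<beta>) else 0)"
      using lt by simp
    finally show ?thesis
      by (cases "a = b"; cases "a' = b'"; cases "a = a'"; cases "b = b'") simp_all
  qed
  ultimately show ?thesis using that by blast
qed

section \<open>The trace norm of the difference\<close>

lemma sum_pairs_diag:
  fixes g :: "nat \<Rightarrow> nat \<Rightarrow> complex"
  assumes "\<And>c c'. c < D \<Longrightarrow> c' < D \<Longrightarrow> c \<noteq> c' \<Longrightarrow> g c c' = 0"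
  shows "(\<Sum>(c, c')\<in>{..<D} \<times> {..<D}. g c c') = (\<Sum>c<D. g c c)"
proof -
  have "(\<Sum>(c, c')\<in>{..<D} \<times> {..<D}. g c c') = (\<Sum>c<D. \<Sum>c'<D. g c c')"
    by (simp add: sum.cartesian_product)
  also have "\<dots> = (\<Sum>c<D. \<Sum>c'<D. if c' = c then g c c else 0)"
    using assms by (intro sum.cong refl) auto
  finally show ?thesis by simp
qed

text \<open>On the span of the vectors \<open>|aa\<rangle>\<close> the matrix is \<open>\<delta> (J - 1)\<close> with \<open>J\<close> the all-ones matrix; its
  absolute value is \<open>\<delta> (1 + (1 - 2/D) J)\<close>.\<close>

lemma trace_norm_offdiag:
  assumes D: "0 < D" and \<delta>: "0 \<le> \<delta>"
    and X: "\<And>a b a' b'. a < D \<Longrightarrow> b < D \<Longrightarrow> a' < D \<Longrightarrow> b' < D \<Longrightarrow>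
      X (a, b) (a', b') = complex_of_real (if a = b \<and> a' = b' \<and> a \<noteq> a' then \<delta> else 0)"
  shows "trace_norm ({..<D} \<times> {..<D}) X = 2 * (real D - 1) * \<delta>"
proof -
  let ?I = "{..<D} \<times> {..<D}"
  \<comment> \<open>\<open>J - 1\<close> acts as \<open>D - 1\<close> on the all-ones vector and as
    -1 on its complement; absolute values \<open>D - 1\<close> and 1 belong to 1 + ((D - 2)/D)
    J.\<close>
  define t where "t = 1 - 2 / real D"
  define B0 where "B0 a a' = \<delta> * ((if a = a' then 1 else 0) + t)" for a a' :: nat
  define B where "B = (\<lambda>(a, b) (a', b'). if a = b \<and> a' = b' \<and> a < D \<and> a' < D then complex_of_real (B0 a a') else 0)"
  have sup: "supported_on ?I B"
    by (auto simp: supported_on_def B_def)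
  have psd: "psd_on ?I B"
    unfolding psd_on_def
  proof (intro conjI allI)
    show "hermitian_on ?I B"
      by (auto simp: hermitian_on_def B_def B0_def)
    fix x :: "nat \<times> nat \<Rightarrow> complex"
    define y where "y a = x (a, a)" for a
    have "(\<Sum>i\<in>?I. \<Sum>j\<in>?I. cnj (x i) * B i j * x j)
        = (\<Sum>(a, b)\<in>?I. \<Sum>(a', b')\<in>?I. cnj (x (a, b)) * B (a, b) (a', b') * x (a', b'))"
      by (simp add: case_prod_beta')
    also have "\<dots> = (\<Sum>a<D. \<Sum>(a', b')\<in>?I. cnj (x (a, a)) * B (a, a) (a', b') * x (a', b'))"
      by (rule sum_pairs_diag) (auto simp: B_def intro!: sum.neutral)
    also have "\<dots> = (\<Sum>a<D. \<Sum>a'<D. cnj (y a) * of_real (B0 a a') * y a')"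
    proof (intro sum.cong refl)
      fix a assume a: "a \<in> {..<D}"
      have "(\<Sum>(a', b')\<in>?I. cnj (x (a, a)) * B (a, a) (a', b') * x (a', b'))
          = (\<Sum>a'<D. cnj (x (a, a)) * B (a, a) (a', a') * x (a', a'))"
        by (rule sum_pairs_diag) (auto simp: B_def)
      then show "(\<Sum>(a', b')\<in>?I. cnj (x (a, a)) * B (a, a) (a', b') * x (a', b'))
          = (\<Sum>a'<D. cnj (y a) * of_real (B0 a a') * y a')"
        using a by (simp add: B_def y_def)
    qed
    also have "\<dots> = of_real \<delta> * ((\<Sum>a<D. cnj (y a) * y a) + of_real t * (cnj (\<Sum>a<D. y a) * (\<Sum>a<D. y a)))"
    proof -
      have "(\<Sum>a<D. \<Sum>a'<D. cnj (y a) * of_real (B0 a a') * y a')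
          = (\<Sum>a<D. \<Sum>a'<D. of_real \<delta> * ((if a' = a then cnj (y a) * y a else 0) + of_real t * (cnj (y a) * y a')))"
        by (intro sum.cong refl) (auto simp: B0_def algebra_simps)
      also have "\<dots> = of_real \<delta> * ((\<Sum>a<D. cnj (y a) * y a) + of_real t * (\<Sum>a<D. \<Sum>a'<D. cnj (y a) * y a'))"
        by (simp add: sum_distrib_left[symmetric] sum.distrib)
      finally show ?thesis by (simp add: sum_product)
    qed
    also have "\<dots> = of_real (\<delta> * ((\<Sum>a<D. (cmod (y a))\<^sup>2) + t * (cmod (\<Sum>a<D. y a))\<^sup>2))"
      unfolding of_real_mult of_real_add of_real_sum complex_norm_square by (simp only: mult.commute)
    finally have "Re (\<Sum>i\<in>?I. \<Sum>j\<in>?I. cnj (x i) * B i j * x j)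
        = \<delta> * ((\<Sum>a<D. (cmod (y a))\<^sup>2) + t * (cmod (\<Sum>a<D. y a))\<^sup>2)" by simp
    also have "\<dots> \<ge> 0"
    proof (cases "D = 1")
      \<comment> \<open>Here \<open>t\<close> is -1, but with a single coordinate the two terms
        cancel.\<close>
      case True
      then show ?thesis by (simp add: t_def)
    next
      case False
      then have "0 \<le> t" using D by (simp add: t_def field_simps)
      then show ?thesis using \<delta> by (intro mult_nonneg_nonneg add_nonneg_nonneg sum_nonneg) auto
    qed
    finally show "0 \<le> Re (\<Sum>i\<in>?I. \<Sum>j\<in>?I. cnj (x i) * B i j * x j)" .
  qed
  have sq: "mmult ?I B B i j = mmult ?I (madj X) X i j" if i: "i \<in> ?I" and j: "j \<in> ?I" for i j
  proof -
    obtain a b a' b' where ij: "i = (a, b)" "j = (a', b')" by (cases i; cases j)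
    have lt: "a < D" "b < D" "a' < D" "b' < D" using i j ij by auto
    have 1: "mmult ?I B B i j = (\<Sum>c<D. B (a, b) (c, c) * B (c, c) (a', b'))"
    proof -
      have "mmult ?I B B i j = (\<Sum>(c, c')\<in>?I. B (a, b) (c, c') * B (c, c') (a', b'))"
        by (simp add: mmult_def ij case_prod_beta')
      also have "\<dots> = (\<Sum>c<D. B (a, b) (c, c) * B (c, c) (a', b'))"
        by (rule sum_pairs_diag) (auto simp: B_def)
      finally show ?thesis .
    qed
    have 2: "mmult ?I (madj X) X i j = (\<Sum>c<D. cnj (X (c, c) (a, b)) * X (c, c) (a', b'))"
    proof -
      have "mmult ?I (madj X) X i j = (\<Sum>(c, c')\<in>?I. cnj (X (c, c') (a, b)) * X (c, c') (a', b'))"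
        by (simp add: mmult_def madj_def ij case_prod_beta')
      also have "\<dots> = (\<Sum>c<D. cnj (X (c, c) (a, b)) * X (c, c) (a', b'))"
        by (rule sum_pairs_diag) (use lt in \<open>auto simp: X\<close>)
      finally show ?thesis .
    qed
    show ?thesis
    proof (cases "a = b \<and> a' = b'")
      case False
      then have "mmult ?I B B i j = 0" "mmult ?I (madj X) X i j = 0"
        unfolding 1 2 using lt by (auto simp: B_def X intro!: sum.neutral)
      then show ?thesis by simp
    next
      case True
      \<comment> \<open>Both squares equal \<open>1 + (D - 2) J\<close> up to the factor \<delta>^2:
        here because \<open>J J = D J\<close>, further below by counting the indices
        \<open>c\<close> different from \<open>a\<close> and \<open>a'\<close>.\<close>
      have "(\<Sum>c<D. B0 a c * B0 c a') = \<delta>\<^sup>2 * ((if a = a' then 1 else 0) + 2 * t + real D * t\<^sup>2)"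
      proof -
        have "(\<Sum>c<D. B0 a c * B0 c a') = (\<Sum>c<D. \<delta>\<^sup>2 * ((if c = a then (if a = a' then 1 else 0) else 0)
            + t * (if c = a then 1 else 0) + t * (if c = a' then 1 else 0) + t\<^sup>2))"
          by (intro sum.cong refl) (auto simp: B0_def power2_eq_square algebra_simps)
        then show ?thesis
          using lt by (simp add: sum_distrib_left[symmetric] sum.distrib)
      qed
      also have "\<dots> = \<delta>\<^sup>2 * ((if a = a' then 1 else 0) + (real D - 2))"
      proof -
        have "real D * t = real D - 2" using D by (simp add: t_def field_simps)
        then have "real D * t\<^sup>2 = (real D - 2) * t" by (simp add: power2_eq_square mult.assoc[symmetric])
        then have "2 * t + real D * t\<^sup>2 = real D - 2"
          using \<open>real D * t = real D - 2\<close> by (simp add: algebra_simps)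
        then show ?thesis by (simp only: add.assoc)
      qed
      also have "\<dots> = (\<Sum>c<D. (if c \<noteq> a then \<delta> else 0) * (if c \<noteq> a' then \<delta> else 0))"
      proof -
        have "(\<Sum>c<D. (if c \<noteq> a then \<delta> else 0) * (if c \<noteq> a' then \<delta> else 0))
            = (\<Sum>c<D. \<delta>\<^sup>2 * (1 - (if c = a then 1 else 0) - (if c = a' then 1 else 0)
              + (if c = a then (if a = a' then 1 else 0) else 0)))"
          by (intro sum.cong refl) (auto simp: power2_eq_square)
        then show ?thesis
          using lt by (simp add: sum_distrib_left[symmetric] sum.distrib sum_subtractf algebra_simps)
      qed
      finally have "complex_of_real (\<Sum>c<D. B0 a c * B0 c a')
          = complex_of_real (\<Sum>c<D. (if c \<noteq> a then \<delta> else 0) * (if c \<noteq> a' then \<delta> else 0))" by simp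
      moreover have "mmult ?I B B i j = complex_of_real (\<Sum>c<D. B0 a c * B0 c a')"
        unfolding 1 of_real_sum using True lt by (intro sum.cong refl) (simp add: B_def)
      moreover have "mmult ?I (madj X) X i j
          = complex_of_real (\<Sum>c<D. (if c \<noteq> a then \<delta> else 0) * (if c \<noteq> a' then \<delta> else 0))"
        unfolding 2 of_real_sum using True lt by (intro sum.cong refl) (simp add: X)
      ultimately show ?thesis by simp
    qed
  qed
  have "mtrace ?I B = (\<Sum>(c, c')\<in>?I. B (c, c') (c, c'))"
    by (simp add: mtrace_def case_prod_beta')
  also have "\<dots> = (\<Sum>c<D. B (c, c) (c, c))"
    by (rule sum_pairs_diag) (auto simp: B_def)
  also have "\<dots> = (\<Sum>c<D. complex_of_real (\<delta> * (1 + t)))"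
    by (intro sum.cong refl) (auto simp: B_def B0_def)
  finally have "Re (mtrace ?I B) = real D * (\<delta> * (1 + t))" by simp
  also have "\<dots> = 2 * (real D - 1) * \<delta>"
    using D by (simp add: t_def field_simps)
  finally show ?thesis
    using trace_norm_eqI[OF _ psd sup sq] by simp
qed

theorem theorem2:
  shows "\<exists>(m :: nat \<Rightarrow> nat) (c :: nat) (e :: nat) (q :: real poly).
     (\<forall>n. even (m n) \<and> 2 \<le> m n \<and> m n \<le> c * (n + 1) ^ e) \<and>
     degree q \<ge> 1 \<and> lead_coeff q > 0 \<and>
     (\<forall>n. (INF \<sigma> \<in> Collect (separable (2^n)).
            trace_norm ({..<2^n} \<times> {..<2^n}) (\<lambda>x y. rho12 n (m n) x y - \<sigma> x y))
          < 1 / poly q (real n))"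
proof -
  have main: "(INF \<sigma> \<in> Collect (separable (2^n)).
      trace_norm ({..<2^n} \<times> {..<2^n}) (\<lambda>x y. rho12 n (2 * Suc n) x y - \<sigma> x y)) < 2 / real (Suc n)" for n
  proof -
    let ?D = "2 ^ n :: nat"
    obtain s \<beta> :: real where sb: "0 \<le> \<beta>" "\<beta> \<le> s" "real ?D * s + real ?D * (real ?D - 1) * \<beta> = 1"
      and rho: "\<And>a b a' b'. a < ?D \<Longrightarrow> b < ?D \<Longrightarrow> a' < ?D \<Longrightarrow> b' < ?D \<Longrightarrow>
        rho12 n (2 * Suc n) (a, b) (a', b') = complex_of_real
        (if a = b \<and> a' = b' then (if a = a' then s else \<beta> + 1 / (real (Suc n) * real ?D))
         else if a = a' \<and> b = b' then \<beta> else 0)"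
      using rho12_structure[of n] by metis
    have D: "0 < ?D" by simp
    obtain \<sigma> where \<sigma>: "separable ?D \<sigma>"
      "\<And>a b a' b'. a < ?D \<Longrightarrow> b < ?D \<Longrightarrow> a' < ?D \<Longrightarrow> b' < ?D \<Longrightarrow>
        \<sigma> (a, b) (a', b') = complex_of_real
        (if a = b \<and> a' = b' then (if a = a' then s else \<beta>) else if a = a' \<and> b = b' then \<beta> else 0)"
      using separable_approximant[OF D sb] by metis
    let ?tn = "\<lambda>\<sigma>. trace_norm ({..<?D} \<times> {..<?D}) (\<lambda>x y. rho12 n (2 * Suc n) x y - \<sigma> x y)"
    have "(INF \<sigma> \<in> Collect (separable ?D). ?tn \<sigma>) \<le> ?tn \<sigma>"
      by (rule cINF_lower) (use \<sigma> in \<open>auto intro!: bdd_belowI2[of _ 0] trace_norm_nonneg\<close>)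
    also have "?tn \<sigma> = 2 * (real ?D - 1) * (1 / (real (Suc n) * real ?D))"
    proof (rule trace_norm_offdiag[OF D])
      fix a b a' b' assume lt: "a < ?D" "b < ?D" "a' < ?D" "b' < ?D"
      show "rho12 n (2 * Suc n) (a, b) (a', b') - \<sigma> (a, b) (a', b') = complex_of_real
          (if a = b \<and> a' = b' \<and> a \<noteq> a' then 1 / (real (Suc n) * real ?D) else 0)"
        unfolding rho[OF lt] \<sigma>(2)[OF lt] by auto
    qed simp
    also have "\<dots> = 2 / real (Suc n) - 2 / (real (Suc n) * real ?D)"
    proof -
      have "2 * (d - 1) * (1 / (N * d)) = 2 / N - 2 / (N * d)" if "N > 0" "d > 0" for N d :: real
        using that by (simp add: field_simps)
      from this[of "real (Suc n)" "real ?D"] show ?thesis using D by (simp only: of_nat_0_less_iff zero_less_Suc simp_thms)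
    qed
    \<comment> \<open>Strictness comes from the positive term subtracted above, the contribution of
      the -1 in \<open>D - 1\<close>.\<close>
    also have "\<dots> < 2 / real (Suc n)" by simp
    finally show ?thesis .
  qed
  show ?thesis
  proof (intro exI conjI allI)
    \<comment> \<open>The witness \<open>m n = 2 (n + 1)\<close> stands for \<open>n + 1\<close>
      pairs, and \<open>q\<close> is the linear polynomial with value \<open>(n + 1) / 2\<close>,
      the reciprocal of the bound just obtained.\<close>
    fix n :: nat
    show "even (2 * Suc n)" "2 \<le> 2 * Suc n" "2 * Suc n \<le> 2 * (n + 1) ^ 1" by simp_all
    show "degree [:1/2, 1/2 :: real:] \<ge> 1" "lead_coeff [:1/2, 1/2 :: real:] > 0" by simp_all
    have "1 / poly [:1/2, 1/2:] (real n) = 2 / real (Suc n)"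
      by (simp add: field_simps)
    then show "(INF \<sigma> \<in> Collect (separable (2^n)).
      trace_norm ({..<2^n} \<times> {..<2^n}) (\<lambda>x y. rho12 n (2 * Suc n) x y - \<sigma> x y)) < 1 / poly [:1/2, 1/2:] (real n)"
      using main[of n] by simp
  qed
qed

end
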